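(* Let $p \in (1, \infty) \setminus \{ 2 \}$ and let $(X, \mu)$ be a decomposable measure space. Then the algebra $\mathbb{K}(L^p(X,\mu))$ of compact operators on $L^p(X,\mu)$ is $M$-approximately unital if and only if $\mu$ is purely atomic.
   Context: A measure space $(X,\mu)$ is decomposable if $X$ can be partitioned into sets $X_i$ ($i\in I$) of finite measure such that $F\subseteq X$ is measurable if and only if $F\cap X_i$ is measurable for every $i$, and then $\mu(F)=\sum_{i} \mu(F\cap X_i)$. A unital Banach algebra is one with an identity of norm $1$. A cai is a contractive approximate identity. Approximately unital means having a cai. Multiplier unitization: for a nonunital approximately unital Banach algebra $A$, $A^1 = A + \mathbb{C}1$ with norm $\|a+\lambda 1\| = \sup\{\|ac+\lambda c\| : c \in A, \|c\|\le 1\}$; if $A$ is unital, $A^1 = A$. An idempotent $P\in B(E)$ on a Banach space $E$ is an $L$-projection if $\|\xi\| = \|P\xi\| + \|(1-P)\xi\|$ for all $\xi\in E$; ranges of $L$-projections are called $L$-summands. A closed subspace $J\subseteq E$ is an $M$-ideal if $J^\perp$ is an $L$-summand in $E^*$. An approximately unital Banach algebra $A$ is $M$-approximately unital if $A$ is an $M$-ideal in $A^1$. (The algebra $\mathbb{K}(L^p(X,\mu))$ is approximately unital.) *)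

theory Defs
  imports "HOL-Analysis.Analysis" "HOL-Algebra.Module"
begin

section \<open>Complex normed spaces and Banach algebras on a carrier set\<close>

text \<open>
  The spaces \<open>L\<^sup>p(X,\<mu>)\<close> depend on the parameters \<open>p\<close> and \<open>\<mu>\<close>, so they cannot be
  instances of the type classes of normed spaces.  We extend the module record
  of HOL-Algebra by a norm.  The fields \<open>mult\<close> and \<open>one\<close> are
  meaningless for mere spaces.  Algebras need not be unital, so their \<open>one\<close> need not be
  an element of the carrier either.
\<close>

record 'v normed_module = "(complex, 'v) module" +
  nrm :: "'v \<Rightarrow> real"

definition complex_scalars :: "complex ring" where
  "complex_scalars = \<lparr>carrier = UNIV, mult = (*), one = 1, zero = 0, add = (+)\<rparr>"

definition complex_line :: "complex normed_module" where
  "complex_line =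
    \<lparr>carrier = UNIV, mult = (*), one = 1, zero = 0, add = (+), smult = (*), nrm = cmod\<rparr>"

text \<open>The distance is cut off outside the carrier because \<^locale>\<open>Metric_space\<close> requires
  symmetry and non-negativity everywhere.\<close>

definition norm_dist :: "'v normed_module \<Rightarrow> 'v \<Rightarrow> 'v \<Rightarrow> real" where
  "norm_dist E x y =
    (if x \<in> carrier E \<and> y \<in> carrier E then nrm E (x \<ominus>\<^bsub>E\<^esub> y) else 0)"

abbreviation norm_topology :: "'v normed_module \<Rightarrow> 'v topology" where
  "norm_topology E \<equiv> Metric_space.mtopology (carrier E) (norm_dist E)"

definition unit_ball :: "'v normed_module \<Rightarrow> 'v set" where
  "unit_ball E = {x \<in> carrier E. nrm E x \<le> 1}"

locale complex_normed_space = Module.module complex_scalars E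
  for E :: "'v normed_module" (structure) +
  assumes nrm_nonneg: "x \<in> carrier E \<Longrightarrow> 0 \<le> nrm E x"
    and nrm_eq_0_iff: "x \<in> carrier E \<Longrightarrow> nrm E x = 0 \<longleftrightarrow> x = \<zero>"
    and nrm_triangle:
      "\<lbrakk>x \<in> carrier E; y \<in> carrier E\<rbrakk> \<Longrightarrow> nrm E (x \<oplus> y) \<le> nrm E x + nrm E y"
    and nrm_smult: "x \<in> carrier E \<Longrightarrow> nrm E (c \<odot> x) = cmod c * nrm E x"

locale complex_banach_space = complex_normed_space +
  assumes complete: "Metric_space.mcomplete (carrier E) (norm_dist E)"

locale complex_banach_algebra = complex_banach_space A
  for A :: "'v normed_module" (structure) +
  assumes mult_closed: "\<lbrakk>x \<in> carrier A; y \<in> carrier A\<rbrakk> \<Longrightarrow> x \<otimes> y \<in> carrier A"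
    and mult_assoc: "\<lbrakk>x \<in> carrier A; y \<in> carrier A; z \<in> carrier A\<rbrakk>
      \<Longrightarrow> (x \<otimes> y) \<otimes> z = x \<otimes> (y \<otimes> z)"
    and distrib_left: "\<lbrakk>x \<in> carrier A; y \<in> carrier A; z \<in> carrier A\<rbrakk>
      \<Longrightarrow> x \<otimes> (y \<oplus> z) = x \<otimes> y \<oplus> x \<otimes> z"
    and distrib_right: "\<lbrakk>x \<in> carrier A; y \<in> carrier A; z \<in> carrier A\<rbrakk>
      \<Longrightarrow> (x \<oplus> y) \<otimes> z = x \<otimes> z \<oplus> y \<otimes> z"
    and smult_mult_left: "\<lbrakk>x \<in> carrier A; y \<in> carrier A\<rbrakk>
      \<Longrightarrow> (c \<odot> x) \<otimes> y = c \<odot> (x \<otimes> y)"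
    and smult_mult_right: "\<lbrakk>x \<in> carrier A; y \<in> carrier A\<rbrakk>
      \<Longrightarrow> x \<otimes> (c \<odot> y) = c \<odot> (x \<otimes> y)"
    and nrm_mult: "\<lbrakk>x \<in> carrier A; y \<in> carrier A\<rbrakk> \<Longrightarrow> nrm A (x \<otimes> y) \<le> nrm A x * nrm A y"


section \<open>Bounded operators and the dual space\<close>

text \<open>Operators are made extensional (\<open>undefined\<close> outside the carrier), so that equality of
  operators is equality of functions.\<close>

definition bounded_ops :: "'v normed_module \<Rightarrow> 'w normed_module \<Rightarrow> ('v \<Rightarrow> 'w) set" where
  "bounded_ops E F = {T \<in> carrier E \<rightarrow>\<^sub>E carrier F.
     (\<forall>x\<in>carrier E. \<forall>y\<in>carrier E. T (x \<oplus>\<^bsub>E\<^esub> y) = T x \<oplus>\<^bsub>F\<^esub> T y) \<and>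
     (\<forall>c. \<forall>x\<in>carrier E. T (c \<odot>\<^bsub>E\<^esub> x) = c \<odot>\<^bsub>F\<^esub> T x) \<and>
     (\<exists>K. \<forall>x\<in>carrier E. nrm F (T x) \<le> K * nrm E x)}"

definition op_nrm :: "'v normed_module \<Rightarrow> 'w normed_module \<Rightarrow> ('v \<Rightarrow> 'w) \<Rightarrow> real" where
  "op_nrm E F T = (SUP x\<in>unit_ball E. nrm F (T x))"

definition op_space :: "'v normed_module \<Rightarrow> 'w normed_module \<Rightarrow> ('v \<Rightarrow> 'w) normed_module" where
  "op_space E F =
    \<lparr>carrier = bounded_ops E F,
     mult = undefined, one = undefined,
     zero = (\<lambda>x\<in>carrier E. \<zero>\<^bsub>F\<^esub>),
     add = (\<lambda>S T. \<lambda>x\<in>carrier E. S x \<oplus>\<^bsub>F\<^esub> T x),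
     smult = (\<lambda>c T. \<lambda>x\<in>carrier E. c \<odot>\<^bsub>F\<^esub> T x),
     nrm = op_nrm E F\<rparr>"

definition op_algebra :: "'v normed_module \<Rightarrow> ('v \<Rightarrow> 'v) normed_module" where
  "op_algebra E = (op_space E E)
    \<lparr>mult := compose (carrier E), one := (\<lambda>x\<in>carrier E. x)\<rparr>"

definition dual_space :: "'v normed_module \<Rightarrow> ('v \<Rightarrow> complex) normed_module" where
  "dual_space E = op_space E complex_line"

definition compact_op :: "'v normed_module \<Rightarrow> ('v \<Rightarrow> 'v) \<Rightarrow> bool" where
  "compact_op E T \<longleftrightarrow> T \<in> bounded_ops E E \<and>
     compactin (norm_topology E) (norm_topology E closure_of (T ` unit_ball E))"

text \<open>The field \<open>one\<close> inherited from \<^const>\<open>op_algebra\<close> is meaningless here if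
  the identity operator is not compact.\<close>

definition compact_op_algebra :: "'v normed_module \<Rightarrow> ('v \<Rightarrow> 'v) normed_module" where
  "compact_op_algebra E = (op_algebra E)\<lparr>carrier := {T. compact_op E T}\<rparr>"


section \<open>M-ideals\<close>

definition L_projection :: "'v normed_module \<Rightarrow> ('v \<Rightarrow> 'v) \<Rightarrow> bool" where
  "L_projection E P \<longleftrightarrow> P \<in> bounded_ops E E \<and> compose (carrier E) P P = P \<and>
     (\<forall>x\<in>carrier E. nrm E x = nrm E (P x) + nrm E (x \<ominus>\<^bsub>E\<^esub> P x))"

definition L_summand :: "'v normed_module \<Rightarrow> 'v set \<Rightarrow> bool" where
  "L_summand E J \<longleftrightarrow> (\<exists>P. L_projection E P \<and> J = P ` carrier E)"

definition annihilator :: "'v normed_module \<Rightarrow> 'v set \<Rightarrow> ('v \<Rightarrow> complex) set" where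
  "annihilator E J = {f \<in> carrier (dual_space E). \<forall>x\<in>J. f x = 0}"

definition M_ideal :: "'v normed_module \<Rightarrow> 'v set \<Rightarrow> bool" where
  "M_ideal E J \<longleftrightarrow> submodule J complex_scalars E \<and> closedin (norm_topology E) J \<and>
     L_summand (dual_space E) (annihilator E J)"


section \<open>Approximate identities and the multiplier unitization\<close>

definition unital :: "'v normed_module \<Rightarrow> bool" where
  "unital A \<longleftrightarrow>
    (\<exists>e\<in>carrier A. nrm A e = 1 \<and> (\<forall>a\<in>carrier A. e \<otimes>\<^bsub>A\<^esub> a = a \<and> a \<otimes>\<^bsub>A\<^esub> e = a))"

text \<open>A contractive approximate identity is a net \<open>(e\<^sub>t)\<close> in the unit ball with
  \<open>e\<^sub>t a \<longlongrightarrow> a\<close> and \<open>a e\<^sub>t \<longlongrightarrow> a\<close>; as elsewhere in the library, nets are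
  represented by proper filters, here the image on \<open>A\<close> of the filter of tails of the net.\<close>

definition approximately_unital :: "'v normed_module \<Rightarrow> bool" where
  "approximately_unital A \<longleftrightarrow>
    (\<exists>\<F>. \<F> \<noteq> bot \<and> (\<forall>\<^sub>F e in \<F>. e \<in> unit_ball A) \<and>
      (\<forall>a\<in>carrier A. ((\<lambda>e. nrm A (e \<otimes>\<^bsub>A\<^esub> a \<ominus>\<^bsub>A\<^esub> a)) \<longlongrightarrow> 0) \<F> \<and>
                     ((\<lambda>e. nrm A (a \<otimes>\<^bsub>A\<^esub> e \<ominus>\<^bsub>A\<^esub> a)) \<longlongrightarrow> 0) \<F>))"

text \<open>
  The pair \<open>(a, s)\<close> stands for \<open>a + s1\<close>, and \<open>A\<close> sits in \<open>A\<^sup>1\<close> as \<open>A \<times> {0}\<close>; this is all of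
  \<open>A\<^sup>1\<close> if \<open>A\<close> is unital.  The zero algebra has an identity, but not one of norm 1.  For it
  the multiplier formula would vanish on all of \<open>\<complex>1\<close> and hence not be a norm; it is treated like
  the algebras with identity, so that its unitization is again zero.
\<close>

definition mult_unitization :: "'v normed_module \<Rightarrow> ('v \<times> complex) normed_module" where
  "mult_unitization A =
    (let own = unital A \<or> carrier A = {\<zero>\<^bsub>A\<^esub>} in
     \<lparr>carrier = (if own then carrier A \<times> {0} else carrier A \<times> UNIV),
      mult = (\<lambda>(a, s) (b, t).
        ((a \<otimes>\<^bsub>A\<^esub> b \<oplus>\<^bsub>A\<^esub> s \<odot>\<^bsub>A\<^esub> b) \<oplus>\<^bsub>A\<^esub> t \<odot>\<^bsub>A\<^esub> a, s * t)),
      one = (if own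
             then ((THE e. e \<in> carrier A \<and> (\<forall>a\<in>carrier A. e \<otimes>\<^bsub>A\<^esub> a = a \<and> a \<otimes>\<^bsub>A\<^esub> e = a)), 0)
             else (\<zero>\<^bsub>A\<^esub>, 1)),
      zero = (\<zero>\<^bsub>A\<^esub>, 0),
      add = (\<lambda>(a, s) (b, t). (a \<oplus>\<^bsub>A\<^esub> b, s + t)),
      smult = (\<lambda>r (a, s). (r \<odot>\<^bsub>A\<^esub> a, r * s)),
      nrm = (\<lambda>(a, s). if own then nrm A a
             else (SUP c\<in>unit_ball A. nrm A (a \<otimes>\<^bsub>A\<^esub> c \<oplus>\<^bsub>A\<^esub> s \<odot>\<^bsub>A\<^esub> c)))\<rparr>)"

definition M_approximately_unital :: "'v normed_module \<Rightarrow> bool" where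
  "M_approximately_unital A \<longleftrightarrow> complex_banach_algebra A \<and> approximately_unital A \<and>
     M_ideal (mult_unitization A) (carrier A \<times> {0})"


section \<open>Measure spaces and \<open>L\<^sup>p\<close>\<close>

definition decomposable :: "'a measure \<Rightarrow> bool" where
  "decomposable M \<longleftrightarrow> (\<exists>P. partition_on (space M) P \<and>
     (\<forall>A\<in>P. A \<in> sets M \<and> emeasure M A < \<infinity>) \<and>
     (\<forall>F. F \<subseteq> space M \<longrightarrow> (F \<in> sets M \<longleftrightarrow> (\<forall>A\<in>P. F \<inter> A \<in> sets M))) \<and>
     (\<forall>F\<in>sets M. emeasure M F = (\<Sum>\<^sub>\<infinity>A\<in>P. emeasure M (F \<inter> A))))"

text \<open>On decomposable spaces an atom automatically has finite measure.\<close>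

definition measure_atom :: "'a measure \<Rightarrow> 'a set \<Rightarrow> bool" where
  "measure_atom M A \<longleftrightarrow> A \<in> sets M \<and> emeasure M A > 0 \<and>
     (\<forall>B\<in>sets M. B \<subseteq> A \<longrightarrow> emeasure M B = 0 \<or> emeasure M (A - B) = 0)"

definition purely_atomic :: "'a measure \<Rightarrow> bool" where
  "purely_atomic M \<longleftrightarrow>
    (\<forall>E\<in>sets M. emeasure M E > 0 \<longrightarrow> (\<exists>A. A \<subseteq> E \<and> measure_atom M A))"

definition Lp_fun :: "real \<Rightarrow> 'a measure \<Rightarrow> ('a \<Rightarrow> complex) set" where
  "Lp_fun p M = {f \<in> borel_measurable M. integrable M (\<lambda>x. cmod (f x) powr p)}"

definition Lp_class :: "real \<Rightarrow> 'a measure \<Rightarrow> ('a \<Rightarrow> complex) \<Rightarrow> ('a \<Rightarrow> complex) set" where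
  "Lp_class p M f = {g \<in> Lp_fun p M. AE x in M. g x = f x}"

definition Lp_rep :: "('a \<Rightarrow> complex) set \<Rightarrow> 'a \<Rightarrow> complex" where
  "Lp_rep F = (SOME f. f \<in> F)"

definition Lp :: "real \<Rightarrow> 'a measure \<Rightarrow> ('a \<Rightarrow> complex) set normed_module" where
  "Lp p M =
    \<lparr>carrier = Lp_class p M ` Lp_fun p M,
     mult = undefined, one = undefined,
     zero = Lp_class p M (\<lambda>x. 0),
     add = (\<lambda>F G. Lp_class p M (\<lambda>x. Lp_rep F x + Lp_rep G x)),
     smult = (\<lambda>c F. Lp_class p M (\<lambda>x. c * Lp_rep F x)),
     nrm = (\<lambda>F. (LINT x|M. cmod (Lp_rep F x) powr p) powr (1 / p))\<rparr>"

end

(* For purely atomic \<mu>, the span of finitely many atoms is the range of an l^p-orthogonal projection P F,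
   and the P F form a two-sided approximate identity of K(L^p).  A functional f on K(L^p) + C1 splits as
   lam f * chi plus its "normal" part, where chi(a + s1) = s and lam f = f(1) - lim f(P F).  This is an
   L-decomposition because \<alpha> P F x P F + \<beta> (1 - P F) is a contraction for unimodular \<alpha>, \<beta> and
   every contraction x.

   Conversely, let \<mu> have an atomless part.  For unit vectors \<xi>, \<eta> the functional f(x) = <x \<xi>, \<eta>*>
   attains its norm on a rank-one operator, so the L-projection kills it and f + chi has norm 2.  This
   yields compact a with norm of a + 1 close to 1 and (a + 1) \<xi> close to \<eta>.  As a is compact, it
   almost kills a difference r of two indicators of independent sets, whence the norms of \<xi> + r and
   \<eta> + r agree (Kalton's property (M)).  Comparing a constant \<xi> with an \<eta> supported on half of
   the set gives a functional equation whose growth at infinity forces p = 2. *)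

theory Submission
  imports Defs
begin

text \<open>The converse is shaped by an order of quantifiers. The operator \<open>a\<close> depends
  on the accuracy, so r can be chosen only after \<open>a\<close>, and it is unknown in advance
  which r is almost killed. Hence a whole sequence of sets whose pairs all have the same statistics
  on both halves: whatever pair compactness selects, the norms of \<xi> + r and \<eta> + r are the
  same two numbers. The factor 2 ^ (1/p) is the one by which a constant must grow when its support
  is halved. No description of the dual of L^p is used. Duality is reduced to the explicit norming
  functional of a single vector, and uniform convexity is replaced by a pointwise strengthening of
  the tangent inequality for t ^ p. In the forward direction p > 1 enters through a (1 - P F) -> 0:
  for p = 1 a sum of N disjoint blocks may have norm N, and comparing growth rates gives nothing.
  Both directions need the multiplier norm of a + s1 to be its operator norm. For this it is enough
  that every vector is fixed by a compact contraction.\<close>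

section \<open>Normed spaces and bounded operators\<close>

lemma complex_scalars_simps [simp]:
  "carrier complex_scalars = UNIV" "a \<otimes>\<^bsub>complex_scalars\<^esub> b = a * b" "\<one>\<^bsub>complex_scalars\<^esub> = 1"
  "\<zero>\<^bsub>complex_scalars\<^esub> = 0" "a \<oplus>\<^bsub>complex_scalars\<^esub> b = a + b"
  by (simp_all add: complex_scalars_def)

lemma complex_line_simps [simp]:
  "carrier complex_line = UNIV" "\<zero>\<^bsub>complex_line\<^esub> = 0" "a \<oplus>\<^bsub>complex_line\<^esub> b = a + b"
  "a \<odot>\<^bsub>complex_line\<^esub> b = a * b" "nrm complex_line = cmod"
  by (simp_all add: complex_line_def)

lemma cring_complex_scalars: "cring complex_scalars"
proof -
  have "\<exists>y. x + y = 0" for x :: complex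
    by (rule exI[of _ "- x"]) simp
  then show ?thesis
    by (intro cringI abelian_groupI comm_monoidI) (simp_all add: algebra_simps)
qed

text \<open>Additive inverses are obtained as \<open>(-1) \<odot> x\<close>, and the norm of zero
  from homogeneity, so instances need to check neither.\<close>

lemma complex_normed_spaceI:
  fixes E :: "'v normed_module" (structure)
  assumes add: "\<And>x y. \<lbrakk>x \<in> carrier E; y \<in> carrier E\<rbrakk> \<Longrightarrow> x \<oplus> y \<in> carrier E"
    and zero: "\<zero> \<in> carrier E"
    and smult: "\<And>c x. x \<in> carrier E \<Longrightarrow> c \<odot> x \<in> carrier E"
    and assoc: "\<And>x y z. \<lbrakk>x \<in> carrier E; y \<in> carrier E; z \<in> carrier E\<rbrakk> \<Longrightarrow> (x \<oplus> y) \<oplus> z = x \<oplus> (y \<oplus> z)"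
    and comm: "\<And>x y. \<lbrakk>x \<in> carrier E; y \<in> carrier E\<rbrakk> \<Longrightarrow> x \<oplus> y = y \<oplus> x"
    and zero_left: "\<And>x. x \<in> carrier E \<Longrightarrow> \<zero> \<oplus> x = x"
    and smult_zero: "\<And>x. x \<in> carrier E \<Longrightarrow> 0 \<odot> x = \<zero>"
    and distr_left: "\<And>a b x. x \<in> carrier E \<Longrightarrow> (a + b) \<odot> x = a \<odot> x \<oplus> b \<odot> x"
    and distr_right: "\<And>a x y. \<lbrakk>x \<in> carrier E; y \<in> carrier E\<rbrakk> \<Longrightarrow> a \<odot> (x \<oplus> y) = a \<odot> x \<oplus> a \<odot> y"
    and smult_smult: "\<And>a b x. x \<in> carrier E \<Longrightarrow> (a * b) \<odot> x = a \<odot> (b \<odot> x)"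
    and smult_1: "\<And>x. x \<in> carrier E \<Longrightarrow> 1 \<odot> x = x"
    and nonneg: "\<And>x. x \<in> carrier E \<Longrightarrow> 0 \<le> nrm E x"
    and definite: "\<And>x. \<lbrakk>x \<in> carrier E; nrm E x = 0\<rbrakk> \<Longrightarrow> x = \<zero>"
    and triangle: "\<And>x y. \<lbrakk>x \<in> carrier E; y \<in> carrier E\<rbrakk> \<Longrightarrow> nrm E (x \<oplus> y) \<le> nrm E x + nrm E y"
    and homogeneous: "\<And>c x. x \<in> carrier E \<Longrightarrow> nrm E (c \<odot> x) = cmod c * nrm E x"
  shows "complex_normed_space E"
proof -
  have inv: "\<exists>y\<in>carrier E. y \<oplus> x = \<zero>" if "x \<in> carrier E" for x
    using that smult smult_zero[OF that] smult_1[OF that] distr_left[OF that, of "-1" 1]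
    by (intro bexI[of _ "(-1) \<odot> x"]) auto
  have "abelian_group E"
    by (intro abelian_groupI) (auto simp: add zero assoc zero_left inv intro: comm)
  then have "Module.module complex_scalars E"
    using cring_complex_scalars
    by (intro moduleI) (auto simp: smult distr_left distr_right smult_smult smult_1)
  moreover have "nrm E \<zero> = 0"
    using homogeneous[OF zero, of 0] smult_zero[OF zero] by simp
  ultimately show ?thesis
    using nonneg definite triangle homogeneous
    by (auto intro!: complex_normed_space.intro complex_normed_space_axioms.intro)
qed

lemma complex_normed_space_complex_line: "complex_normed_space complex_line"
  by (rule complex_normed_spaceI) (auto simp: algebra_simps norm_triangle_ineq norm_mult)

context complex_normed_space
begin

lemma smult_closed' [simp, intro]: "x \<in> carrier E \<Longrightarrow> c \<odot> x \<in> carrier E"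
  using smult_closed by simp

lemma smult_add_left: "x \<in> carrier E \<Longrightarrow> (a + b) \<odot> x = a \<odot> x \<oplus> b \<odot> x"
  using smult_l_distr[of a b x] by simp

lemma smult_add_right: "\<lbrakk>x \<in> carrier E; y \<in> carrier E\<rbrakk> \<Longrightarrow> a \<odot> (x \<oplus> y) = a \<odot> x \<oplus> a \<odot> y"
  using smult_r_distr[of a x y] by simp

lemma smult_smult [simp]: "x \<in> carrier E \<Longrightarrow> a \<odot> (b \<odot> x) = (a * b) \<odot> x"
  using smult_assoc1[of a b x] by simp

lemma smult_1 [simp]: "x \<in> carrier E \<Longrightarrow> 1 \<odot> x = x"
  using smult_one[of x] by simp

lemma smult_0_left [simp]: "x \<in> carrier E \<Longrightarrow> 0 \<odot> x = \<zero>"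
  using smult_l_null[of x] by simp

lemma smult_0_right [simp]: "c \<odot> \<zero> = \<zero>"
  using smult_r_null[of c] by simp

lemma minus_smult: "x \<in> carrier E \<Longrightarrow> \<ominus> x = (-1) \<odot> x"
  by (rule M.minus_equality) (use smult_add_left[of x "-1" 1] in auto)

lemma diff_smult: "\<lbrakk>x \<in> carrier E; y \<in> carrier E\<rbrakk> \<Longrightarrow> x \<ominus> y = x \<oplus> (-1) \<odot> y"
  by (simp add: a_minus_def minus_smult)

lemma diff_self [simp]: "x \<in> carrier E \<Longrightarrow> x \<ominus> x = \<zero>"
  by (simp add: a_minus_def M.r_neg)

lemma diff_eq_0_iff: "\<lbrakk>x \<in> carrier E; y \<in> carrier E\<rbrakk> \<Longrightarrow> x \<ominus> y = \<zero> \<longleftrightarrow> x = y"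
  by (metis M.minus_closed M.add.inv_solve_right M.l_zero a_minus_def M.zero_closed)

lemma diff_add_cancel [simp]: "\<lbrakk>x \<in> carrier E; y \<in> carrier E\<rbrakk> \<Longrightarrow> (x \<ominus> y) \<oplus> y = x"
  by (simp add: a_minus_def M.a_assoc M.l_neg)

lemma diff_add_diff:
  assumes "x \<in> carrier E" "y \<in> carrier E" "z \<in> carrier E"
  shows "(x \<ominus> y) \<oplus> (y \<ominus> z) = x \<ominus> z"
proof -
  have "(x \<ominus> y) \<oplus> (y \<ominus> z) = ((x \<ominus> y) \<oplus> y) \<oplus> \<ominus> z"
    using assms by (simp only: a_minus_def M.a_assoc M.minus_closed M.a_inv_closed M.a_closed)
  then show ?thesis
    using assms by (simp only: diff_add_cancel a_minus_def[symmetric])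
qed

lemma add_diff_add:
  assumes "x \<in> carrier E" "y \<in> carrier E" "z \<in> carrier E" "w \<in> carrier E"
  shows "(x \<oplus> y) \<ominus> (z \<oplus> w) = (x \<ominus> z) \<oplus> (y \<ominus> w)"
  using assms by (simp add: a_minus_def M.minus_add M.a_ac)

lemma smult_diff_right:
  "\<lbrakk>x \<in> carrier E; y \<in> carrier E\<rbrakk> \<Longrightarrow> c \<odot> (x \<ominus> y) = c \<odot> x \<ominus> c \<odot> y"
  by (simp add: diff_smult smult_add_right)

lemma diff_zero [simp]: "x \<in> carrier E \<Longrightarrow> x \<ominus> \<zero> = x"
  by (simp add: diff_smult)

lemma add_diff_cancel_left' [simp]: "\<lbrakk>x \<in> carrier E; y \<in> carrier E\<rbrakk> \<Longrightarrow> (x \<oplus> y) \<ominus> x = y"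
  using add_diff_add[of x y x \<zero>] by simp

lemma diff_diff_cancel:
  assumes "x \<in> carrier E" "y \<in> carrier E" "z \<in> carrier E"
  shows "(x \<ominus> z) \<ominus> (y \<ominus> z) = x \<ominus> y"
proof -
  have "(x \<ominus> z) \<oplus> (z \<ominus> y) = x \<ominus> y" using assms by (simp add: diff_add_diff)
  moreover have "(x \<ominus> z) \<ominus> (y \<ominus> z) = (x \<ominus> z) \<oplus> (z \<ominus> y)"
    using assms by (simp add: diff_smult[of "x \<ominus> z"] smult_diff_right) (simp add: diff_smult M.a_comm)
  ultimately show ?thesis by simp
qed

lemma nrm_zero [simp]: "nrm E \<zero> = 0"
  using nrm_eq_0_iff by simp

lemma nrm_diff_commute:
  assumes "x \<in> carrier E" "y \<in> carrier E" shows "nrm E (x \<ominus> y) = nrm E (y \<ominus> x)"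
proof -
  have "y \<ominus> x = (-1) \<odot> (x \<ominus> y)"
    using assms by (simp add: diff_smult smult_add_right M.a_comm)
  with assms show ?thesis
    by (simp add: nrm_smult)
qed

lemma nrm_diff_trans:
  assumes "x \<in> carrier E" "y \<in> carrier E" "z \<in> carrier E"
  shows "nrm E (x \<ominus> z) \<le> nrm E (x \<ominus> y) + nrm E (y \<ominus> z)"
  using nrm_triangle[of "x \<ominus> y" "y \<ominus> z"] assms by (simp add: diff_add_diff)

lemma nrm_le_diff:
  assumes "x \<in> carrier E" "y \<in> carrier E"
  shows "nrm E x \<le> nrm E (x \<ominus> y) + nrm E y"
  using nrm_triangle[of "x \<ominus> y" y] assms by simp

sublocale metric: Metric_space "carrier E" "norm_dist E"
proof
  fix x y z
  show "0 \<le> norm_dist E x y"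
    by (simp add: norm_dist_def nrm_nonneg)
  show "norm_dist E x y = norm_dist E y x"
    by (simp add: norm_dist_def nrm_diff_commute)
  show "norm_dist E x y = 0 \<longleftrightarrow> x = y" if "x \<in> carrier E" "y \<in> carrier E"
    using that by (simp add: norm_dist_def nrm_eq_0_iff diff_eq_0_iff)
  show "norm_dist E x z \<le> norm_dist E x y + norm_dist E y z"
    if "x \<in> carrier E" "y \<in> carrier E" "z \<in> carrier E"
    using that by (simp add: norm_dist_def nrm_diff_trans)
qed

lemma norm_dist_eq: "\<lbrakk>x \<in> carrier E; y \<in> carrier E\<rbrakk> \<Longrightarrow> norm_dist E x y = nrm E (x \<ominus> y)"
  by (simp add: norm_dist_def)

lemma zero_in_unit_ball [simp]: "\<zero> \<in> unit_ball E"
  by (simp add: unit_ball_def)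

lemma unit_ball_closed: "x \<in> unit_ball E \<Longrightarrow> x \<in> carrier E"
  by (simp add: unit_ball_def)

lemma normalize_in_unit_ball:
  "\<lbrakk>x \<in> carrier E; nrm E x > 0\<rbrakk> \<Longrightarrow> complex_of_real (inverse (nrm E x)) \<odot> x \<in> unit_ball E"
  using nrm_nonneg[of x] by (simp add: unit_ball_def nrm_smult norm_inverse)

end

lemma bounded_opsD:
  fixes E F
  assumes "T \<in> bounded_ops E F"
  shows "x \<in> carrier E \<Longrightarrow> T x \<in> carrier F"
    and "\<lbrakk>x \<in> carrier E; y \<in> carrier E\<rbrakk> \<Longrightarrow> T (x \<oplus>\<^bsub>E\<^esub> y) = T x \<oplus>\<^bsub>F\<^esub> T y"
    and "x \<in> carrier E \<Longrightarrow> T (c \<odot>\<^bsub>E\<^esub> x) = c \<odot>\<^bsub>F\<^esub> T x"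
    and "T \<in> extensional (carrier E)"
  using assms by (auto simp: bounded_ops_def PiE_def)

lemma bounded_opsI:
  assumes "T \<in> extensional (carrier E)" "\<And>x. x \<in> carrier E \<Longrightarrow> T x \<in> carrier F"
    and "\<And>x y. \<lbrakk>x \<in> carrier E; y \<in> carrier E\<rbrakk> \<Longrightarrow> T (x \<oplus>\<^bsub>E\<^esub> y) = T x \<oplus>\<^bsub>F\<^esub> T y"
    and "\<And>c x. x \<in> carrier E \<Longrightarrow> T (c \<odot>\<^bsub>E\<^esub> x) = c \<odot>\<^bsub>F\<^esub> T x"
    and "\<And>x. x \<in> carrier E \<Longrightarrow> nrm F (T x) \<le> K * nrm E x"
  shows "T \<in> bounded_ops E F"
  using assms unfolding bounded_ops_def by (auto simp: PiE_def intro!: exI[of _ K])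

lemma op_eqI:
  assumes "S \<in> bounded_ops E F" "T \<in> bounded_ops E F" "\<And>x. x \<in> carrier E \<Longrightarrow> S x = T x"
  shows "S = T"
  using assms by (meson bounded_opsD(4) extensionalityI)

text \<open>Functionals are the case where \<open>F\<close> is \<open>complex_line\<close>, so that
  dual spaces and operator spaces share one development.\<close>

locale normed_space_pair = E: complex_normed_space E + F: complex_normed_space F
  for E :: "'v normed_module" and F :: "'w normed_module"
begin

lemma op_zero: "T \<in> bounded_ops E F \<Longrightarrow> T \<zero>\<^bsub>E\<^esub> = \<zero>\<^bsub>F\<^esub>"
  using bounded_opsD(3)[of T E F "\<zero>\<^bsub>E\<^esub>" 0] bounded_opsD(1)[of T E F "\<zero>\<^bsub>E\<^esub>"] by simp

lemma op_diff:
  "\<lbrakk>T \<in> bounded_ops E F; x \<in> carrier E; y \<in> carrier E\<rbrakk> \<Longrightarrow> T (x \<ominus>\<^bsub>E\<^esub> y) = T x \<ominus>\<^bsub>F\<^esub> T y"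
  by (simp add: E.diff_smult F.diff_smult bounded_opsD)

lemma op_nrm_bdd:
  assumes "T \<in> bounded_ops E F" shows "bdd_above ((\<lambda>x. nrm F (T x)) ` unit_ball E)"
proof -
  obtain K where K: "\<And>x. x \<in> carrier E \<Longrightarrow> nrm F (T x) \<le> K * nrm E x"
    using assms unfolding bounded_ops_def by blast
  \<comment> \<open>The constant in \<open>bounded_ops\<close> may be negative, hence the absolute
    value.\<close>
  have "nrm F (T x) \<le> \<bar>K\<bar>" if "x \<in> unit_ball E" for x
  proof -
    have x: "x \<in> carrier E" "nrm E x \<le> 1" "0 \<le> nrm E x"
      using that E.nrm_nonneg by (auto simp: unit_ball_def)
    have "K * nrm E x \<le> \<bar>K\<bar> * 1"
      by (intro mult_mono) (use x in auto)
    then show ?thesis using K[OF x(1)] by simp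
  qed
  then show ?thesis by (auto simp: bdd_above_def)
qed

lemma op_nrm_unit_ball:
  "\<lbrakk>T \<in> bounded_ops E F; x \<in> unit_ball E\<rbrakk> \<Longrightarrow> nrm F (T x) \<le> op_nrm E F T"
  unfolding op_nrm_def by (rule cSUP_upper[OF _ op_nrm_bdd])

lemma op_nrm_nonneg: "T \<in> bounded_ops E F \<Longrightarrow> 0 \<le> op_nrm E F T"
  using op_nrm_unit_ball[of T "\<zero>\<^bsub>E\<^esub>"] op_zero[of T] by simp

lemma op_nrm_bound:
  assumes T: "T \<in> bounded_ops E F" and x: "x \<in> carrier E"
  shows "nrm F (T x) \<le> op_nrm E F T * nrm E x"
proof (cases "nrm E x = 0")
  case True
  then show ?thesis using x T by (simp add: E.nrm_eq_0_iff op_zero)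
next
  case False
  then have pos: "nrm E x > 0" using E.nrm_nonneg[OF x] by simp
  have "inverse (nrm E x) * nrm F (T x) = nrm F (T (complex_of_real (inverse (nrm E x)) \<odot>\<^bsub>E\<^esub> x))"
    using pos x T by (simp add: bounded_opsD F.nrm_smult norm_inverse)
  also have "\<dots> \<le> op_nrm E F T"
    by (rule op_nrm_unit_ball[OF T E.normalize_in_unit_ball[OF x pos]])
  finally show ?thesis using pos by (simp add: field_simps)
qed

lemma op_nrm_leI:
  assumes "\<And>x. x \<in> unit_ball E \<Longrightarrow> nrm F (T x) \<le> K" shows "op_nrm E F T \<le> K"
  unfolding op_nrm_def by (rule cSUP_least) (use assms E.zero_in_unit_ball in blast)+

lemma op_nrm_le:
  assumes "\<And>x. x \<in> carrier E \<Longrightarrow> nrm F (T x) \<le> K * nrm E x" "0 \<le> K"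
  shows "op_nrm E F T \<le> K"
proof (rule op_nrm_leI)
  fix x assume x: "x \<in> unit_ball E"
  then have "nrm F (T x) \<le> K * nrm E x" using assms(1) by (simp add: unit_ball_def)
  also have "\<dots> \<le> K * 1" using x assms(2) by (intro mult_left_mono) (auto simp: unit_ball_def)
  finally show "nrm F (T x) \<le> K" by simp
qed

lemma op_add:
  assumes S: "S \<in> bounded_ops E F" and T: "T \<in> bounded_ops E F"
  shows "(\<lambda>x\<in>carrier E. S x \<oplus>\<^bsub>F\<^esub> T x) \<in> bounded_ops E F"
    and "op_nrm E F (\<lambda>x\<in>carrier E. S x \<oplus>\<^bsub>F\<^esub> T x) \<le> op_nrm E F S + op_nrm E F T"
proof -
  have le: "nrm F ((\<lambda>x\<in>carrier E. S x \<oplus>\<^bsub>F\<^esub> T x) x) \<le> (op_nrm E F S + op_nrm E F T) * nrm E x"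
    if x: "x \<in> carrier E" for x
    using F.nrm_triangle[of "S x" "T x"] op_nrm_bound[OF S x] op_nrm_bound[OF T x]
      bounded_opsD(1)[OF S x] bounded_opsD(1)[OF T x] x by (simp add: algebra_simps)
  show "(\<lambda>x\<in>carrier E. S x \<oplus>\<^bsub>F\<^esub> T x) \<in> bounded_ops E F"
    by (rule bounded_opsI[OF _ _ _ _ le])
      (use bounded_opsD[OF S] bounded_opsD[OF T] in \<open>auto simp: F.M.a_ac F.smult_add_right extensional_def\<close>)
  show "op_nrm E F (\<lambda>x\<in>carrier E. S x \<oplus>\<^bsub>F\<^esub> T x) \<le> op_nrm E F S + op_nrm E F T"
    by (rule op_nrm_le[OF le]) (use op_nrm_nonneg[OF S] op_nrm_nonneg[OF T] in auto)
qed

lemma op_smult: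
  assumes T: "T \<in> bounded_ops E F"
  shows "(\<lambda>x\<in>carrier E. c \<odot>\<^bsub>F\<^esub> T x) \<in> bounded_ops E F"
    and "op_nrm E F (\<lambda>x\<in>carrier E. c \<odot>\<^bsub>F\<^esub> T x) = cmod c * op_nrm E F T"
proof -
  have bnd: "(\<lambda>x\<in>carrier E. c \<odot>\<^bsub>F\<^esub> T x) \<in> bounded_ops E F"
    and le: "op_nrm E F (\<lambda>x\<in>carrier E. c \<odot>\<^bsub>F\<^esub> T x) \<le> cmod c * op_nrm E F T"
    if T: "T \<in> bounded_ops E F" for c T
  proof -
    have le: "nrm F ((\<lambda>x\<in>carrier E. c \<odot>\<^bsub>F\<^esub> T x) x) \<le> (cmod c * op_nrm E F T) * nrm E x"
      if x: "x \<in> carrier E" for x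
      using bounded_opsD(1)[OF T x] x mult_left_mono[OF op_nrm_bound[OF T x], of "cmod c"]
      by (simp add: F.nrm_smult algebra_simps)
    show "(\<lambda>x\<in>carrier E. c \<odot>\<^bsub>F\<^esub> T x) \<in> bounded_ops E F"
      by (rule bounded_opsI[OF _ _ _ _ le])
        (use bounded_opsD[OF T] in \<open>auto simp: F.smult_add_right mult.commute extensional_def\<close>)
    show "op_nrm E F (\<lambda>x\<in>carrier E. c \<odot>\<^bsub>F\<^esub> T x) \<le> cmod c * op_nrm E F T"
      by (rule op_nrm_le[OF le]) (use op_nrm_nonneg[OF T] in auto)
  qed
  show "(\<lambda>x\<in>carrier E. c \<odot>\<^bsub>F\<^esub> T x) \<in> bounded_ops E F" by (rule bnd[OF T])
  show "op_nrm E F (\<lambda>x\<in>carrier E. c \<odot>\<^bsub>F\<^esub> T x) = cmod c * op_nrm E F T"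
  proof (cases "c = 0")
    case True
    then show ?thesis using le[OF T, of c] op_nrm_nonneg[OF bnd[OF T, of c]] by simp
  next
    case False
    \<comment> \<open>The reverse inequality is \<open>le\<close> for the scalar
      \<open>inverse c\<close>, applied to the operator already scaled by \<open>c\<close>.\<close>
    have "(\<lambda>x\<in>carrier E. inverse c \<odot>\<^bsub>F\<^esub> (\<lambda>x\<in>carrier E. c \<odot>\<^bsub>F\<^esub> T x) x) = T"
      using False bounded_opsD[OF T] by (intro extensionalityI[of _ "carrier E"]) auto
    then have "op_nrm E F T \<le> inverse (cmod c) * op_nrm E F (\<lambda>x\<in>carrier E. c \<odot>\<^bsub>F\<^esub> T x)"
      using le[OF bnd[OF T, of c], of "inverse c"] by (simp add: norm_inverse)
    then show ?thesis
      using le[OF T, of c] False by (simp add: field_simps)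
  qed
qed

lemma op_zero_mem: "(\<lambda>x\<in>carrier E. \<zero>\<^bsub>F\<^esub>) \<in> bounded_ops E F"
  by (rule bounded_opsI[where K = 0]) auto

sublocale op_space: complex_normed_space "op_space E F"
proof (rule complex_normed_spaceI)
  fix S T U :: "'v \<Rightarrow> 'w" and a b
  assume S: "S \<in> carrier (op_space E F)"
  note [simp] = op_space_def
  have S': "S \<in> bounded_ops E F" using S by simp
  note S'' = bounded_opsD[OF S']
  show "a \<odot>\<^bsub>op_space E F\<^esub> S \<in> carrier (op_space E F)"
    using op_smult[OF S'] by simp
  show "\<zero>\<^bsub>op_space E F\<^esub> \<oplus>\<^bsub>op_space E F\<^esub> S = S" "0 \<odot>\<^bsub>op_space E F\<^esub> S = \<zero>\<^bsub>op_space E F\<^esub>"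
    "1 \<odot>\<^bsub>op_space E F\<^esub> S = S"
    using S'' by (auto intro!: extensionalityI[of _ "carrier E"] restrict_ext)
  show "(a + b) \<odot>\<^bsub>op_space E F\<^esub> S = a \<odot>\<^bsub>op_space E F\<^esub> S \<oplus>\<^bsub>op_space E F\<^esub> b \<odot>\<^bsub>op_space E F\<^esub> S"
    "(a * b) \<odot>\<^bsub>op_space E F\<^esub> S = a \<odot>\<^bsub>op_space E F\<^esub> (b \<odot>\<^bsub>op_space E F\<^esub> S)"
    using S'' by (auto intro!: restrict_ext simp: F.smult_add_left)
  show "0 \<le> nrm (op_space E F) S" using op_nrm_nonneg[OF S'] by simp
  show "S = \<zero>\<^bsub>op_space E F\<^esub>" if "nrm (op_space E F) S = 0"
  proof -
    have "S x = \<zero>\<^bsub>F\<^esub>" if x: "x \<in> carrier E" for x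
      using op_nrm_bound[OF S' x] F.nrm_nonneg[of "S x"] F.nrm_eq_0_iff[of "S x"] S''(1)[OF x]
        \<open>nrm (op_space E F) S = 0\<close> by simp
    then show ?thesis using S'' by (auto intro!: extensionalityI[of _ "carrier E"])
  qed
  show "nrm (op_space E F) (a \<odot>\<^bsub>op_space E F\<^esub> S) = cmod a * nrm (op_space E F) S"
    using op_smult[OF S'] by simp
  assume T: "T \<in> carrier (op_space E F)"
  have T': "T \<in> bounded_ops E F" using T by simp
  note T'' = bounded_opsD[OF T']
  show "S \<oplus>\<^bsub>op_space E F\<^esub> T \<in> carrier (op_space E F)"
    "nrm (op_space E F) (S \<oplus>\<^bsub>op_space E F\<^esub> T) \<le> nrm (op_space E F) S + nrm (op_space E F) T"
    using op_add[OF S' T'] by auto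
  show "S \<oplus>\<^bsub>op_space E F\<^esub> T = T \<oplus>\<^bsub>op_space E F\<^esub> S"
    "a \<odot>\<^bsub>op_space E F\<^esub> (S \<oplus>\<^bsub>op_space E F\<^esub> T) = a \<odot>\<^bsub>op_space E F\<^esub> S \<oplus>\<^bsub>op_space E F\<^esub> a \<odot>\<^bsub>op_space E F\<^esub> T"
    using S'' T'' by (auto intro!: restrict_ext F.M.a_comm simp: F.smult_add_right)
  assume U: "U \<in> carrier (op_space E F)"
  then show "S \<oplus>\<^bsub>op_space E F\<^esub> T \<oplus>\<^bsub>op_space E F\<^esub> U = S \<oplus>\<^bsub>op_space E F\<^esub> (T \<oplus>\<^bsub>op_space E F\<^esub> U)"
    using S'' T'' bounded_opsD[of U E F] by (auto intro!: restrict_ext F.M.a_assoc)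
qed (simp add: op_space_def op_zero_mem)

lemma op_space_diff:
  assumes "S \<in> bounded_ops E F" "T \<in> bounded_ops E F" "x \<in> carrier E"
  shows "(S \<ominus>\<^bsub>op_space E F\<^esub> T) x = S x \<ominus>\<^bsub>F\<^esub> T x"
proof -
  have "S \<in> carrier (op_space E F)" "T \<in> carrier (op_space E F)"
    using assms by (auto simp: op_space_def)
  then have "S \<ominus>\<^bsub>op_space E F\<^esub> T = S \<oplus>\<^bsub>op_space E F\<^esub> (-1) \<odot>\<^bsub>op_space E F\<^esub> T"
    by (rule op_space.diff_smult)
  then show ?thesis
    using assms bounded_opsD[OF assms(1)] bounded_opsD[OF assms(2)]
    by (simp add: op_space_def F.diff_smult)
qed

end

lemma compose_bounded_ops:
  assumes E: "complex_normed_space E" and F: "complex_normed_space F" and G: "complex_normed_space G"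
    and S: "S \<in> bounded_ops F G" and T: "T \<in> bounded_ops E F"
  shows "compose (carrier E) S T \<in> bounded_ops E G"
    and "op_nrm E G (compose (carrier E) S T) \<le> op_nrm F G S * op_nrm E F T"
proof -
  interpret EF: normed_space_pair E F using E F by (simp add: normed_space_pair_def)
  interpret FG: normed_space_pair F G using F G by (simp add: normed_space_pair_def)
  interpret EG: normed_space_pair E G using E G by (simp add: normed_space_pair_def)
  have le: "nrm G (compose (carrier E) S T x) \<le> (op_nrm F G S * op_nrm E F T) * nrm E x"
    if x: "x \<in> carrier E" for x
    using FG.op_nrm_bound[OF S bounded_opsD(1)[OF T x]] x
      mult_left_mono[OF EF.op_nrm_bound[OF T x] FG.op_nrm_nonneg[OF S]]
    by (simp add: compose_eq algebra_simps)
  show "compose (carrier E) S T \<in> bounded_ops E G"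
    by (rule bounded_opsI[OF _ _ _ _ le])
      (use bounded_opsD[OF T] bounded_opsD[OF S] in \<open>auto simp: compose_eq\<close>)
  show "op_nrm E G (compose (carrier E) S T) \<le> op_nrm F G S * op_nrm E F T"
    by (rule EG.op_nrm_le[OF le]) (use EF.op_nrm_nonneg[OF T] FG.op_nrm_nonneg[OF S] in auto)
qed

section \<open>Completeness and total boundedness in terms of the norm\<close>

context complex_normed_space
begin

text \<open>Bridge from metric completeness to norms of differences; the completeness proofs for
  operators, compact operators and L^p all go through it.\<close>

lemma mcomplete_iff:
  "metric.mcomplete \<longleftrightarrow>
    (\<forall>\<sigma>. range \<sigma> \<subseteq> carrier E \<and> (\<forall>\<epsilon>>0. \<exists>N. \<forall>m\<ge>N. \<forall>n\<ge>N. nrm E (\<sigma> m \<ominus> \<sigma> n) < \<epsilon>)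
      \<longrightarrow> (\<exists>x\<in>carrier E. (\<lambda>n. nrm E (\<sigma> n \<ominus> x)) \<longlonglongrightarrow> 0))"
proof -
  have "metric.MCauchy \<sigma> \<longleftrightarrow> range \<sigma> \<subseteq> carrier E \<and> (\<forall>\<epsilon>>0. \<exists>N. \<forall>m\<ge>N. \<forall>n\<ge>N. nrm E (\<sigma> m \<ominus> \<sigma> n) < \<epsilon>)"
    for \<sigma> :: "nat \<Rightarrow> _"
    unfolding metric.MCauchy_def
  proof (rule conj_cong[OF refl])
    assume "range \<sigma> \<subseteq> carrier E"
    then have "norm_dist E (\<sigma> m) (\<sigma> n) = nrm E (\<sigma> m \<ominus> \<sigma> n)" for m n
      by (intro norm_dist_eq) auto
    then show "(\<forall>\<epsilon>>0. \<exists>N. \<forall>m n. N \<le> m \<longrightarrow> N \<le> n \<longrightarrow> norm_dist E (\<sigma> m) (\<sigma> n) < \<epsilon>) \<longleftrightarrow>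
        (\<forall>\<epsilon>>0. \<exists>N. \<forall>m\<ge>N. \<forall>n\<ge>N. nrm E (\<sigma> m \<ominus> \<sigma> n) < \<epsilon>)"
      by simp
  qed
  moreover have "limitin metric.mtopology \<sigma> x sequentially \<longleftrightarrow> x \<in> carrier E \<and> (\<lambda>n. nrm E (\<sigma> n \<ominus> x)) \<longlonglongrightarrow> 0"
    if "range \<sigma> \<subseteq> carrier E" for \<sigma> :: "nat \<Rightarrow> _" and x
  proof -
    have \<sigma>: "\<sigma> n \<in> carrier E" for n using that by auto
    have "(\<lambda>n. norm_dist E (\<sigma> n) x) = (\<lambda>n. nrm E (\<sigma> n \<ominus> x))" if "x \<in> carrier E"
      using that \<sigma> by (simp add: norm_dist_eq)
    with \<sigma> show ?thesis
      by (auto simp: metric.limitin_metric_dist_null)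
  qed
  ultimately show ?thesis
    unfolding metric.mcomplete_def by (auto simp: Bex_def)
qed

lemma limit_unique:
  fixes \<sigma> :: "nat \<Rightarrow> _"
  assumes "range \<sigma> \<subseteq> carrier E" "x \<in> carrier E" "y \<in> carrier E"
    and "(\<lambda>n. nrm E (\<sigma> n \<ominus> x)) \<longlonglongrightarrow> 0" "(\<lambda>n. nrm E (\<sigma> n \<ominus> y)) \<longlonglongrightarrow> 0"
  shows "x = y"
proof -
  have "nrm E (x \<ominus> y) \<le> nrm E (\<sigma> n \<ominus> x) + nrm E (\<sigma> n \<ominus> y)" for n
    using nrm_diff_trans[of x "\<sigma> n" y] assms(1-3) by (auto simp: nrm_diff_commute range_subsetD)
  then have "nrm E (x \<ominus> y) \<le> 0"
    using tendsto_add[OF assms(4,5)] by (intro LIMSEQ_le_const[of _ 0]) auto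
  then show ?thesis
    using assms nrm_nonneg[of "x \<ominus> y"] nrm_eq_0_iff[of "x \<ominus> y"] by (simp add: diff_eq_0_iff)
qed

text \<open>In contrast to \<open>mtotally_bounded\<close>, the centres may lie outside
  \<open>S\<close>, so that a net of a set is also a net of each of its subsets.\<close>

definition finite_net :: "real \<Rightarrow> 'v set \<Rightarrow> bool" where
  "finite_net \<epsilon> S \<longleftrightarrow> (\<exists>Z. finite Z \<and> Z \<subseteq> carrier E \<and> (\<forall>x\<in>S. \<exists>z\<in>Z. nrm E (x \<ominus> z) < \<epsilon>))"

lemma finite_net_mono: "\<lbrakk>finite_net \<delta> S; \<delta> \<le> \<epsilon>; T \<subseteq> S\<rbrakk> \<Longrightarrow> finite_net \<epsilon> T"
  unfolding finite_net_def by (meson less_le_trans subsetD)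

text \<open>A centre that is used at all can be moved to a point of \<open>S\<close> within
  \<epsilon> / 2 of it, which costs a factor 2 in the radius.\<close>

lemma mtotally_bounded_iff_finite_net:
  assumes S: "S \<subseteq> carrier E"
  shows "metric.mtotally_bounded S \<longleftrightarrow> (\<forall>\<epsilon>>0. finite_net \<epsilon> S)"
proof
  assume L: "metric.mtotally_bounded S"
  show "\<forall>\<epsilon>>0. finite_net \<epsilon> S"
  proof (intro allI impI)
    fix \<epsilon> :: real assume "\<epsilon> > 0"
    then have "\<exists>Z. finite Z \<and> Z \<subseteq> S \<and> S \<subseteq> (\<Union>x\<in>Z. metric.mball x \<epsilon>)"
      using L unfolding metric.mtotally_bounded_def by simp
    then obtain Z where Z: "finite Z" "Z \<subseteq> S" "S \<subseteq> (\<Union>x\<in>Z. metric.mball x \<epsilon>)"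
      by (elim exE conjE)
    show "finite_net \<epsilon> S"
      unfolding finite_net_def
    proof (intro exI[of _ Z] conjI ballI)
      fix x assume x: "x \<in> S"
      then obtain z where "z \<in> Z" "x \<in> metric.mball z \<epsilon>" using Z(3) by blast
      then have "norm_dist E z x < \<epsilon>" "z \<in> carrier E" "x \<in> carrier E"
        by (simp_all add: metric.mball_def)
      then have "nrm E (x \<ominus> z) < \<epsilon>" by (simp add: norm_dist_eq nrm_diff_commute[of x z])
      with \<open>z \<in> Z\<close> show "\<exists>z\<in>Z. nrm E (x \<ominus> z) < \<epsilon>" by blast
    qed (use Z S in auto)
  qed
next
  assume R: "\<forall>\<epsilon>>0. finite_net \<epsilon> S"
  show "metric.mtotally_bounded S"
    unfolding metric.mtotally_bounded_def
  proof (intro allI impI)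
    fix \<epsilon> :: real assume \<epsilon>: "\<epsilon> > 0"
    then obtain Z where Z: "finite Z" "Z \<subseteq> carrier E" "\<And>x. x \<in> S \<Longrightarrow> \<exists>z\<in>Z. nrm E (x \<ominus> z) < \<epsilon> / 2"
      using R unfolding finite_net_def by (meson half_gt_zero)
    define Z' where "Z' = {z\<in>Z. \<exists>x\<in>S. nrm E (x \<ominus> z) < \<epsilon> / 2}"
    define c where "c z = (SOME x. x \<in> S \<and> nrm E (x \<ominus> z) < \<epsilon> / 2)" for z
    have c: "c z \<in> S" "nrm E (c z \<ominus> z) < \<epsilon> / 2" if "z \<in> Z'" for z
      using that someI_ex[of "\<lambda>x. x \<in> S \<and> nrm E (x \<ominus> z) < \<epsilon> / 2"] by (auto simp: Z'_def c_def)
    show "\<exists>K. finite K \<and> K \<subseteq> S \<and> S \<subseteq> (\<Union>x\<in>K. metric.mball x \<epsilon>)"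
    proof (intro exI[of _ "c ` Z'"] conjI subsetI)
      fix x assume x: "x \<in> S"
      then obtain z where z: "z \<in> Z" "nrm E (x \<ominus> z) < \<epsilon> / 2" using Z(3) by blast
      then have z': "z \<in> Z'" using x by (auto simp: Z'_def)
      have mem: "x \<in> carrier E" "z \<in> carrier E" "c z \<in> carrier E" using S x Z z c[OF z'] by auto
      have "nrm E (x \<ominus> c z) < \<epsilon>"
        using nrm_diff_trans[OF mem] z(2) c(2)[OF z'] nrm_diff_commute[OF mem(2,3)] by simp
      then have "x \<in> metric.mball (c z) \<epsilon>"
        using mem by (simp add: norm_dist_eq nrm_diff_commute[of x "c z"])
      with z' show "x \<in> (\<Union>x\<in>c ` Z'. metric.mball x \<epsilon>)" by blast
    qed (use Z c in \<open>auto simp: Z'_def\<close>)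
  qed
qed

text \<open>Total boundedness of a disc in the plane, transported along
  \<open>c \<mapsto> c \<odot> v\<close>. The \<open>+ 1\<close> in \<delta> covers the vector of
  norm 0. Rank-one operators are compact for this reason.\<close>

lemma finite_net_bounded_scalars:
  assumes v: "v \<in> carrier E" and \<epsilon>: "\<epsilon> > 0"
  shows "finite_net \<epsilon> ((\<lambda>c. c \<odot> v) ` cball 0 r)"
proof -
  define \<delta> where "\<delta> = \<epsilon> / (nrm E v + 1)"
  have pos: "\<delta> > 0" using \<epsilon> nrm_nonneg[OF v] by (simp add: \<delta>_def add_nonneg_pos)
  obtain K where K: "finite K" "cball (0::complex) r \<subseteq> (\<Union>x\<in>K. ball x \<delta>)"
    using compact_eq_totally_bounded[of "cball (0::complex) r"] pos by auto
  show ?thesis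
    unfolding finite_net_def
  proof (intro exI[of _ "(\<lambda>c. c \<odot> v) ` K"] conjI ballI)
    fix x assume "x \<in> (\<lambda>c. c \<odot> v) ` cball 0 r"
    then obtain c k where c: "x = c \<odot> v" "k \<in> K" "dist k c < \<delta>" using K by auto
    have "c \<odot> v \<ominus> k \<odot> v = (c - k) \<odot> v"
      using v smult_add_left[of v c "- k"] by (simp add: diff_smult)
    then have "nrm E (x \<ominus> k \<odot> v) = dist k c * nrm E v"
      using v c by (simp add: nrm_smult dist_norm norm_minus_commute)
    also have "\<dots> \<le> \<delta> * nrm E v" using c nrm_nonneg[OF v] by (intro mult_right_mono) auto
    also have "\<dots> < \<delta> * (nrm E v + 1)" using pos by simp
    also have "\<dots> = \<epsilon>" using nrm_nonneg[OF v] by (simp add: \<delta>_def)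
    finally show "\<exists>z\<in>(\<lambda>c. c \<odot> v) ` K. nrm E (x \<ominus> z) < \<epsilon>" using c by blast
  qed (use K v in auto)
qed

end

lemma (in normed_space_pair) op_space_complete:
  assumes F: "F.metric.mcomplete"
  shows "op_space.metric.mcomplete"
  unfolding op_space.mcomplete_iff
proof (intro allI impI, elim conjE)
  fix \<sigma> :: "nat \<Rightarrow> 'v \<Rightarrow> 'w"
  assume "range \<sigma> \<subseteq> carrier (op_space E F)"
  then have \<sigma>: "\<sigma> n \<in> bounded_ops E F" for n by (auto simp: op_space_def)
  then have \<sigma>': "\<sigma> n \<in> carrier (op_space E F)" for n by (auto simp: op_space_def)
  assume cauchy: "\<forall>\<epsilon>>0. \<exists>N. \<forall>m\<ge>N. \<forall>n\<ge>N. nrm (op_space E F) (\<sigma> m \<ominus>\<^bsub>op_space E F\<^esub> \<sigma> n) < \<epsilon>"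
  note mem = bounded_opsD(1)[OF \<sigma>]
  have diff: "nrm F (\<sigma> m x \<ominus>\<^bsub>F\<^esub> \<sigma> n x) \<le> nrm (op_space E F) (\<sigma> m \<ominus>\<^bsub>op_space E F\<^esub> \<sigma> n) * nrm E x"
    if x: "x \<in> carrier E" for m n x
  proof -
    have "\<sigma> m \<ominus>\<^bsub>op_space E F\<^esub> \<sigma> n \<in> carrier (op_space E F)" using \<sigma>' by simp
    then have "\<sigma> m \<ominus>\<^bsub>op_space E F\<^esub> \<sigma> n \<in> bounded_ops E F" by (simp add: op_space_def)
    from op_nrm_bound[OF this x] show ?thesis
      using \<sigma> x by (simp add: op_space_diff) (simp add: op_space_def)
  qed
  have "\<exists>l\<in>carrier F. (\<lambda>n. nrm F (\<sigma> n x \<ominus>\<^bsub>F\<^esub> l)) \<longlonglongrightarrow> 0" if x: "x \<in> carrier E" for x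
  proof -
    have "\<exists>N. \<forall>m\<ge>N. \<forall>n\<ge>N. nrm F (\<sigma> m x \<ominus>\<^bsub>F\<^esub> \<sigma> n x) < \<epsilon>" if "\<epsilon> > 0" for \<epsilon>
    proof -
      have pos: "\<epsilon> / (nrm E x + 1) > 0" using that E.nrm_nonneg[OF x] by (simp add: add_nonneg_pos)
      then obtain N where N: "\<And>m n. m \<ge> N \<Longrightarrow> n \<ge> N \<Longrightarrow>
          nrm (op_space E F) (\<sigma> m \<ominus>\<^bsub>op_space E F\<^esub> \<sigma> n) < \<epsilon> / (nrm E x + 1)"
        using cauchy by meson
      have "nrm F (\<sigma> m x \<ominus>\<^bsub>F\<^esub> \<sigma> n x) < \<epsilon>" if "m \<ge> N" "n \<ge> N" for m n
      proof -
        have "nrm F (\<sigma> m x \<ominus>\<^bsub>F\<^esub> \<sigma> n x) \<le> \<epsilon> / (nrm E x + 1) * nrm E x"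
          using diff[OF x, of m n] mult_right_mono[OF less_imp_le[OF N[OF that]] E.nrm_nonneg[OF x]] by linarith
        also have "\<dots> < \<epsilon> / (nrm E x + 1) * (nrm E x + 1)" by (intro mult_strict_left_mono) (use pos in auto)
        also have "\<dots> = \<epsilon>" using E.nrm_nonneg[OF x] by simp
        finally show ?thesis .
      qed
      then show ?thesis by blast
    qed
    then show ?thesis using F mem[OF x] unfolding F.mcomplete_iff by (auto simp: image_subset_iff)
  qed
  then obtain L where L: "\<And>x. x \<in> carrier E \<Longrightarrow> L x \<in> carrier F"
    "\<And>x. x \<in> carrier E \<Longrightarrow> (\<lambda>n. nrm F (\<sigma> n x \<ominus>\<^bsub>F\<^esub> L x)) \<longlonglongrightarrow> 0" by metis
  define T where "T = restrict L (carrier E)"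
  have T: "T x \<in> carrier F" "(\<lambda>n. nrm F (\<sigma> n x \<ominus>\<^bsub>F\<^esub> T x)) \<longlonglongrightarrow> 0" if "x \<in> carrier E" for x
    using L that by (auto simp: T_def)
  \<comment> \<open>Obtained by letting \<open>m\<close> tend to infinity in the Cauchy estimate.
    The same bound yields the boundedness of \<open>T\<close> and the convergence in norm.\<close>
  have close: "nrm F (\<sigma> n x \<ominus>\<^bsub>F\<^esub> T x) \<le> \<epsilon> * nrm E x"
    if N: "\<And>m n. m \<ge> N \<Longrightarrow> n \<ge> N \<Longrightarrow> nrm (op_space E F) (\<sigma> m \<ominus>\<^bsub>op_space E F\<^esub> \<sigma> n) < \<epsilon>"
      and x: "x \<in> carrier E" and n: "n \<ge> N" for N n \<epsilon> x
  proof -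
    have "nrm F (\<sigma> n x \<ominus>\<^bsub>F\<^esub> T x) \<le> \<epsilon> * nrm E x + nrm F (\<sigma> m x \<ominus>\<^bsub>F\<^esub> T x)" if "m \<ge> N" for m
      using F.nrm_diff_trans[OF mem[OF x] mem[OF x] T(1)[OF x], of n m] diff[OF x, of n m]
        mult_right_mono[OF less_imp_le[OF N[OF n that]] E.nrm_nonneg[OF x]] by linarith
    then show ?thesis
      using tendsto_add[OF tendsto_const T(2)[OF x], of "\<epsilon> * nrm E x"]
      by (intro LIMSEQ_le_const) auto
  qed
  obtain N1 where N1: "\<And>m n. m \<ge> N1 \<Longrightarrow> n \<ge> N1 \<Longrightarrow> nrm (op_space E F) (\<sigma> m \<ominus>\<^bsub>op_space E F\<^esub> \<sigma> n) < 1"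
    using cauchy by (meson zero_less_one)
  have T_op: "T \<in> bounded_ops E F"
  proof (rule bounded_opsI[where K = "1 + op_nrm E F (\<sigma> N1)"])
    fix x y c assume x: "x \<in> carrier E"
    show "T x \<in> carrier F" using T x by simp
    have c1: "nrm F (\<sigma> N1 x \<ominus>\<^bsub>F\<^esub> T x) \<le> 1 * nrm E x"
      by (rule close[OF _ x order_refl]) (rule N1)
    show "nrm F (T x) \<le> (1 + op_nrm E F (\<sigma> N1)) * nrm E x"
      using F.nrm_le_diff[OF T(1)[OF x] mem[OF x, of N1]] c1 op_nrm_bound[OF \<sigma> x, of N1]
        F.nrm_diff_commute[OF T(1)[OF x] mem[OF x, of N1]]
      by (simp add: algebra_simps)
    show "T (c \<odot>\<^bsub>E\<^esub> x) = c \<odot>\<^bsub>F\<^esub> T x"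
    proof (rule F.limit_unique[of "\<lambda>n. \<sigma> n (c \<odot>\<^bsub>E\<^esub> x)"])
      have "nrm F (\<sigma> n (c \<odot>\<^bsub>E\<^esub> x) \<ominus>\<^bsub>F\<^esub> c \<odot>\<^bsub>F\<^esub> T x) = cmod c * nrm F (\<sigma> n x \<ominus>\<^bsub>F\<^esub> T x)" for n
        using T(1)[OF x] mem[OF x] x bounded_opsD(3)[OF \<sigma>]
        by (simp add: F.smult_diff_right[symmetric] F.nrm_smult)
      then show "(\<lambda>n. nrm F (\<sigma> n (c \<odot>\<^bsub>E\<^esub> x) \<ominus>\<^bsub>F\<^esub> c \<odot>\<^bsub>F\<^esub> T x)) \<longlonglongrightarrow> 0"
        using tendsto_mult[OF tendsto_const T(2)[OF x], of "cmod c"] by simp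
    qed (use T x mem in auto)
    assume y: "y \<in> carrier E"
    show "T (x \<oplus>\<^bsub>E\<^esub> y) = T x \<oplus>\<^bsub>F\<^esub> T y"
    proof (rule F.limit_unique[of "\<lambda>n. \<sigma> n (x \<oplus>\<^bsub>E\<^esub> y)"])
      have "nrm F (\<sigma> n (x \<oplus>\<^bsub>E\<^esub> y) \<ominus>\<^bsub>F\<^esub> (T x \<oplus>\<^bsub>F\<^esub> T y)) \<le> nrm F (\<sigma> n x \<ominus>\<^bsub>F\<^esub> T x) + nrm F (\<sigma> n y \<ominus>\<^bsub>F\<^esub> T y)" for n
        using T(1)[OF x] T(1)[OF y] mem[OF x] mem[OF y] x y bounded_opsD(2)[OF \<sigma>]
        by (simp add: F.add_diff_add F.nrm_triangle)
      moreover have "(\<lambda>n. nrm F (\<sigma> n x \<ominus>\<^bsub>F\<^esub> T x) + nrm F (\<sigma> n y \<ominus>\<^bsub>F\<^esub> T y)) \<longlonglongrightarrow> 0"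
        using tendsto_add[OF T(2)[OF x] T(2)[OF y]] by simp
      ultimately show "(\<lambda>n. nrm F (\<sigma> n (x \<oplus>\<^bsub>E\<^esub> y) \<ominus>\<^bsub>F\<^esub> (T x \<oplus>\<^bsub>F\<^esub> T y))) \<longlonglongrightarrow> 0"
        by (rule_tac real_tendsto_sandwich[OF always_eventually always_eventually tendsto_const])
          (use T x y mem in \<open>auto intro!: F.nrm_nonneg\<close>)
    qed (use T x y mem in auto)
  qed (simp add: T_def)
  then have T_mem: "T \<in> carrier (op_space E F)" by (simp add: op_space_def)
  have "(\<lambda>n. nrm (op_space E F) (\<sigma> n \<ominus>\<^bsub>op_space E F\<^esub> T)) \<longlonglongrightarrow> 0"
  proof (rule LIMSEQ_I)
    fix \<epsilon> :: real assume \<epsilon>: "\<epsilon> > 0"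
    then obtain N where N: "\<And>m n. m \<ge> N \<Longrightarrow> n \<ge> N \<Longrightarrow> nrm (op_space E F) (\<sigma> m \<ominus>\<^bsub>op_space E F\<^esub> \<sigma> n) < \<epsilon> / 2"
      using cauchy by (meson half_gt_zero)
    have "norm (nrm (op_space E F) (\<sigma> n \<ominus>\<^bsub>op_space E F\<^esub> T) - 0) < \<epsilon>" if n: "n \<ge> N" for n
    proof -
      have "op_nrm E F (\<sigma> n \<ominus>\<^bsub>op_space E F\<^esub> T) \<le> \<epsilon> / 2"
        by (rule op_nrm_le) (use close[OF N _ n] \<epsilon> in \<open>auto simp: op_space_diff \<sigma> T_op\<close>)
      then have "nrm (op_space E F) (\<sigma> n \<ominus>\<^bsub>op_space E F\<^esub> T) \<le> \<epsilon> / 2" by (simp add: op_space_def)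
      then show ?thesis using \<epsilon> op_space.nrm_nonneg[of "\<sigma> n \<ominus>\<^bsub>op_space E F\<^esub> T"] \<sigma>' T_mem by simp
    qed
    then show "\<exists>N. \<forall>n\<ge>N. norm (nrm (op_space E F) (\<sigma> n \<ominus>\<^bsub>op_space E F\<^esub> T) - 0) < \<epsilon>" by blast
  qed
  with T_mem show "\<exists>T\<in>carrier (op_space E F). (\<lambda>n. nrm (op_space E F) (\<sigma> n \<ominus>\<^bsub>op_space E F\<^esub> T)) \<longlonglongrightarrow> 0" by blast
qed

section \<open>The algebra of compact operators\<close>

lemma op_space_simps:
  "carrier (op_space E F) = bounded_ops E F"
  "\<zero>\<^bsub>op_space E F\<^esub> = (\<lambda>x\<in>carrier E. \<zero>\<^bsub>F\<^esub>)"
  "S \<oplus>\<^bsub>op_space E F\<^esub> T = (\<lambda>x\<in>carrier E. S x \<oplus>\<^bsub>F\<^esub> T x)"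
  "c \<odot>\<^bsub>op_space E F\<^esub> T = (\<lambda>x\<in>carrier E. c \<odot>\<^bsub>F\<^esub> T x)"
  "nrm (op_space E F) = op_nrm E F"
  by (simp_all add: op_space_def)

lemma compact_op_algebra_simps:
  "carrier (compact_op_algebra E) = {T. compact_op E T}"
  "S \<otimes>\<^bsub>compact_op_algebra E\<^esub> T = compose (carrier E) S T"
  "\<zero>\<^bsub>compact_op_algebra E\<^esub> = (\<lambda>x\<in>carrier E. \<zero>\<^bsub>E\<^esub>)"
  "S \<oplus>\<^bsub>compact_op_algebra E\<^esub> T = (\<lambda>x\<in>carrier E. S x \<oplus>\<^bsub>E\<^esub> T x)"
  "c \<odot>\<^bsub>compact_op_algebra E\<^esub> T = (\<lambda>x\<in>carrier E. c \<odot>\<^bsub>E\<^esub> T x)"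
  "nrm (compact_op_algebra E) = op_nrm E E"
  by (simp_all add: compact_op_algebra_def op_algebra_def op_space_def)

text \<open>Only the fields relevant to a normed space are compared, because
  \<open>compact_op_algebra E\<close> and \<open>op_space E E\<close> differ in \<open>mult\<close>
  and \<open>one\<close>. Differences need a separate argument: additive inverses are defined by
  reference to the carrier.\<close>

lemma (in complex_normed_space) complex_normed_space_subspace:
  fixes W :: "'v normed_module"
  assumes "carrier W \<subseteq> carrier E" "\<zero> \<in> carrier W"
    and "\<And>x y. \<lbrakk>x \<in> carrier W; y \<in> carrier W\<rbrakk> \<Longrightarrow> x \<oplus> y \<in> carrier W"
    and "\<And>c x. x \<in> carrier W \<Longrightarrow> c \<odot> x \<in> carrier W"
    and "add W = add E" "zero W = zero E" "smult W = smult E" "nrm W = nrm E"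
  shows "complex_normed_space W"
    and "\<And>x y. \<lbrakk>x \<in> carrier W; y \<in> carrier W\<rbrakk> \<Longrightarrow> x \<ominus>\<^bsub>W\<^esub> y = x \<ominus> y"
proof -
  have mem: "x \<in> carrier E" if "x \<in> carrier W" for x
    using assms(1) that by blast
  show W: "complex_normed_space W"
    by (rule complex_normed_spaceI)
      (use assms(2-8) mem in \<open>simp_all add: M.a_ac smult_add_left smult_add_right nrm_nonneg
        nrm_eq_0_iff nrm_triangle nrm_smult\<close>)
  interpret W: complex_normed_space W by (rule W)
  show "x \<ominus>\<^bsub>W\<^esub> y = x \<ominus> y" if "x \<in> carrier W" "y \<in> carrier W" for x y
    using that mem by (simp add: diff_smult W.diff_smult assms(5,7))
qed

section \<open>Compact operators through finite nets\<close>

sublocale complex_banach_space \<subseteq> ops: normed_space_pair E E ..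

context complex_banach_space
begin

text \<open>In a complete space a set has compact closure exactly if it is totally bounded; all
  later estimates use the nets.\<close>

lemma compact_op_iff:
  "compact_op E T \<longleftrightarrow> T \<in> bounded_ops E E \<and> (\<forall>\<epsilon>>0. finite_net \<epsilon> (T ` unit_ball E))"
proof (cases "T \<in> bounded_ops E E")
  case True
  then have "T ` unit_ball E \<subseteq> carrier E"
    using bounded_opsD(1) by (force simp: unit_ball_def)
  then show ?thesis
    using True metric.mtotally_bounded_eq_compact_closure_of[OF complete, of "T ` unit_ball E"]
    by (simp add: compact_op_def mtotally_bounded_iff_finite_net)
qed (simp add: compact_op_def)

lemma compact_op_bounded: "compact_op E T \<Longrightarrow> T \<in> bounded_ops E E"
  by (simp add: compact_op_def)

lemma compact_op_net:
  assumes "compact_op E T" "\<epsilon> > 0"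
  obtains Z where "finite Z" "Z \<subseteq> carrier E" "\<And>x. x \<in> unit_ball E \<Longrightarrow> \<exists>z\<in>Z. nrm E (T x \<ominus> z) < \<epsilon>"
proof -
  have "\<exists>Z. finite Z \<and> Z \<subseteq> carrier E \<and> (\<forall>x\<in>unit_ball E. \<exists>z\<in>Z. nrm E (T x \<ominus> z) < \<epsilon>)"
    using assms by (simp add: compact_op_iff finite_net_def)
  then show thesis using that by (elim exE conjE) simp
qed

lemma compact_op_zero: "compact_op E (\<lambda>x\<in>carrier E. \<zero>)"
  unfolding compact_op_iff finite_net_def
  by (auto simp: ops.op_zero_mem unit_ball_def intro!: exI[of _ "{\<zero>}"])

lemma compact_op_add:
  assumes S: "compact_op E S" and T: "compact_op E T"
  shows "compact_op E (\<lambda>x\<in>carrier E. S x \<oplus> T x)"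
  unfolding compact_op_iff
proof (intro conjI allI impI)
  note S' = compact_op_bounded[OF S] and T' = compact_op_bounded[OF T]
  show "(\<lambda>x\<in>carrier E. S x \<oplus> T x) \<in> bounded_ops E E" by (rule ops.op_add[OF S' T'])
  fix \<epsilon> :: real assume "\<epsilon> > 0"
  then have \<epsilon>: "\<epsilon> / 2 > 0" by simp
  obtain Y where Y: "finite Y" "Y \<subseteq> carrier E" "\<And>x. x \<in> unit_ball E \<Longrightarrow> \<exists>z\<in>Y. nrm E (S x \<ominus> z) < \<epsilon> / 2"
    using compact_op_net[OF S \<epsilon>] by blast
  obtain Z where Z: "finite Z" "Z \<subseteq> carrier E" "\<And>x. x \<in> unit_ball E \<Longrightarrow> \<exists>z\<in>Z. nrm E (T x \<ominus> z) < \<epsilon> / 2"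
    using compact_op_net[OF T \<epsilon>] by blast
  show "finite_net \<epsilon> ((\<lambda>x\<in>carrier E. S x \<oplus> T x) ` unit_ball E)"
    unfolding finite_net_def
  proof (intro exI[of _ "(\<lambda>(y, z). y \<oplus> z) ` (Y \<times> Z)"] conjI ballI)
    fix w assume "w \<in> (\<lambda>x\<in>carrier E. S x \<oplus> T x) ` unit_ball E"
    then obtain x where x: "x \<in> unit_ball E" "w = S x \<oplus> T x" by (auto simp: unit_ball_def)
    then have xE: "x \<in> carrier E" by (simp add: unit_ball_def)
    obtain y z where yz: "y \<in> Y" "z \<in> Z" "nrm E (S x \<ominus> y) < \<epsilon> / 2" "nrm E (T x \<ominus> z) < \<epsilon> / 2"
      using Y(3)[OF x(1)] Z(3)[OF x(1)] by blast
    then have mem: "y \<in> carrier E" "z \<in> carrier E" "S x \<in> carrier E" "T x \<in> carrier E"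
      using Y Z bounded_opsD(1)[OF S' xE] bounded_opsD(1)[OF T' xE] by auto
    have "nrm E (w \<ominus> (y \<oplus> z)) < \<epsilon>"
      using nrm_triangle[of "S x \<ominus> y" "T x \<ominus> z"] mem yz x(2) by (simp add: add_diff_add)
    with yz show "\<exists>z\<in>(\<lambda>(y, z). y \<oplus> z) ` (Y \<times> Z). nrm E (w \<ominus> z) < \<epsilon>" by force
  qed (use Y Z in auto)
qed

lemma compact_op_compose_left:
  assumes S: "S \<in> bounded_ops E E" and T: "compact_op E T"
  shows "compact_op E (compose (carrier E) S T)"
  unfolding compact_op_iff
proof (intro conjI allI impI)
  note T' = compact_op_bounded[OF T]
  show "compose (carrier E) S T \<in> bounded_ops E E"
    by (rule compose_bounded_ops[OF _ _ _ S T']) unfold_locales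
  fix \<epsilon> :: real assume "\<epsilon> > 0"
  define \<delta> where "\<delta> = \<epsilon> / (op_nrm E E S + 1)"
  have pos: "\<delta> > 0" using \<open>\<epsilon> > 0\<close> ops.op_nrm_nonneg[OF S] by (simp add: \<delta>_def add_nonneg_pos)
  obtain Z where Z: "finite Z" "Z \<subseteq> carrier E" "\<And>x. x \<in> unit_ball E \<Longrightarrow> \<exists>z\<in>Z. nrm E (T x \<ominus> z) < \<delta>"
    using compact_op_net[OF T pos] by blast
  show "finite_net \<epsilon> (compose (carrier E) S T ` unit_ball E)"
    unfolding finite_net_def
  proof (intro exI[of _ "S ` Z"] conjI ballI)
    fix w assume "w \<in> compose (carrier E) S T ` unit_ball E"
    then obtain x where x: "x \<in> unit_ball E" "w = S (T x)" by (auto simp: unit_ball_def compose_eq)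
    then have xE: "x \<in> carrier E" by (simp add: unit_ball_def)
    obtain z where z: "z \<in> Z" "nrm E (T x \<ominus> z) < \<delta>" using Z(3)[OF x(1)] by blast
    then have mem: "z \<in> carrier E" "T x \<in> carrier E" using Z bounded_opsD(1)[OF T' xE] by auto
    have "nrm E (w \<ominus> S z) \<le> op_nrm E E S * nrm E (T x \<ominus> z)"
      using ops.op_nrm_bound[OF S, of "T x \<ominus> z"] mem x by (simp add: ops.op_diff[OF S])
    also have "\<dots> \<le> op_nrm E E S * \<delta>" using z ops.op_nrm_nonneg[OF S] by (intro mult_left_mono) auto
    also have "\<dots> < (op_nrm E E S + 1) * \<delta>" using pos by simp
    also have "\<dots> = \<epsilon>" using ops.op_nrm_nonneg[OF S] by (simp add: \<delta>_def)
    finally show "\<exists>z\<in>S ` Z. nrm E (w \<ominus> z) < \<epsilon>" using z by blast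
  qed (use Z bounded_opsD(1)[OF S] in auto)
qed

lemma compact_op_smult:
  assumes T: "compact_op E T"
  shows "compact_op E (\<lambda>x\<in>carrier E. c \<odot> T x)"
proof -
  have "(\<lambda>x\<in>carrier E. c \<odot> x) \<in> bounded_ops E E"
    by (rule bounded_opsI[where K = "cmod c"])
      (auto simp: smult_add_right nrm_smult mult.commute extensional_def)
  from compact_op_compose_left[OF this T]
  show ?thesis
    using bounded_opsD(1)[OF compact_op_bounded[OF T]] by (simp add: compose_def cong: restrict_cong)
qed

lemma compact_op_rank_one:
  assumes \<psi>: "\<psi> \<in> bounded_ops E complex_line" and v: "v \<in> carrier E"
  shows "compact_op E (\<lambda>x\<in>carrier E. \<psi> x \<odot> v)"
    and "op_nrm E E (\<lambda>x\<in>carrier E. \<psi> x \<odot> v) \<le> op_nrm E complex_line \<psi> * nrm E v"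
proof -
  interpret line: normed_space_pair E complex_line
    using complex_normed_space_axioms complex_normed_space_complex_line by (simp add: normed_space_pair_def)
  have le: "nrm E ((\<lambda>x\<in>carrier E. \<psi> x \<odot> v) x) \<le> (op_nrm E complex_line \<psi> * nrm E v) * nrm E x"
    if x: "x \<in> carrier E" for x
    using x v mult_right_mono[OF line.op_nrm_bound[OF \<psi> x] nrm_nonneg[OF v]]
    by (simp add: nrm_smult mult_ac)
  have op: "(\<lambda>x\<in>carrier E. \<psi> x \<odot> v) \<in> bounded_ops E E"
    by (rule bounded_opsI[OF _ _ _ _ le])
      (use v bounded_opsD[OF \<psi>] in \<open>auto simp: smult_add_left extensional_def\<close>)
  have "(\<lambda>x\<in>carrier E. \<psi> x \<odot> v) ` unit_ball E \<subseteq> (\<lambda>c. c \<odot> v) ` cball 0 (op_nrm E complex_line \<psi>)"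
    using line.op_nrm_unit_ball[OF \<psi>] by (auto simp: unit_ball_def)
  then show "compact_op E (\<lambda>x\<in>carrier E. \<psi> x \<odot> v)"
    unfolding compact_op_iff using op finite_net_mono[OF finite_net_bounded_scalars[OF v] order_refl] by blast
  show "op_nrm E E (\<lambda>x\<in>carrier E. \<psi> x \<odot> v) \<le> op_nrm E complex_line \<psi> * nrm E v"
    by (rule ops.op_nrm_le[OF le]) (use line.op_nrm_nonneg[OF \<psi>] nrm_nonneg[OF v] in auto)
qed

text \<open>Kuratowski's measure of noncompactness of the ball is at most \<open>\<rho>\<close> times itself, hence zero.\<close>

lemma compact_op_identity_if_near:
  assumes b: "compact_op E b" and \<rho>: "\<rho> < 1"
    and near: "\<And>x. x \<in> unit_ball E \<Longrightarrow> nrm E (x \<ominus> b x) \<le> \<rho>"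
  shows "compact_op E (\<lambda>x\<in>carrier E. x)"
proof -
  note b' = compact_op_bounded[OF b]
  \<comment> \<open>\<open>r\<close> is kept positive because it is divided by. Passing from
    \<open>r\<close> to the larger \<open>s < 1\<close> leaves the gap \<open>s - r\<close>, which
    pays for the net of the image of \<open>b\<close>.\<close>
  define r where "r = max \<rho> (1/2)"
  define s where "s = (r + 1) / 2"
  have r: "0 < r" "r < s" "s < 1" "\<rho> \<le> r" using \<rho> by (auto simp: r_def s_def)
  have net: "finite_net (2 * s ^ n) (unit_ball E)" for n
  proof (induction n)
    case 0
    show ?case
      unfolding finite_net_def
      by (intro exI[of _ "{\<zero>}"]) (auto simp: unit_ball_def diff_zero)
  next
    case (Suc n)
    then obtain Y where Y: "finite Y" "Y \<subseteq> carrier E" "\<And>x. x \<in> unit_ball E \<Longrightarrow> \<exists>z\<in>Y. nrm E (x \<ominus> z) < 2 * s ^ n"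
      unfolding finite_net_def by blast
    have "2 * (s - r) * s ^ n > 0" using r by simp
    from compact_op_net[OF b this] obtain Z where Z: "finite Z" "Z \<subseteq> carrier E"
      "\<And>x. x \<in> unit_ball E \<Longrightarrow> \<exists>z\<in>Z. nrm E (b x \<ominus> z) < 2 * (s - r) * s ^ n" by blast
    show ?case
      unfolding finite_net_def
    proof (intro exI[of _ "(\<lambda>(z, y). z \<oplus> complex_of_real r \<odot> y) ` (Z \<times> Y)"] conjI ballI)
      fix x assume x: "x \<in> unit_ball E"
      then have xE: "x \<in> carrier E" by (simp add: unit_ball_def)
      \<comment> \<open>The remainder \<open>x \<ominus> b x\<close>, rescaled, lies in the unit
        ball again, so the net of the previous stage applies to it.\<close>
      define w where "w = complex_of_real (inverse r) \<odot> (x \<ominus> b x)"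
      have bx: "b x \<in> carrier E" using bounded_opsD(1)[OF b' xE] .
      have w: "w \<in> unit_ball E"
        using near[OF x] r xE bx by (simp add: w_def unit_ball_def nrm_smult norm_divide field_simps)
      then have wE: "w \<in> carrier E" by (simp add: unit_ball_def)
      have xeq: "x = b x \<oplus> complex_of_real r \<odot> w"
        using r xE bx by (simp add: w_def M.a_comm[of "b x"])
      obtain z y where zy: "z \<in> Z" "nrm E (b x \<ominus> z) < 2 * (s - r) * s ^ n" "y \<in> Y" "nrm E (w \<ominus> y) < 2 * s ^ n"
        using Z(3)[OF x] Y(3)[OF w] by blast
      have mem: "z \<in> carrier E" "y \<in> carrier E" using zy Z Y by auto
      have "nrm E (x \<ominus> (z \<oplus> complex_of_real r \<odot> y)) = nrm E ((b x \<ominus> z) \<oplus> complex_of_real r \<odot> (w \<ominus> y))"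
        by (subst xeq) (use mem bx wE in \<open>simp add: add_diff_add smult_diff_right\<close>)
      also have "\<dots> \<le> nrm E (b x \<ominus> z) + r * nrm E (w \<ominus> y)"
        using nrm_triangle[of "b x \<ominus> z" "complex_of_real r \<odot> (w \<ominus> y)"] mem bx wE r by (simp add: nrm_smult)
      also have "\<dots> < 2 * (s - r) * s ^ n + r * (2 * s ^ n)"
        using zy r by (intro add_less_le_mono mult_left_mono) auto
      also have "\<dots> = 2 * s ^ Suc n" by (simp add: algebra_simps)
      finally show "\<exists>z\<in>(\<lambda>(z, y). z \<oplus> complex_of_real r \<odot> y) ` (Z \<times> Y). nrm E (x \<ominus> z) < 2 * s ^ Suc n"
        using zy by force
    qed (use Y Z in auto)
  qed
  have id: "(\<lambda>x\<in>carrier E. x) \<in> bounded_ops E E"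
    by (rule bounded_opsI[where K = 1]) (auto simp: extensional_def)
  moreover have "finite_net \<epsilon> ((\<lambda>x\<in>carrier E. x) ` unit_ball E)" if "\<epsilon> > 0" for \<epsilon>
  proof -
    obtain n where "s ^ n < \<epsilon> / 2" using real_arch_pow_inv[of "\<epsilon> / 2" s] \<open>\<epsilon> > 0\<close> r by auto
    then show ?thesis
      by (intro finite_net_mono[OF net[of n]]) (auto simp: unit_ball_def)
  qed
  ultimately show ?thesis unfolding compact_op_iff by blast
qed

sublocale K: complex_normed_space "compact_op_algebra E"
  by (rule ops.op_space.complex_normed_space_subspace(1))
    (auto simp: op_space_simps compact_op_algebra_simps compact_op_bounded compact_op_zero compact_op_add
      compact_op_smult fun_eq_iff)

lemma K_diff:
  assumes "compact_op E S" "compact_op E T"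
  shows "S \<ominus>\<^bsub>compact_op_algebra E\<^esub> T = S \<ominus>\<^bsub>op_space E E\<^esub> T"
  by (rule ops.op_space.complex_normed_space_subspace(2))
    (auto simp: op_space_simps compact_op_algebra_simps compact_op_bounded compact_op_zero compact_op_add
      compact_op_smult fun_eq_iff assms)

lemma K_diff_apply:
  assumes "compact_op E S" "compact_op E T" "x \<in> carrier E"
  shows "(S \<ominus>\<^bsub>compact_op_algebra E\<^esub> T) x = S x \<ominus> T x"
  using assms by (simp add: K_diff ops.op_space_diff compact_op_bounded)

lemma compact_op_limit:
  assumes \<sigma>: "\<And>n. compact_op E (\<sigma> n)" and T: "T \<in> bounded_ops E E"
    and lim: "(\<lambda>n::nat. op_nrm E E (\<sigma> n \<ominus>\<^bsub>op_space E E\<^esub> T)) \<longlonglongrightarrow> 0"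
  shows "compact_op E T"
  unfolding compact_op_iff
proof (intro conjI allI impI T)
  fix \<epsilon> :: real assume \<epsilon>: "\<epsilon> > 0"
  then obtain n where n: "op_nrm E E (\<sigma> n \<ominus>\<^bsub>op_space E E\<^esub> T) < \<epsilon> / 2"
    using order_tendstoD(2)[OF lim, of "\<epsilon> / 2"] by (auto simp: eventually_sequentially)
  note \<sigma>' = compact_op_bounded[OF \<sigma>]
  have d: "\<sigma> n \<ominus>\<^bsub>op_space E E\<^esub> T \<in> bounded_ops E E"
    using \<sigma>'[of n] T ops.op_space.M.minus_closed[of "\<sigma> n" T] by (simp add: op_space_simps)
  obtain Z where Z: "finite Z" "Z \<subseteq> carrier E" "\<And>x. x \<in> unit_ball E \<Longrightarrow> \<exists>z\<in>Z. nrm E (\<sigma> n x \<ominus> z) < \<epsilon> / 2"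
    using compact_op_net[OF \<sigma>, of "\<epsilon> / 2"] \<epsilon> by auto
  show "finite_net \<epsilon> (T ` unit_ball E)"
    unfolding finite_net_def
  proof (intro exI[of _ Z] conjI ballI)
    fix w assume "w \<in> T ` unit_ball E"
    then obtain x where x: "x \<in> unit_ball E" "w = T x" by blast
    then have xE: "x \<in> carrier E" by (simp add: unit_ball_def)
    obtain z where z: "z \<in> Z" "nrm E (\<sigma> n x \<ominus> z) < \<epsilon> / 2" using Z(3)[OF x(1)] by blast
    have mem: "z \<in> carrier E" "T x \<in> carrier E" "\<sigma> n x \<in> carrier E"
      using z Z bounded_opsD(1)[OF T xE] bounded_opsD(1)[OF \<sigma>' xE] by auto
    have "nrm E (\<sigma> n x \<ominus> T x) < \<epsilon> / 2"
      using ops.op_nrm_unit_ball[OF d x(1)] n \<sigma>'[of n] T xE by (simp add: ops.op_space_diff)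
    then have "nrm E (w \<ominus> z) < \<epsilon>"
      using nrm_diff_trans[OF mem(2,3,1)] nrm_diff_commute[OF mem(2,3)] z x by simp
    with z show "\<exists>z\<in>Z. nrm E (w \<ominus> z) < \<epsilon>" by blast
  qed (use Z in auto)
qed

lemma K_complete: "K.metric.mcomplete"
  unfolding K.mcomplete_iff
proof (intro allI impI, elim conjE)
  fix \<sigma> :: "nat \<Rightarrow> 'a \<Rightarrow> 'a"
  assume "range \<sigma> \<subseteq> carrier (compact_op_algebra E)"
  then have \<sigma>: "compact_op E (\<sigma> n)" for n by (auto simp: compact_op_algebra_simps)
  assume "\<forall>\<epsilon>>0. \<exists>N. \<forall>m\<ge>N. \<forall>n\<ge>N. nrm (compact_op_algebra E) (\<sigma> m \<ominus>\<^bsub>compact_op_algebra E\<^esub> \<sigma> n) < \<epsilon>"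
  then have "\<forall>\<epsilon>>0. \<exists>N. \<forall>m\<ge>N. \<forall>n\<ge>N. nrm (op_space E E) (\<sigma> m \<ominus>\<^bsub>op_space E E\<^esub> \<sigma> n) < \<epsilon>"
    by (simp add: K_diff \<sigma> compact_op_algebra_simps op_space_simps)
  then obtain T where T: "T \<in> bounded_ops E E" "(\<lambda>n. op_nrm E E (\<sigma> n \<ominus>\<^bsub>op_space E E\<^esub> T)) \<longlonglongrightarrow> 0"
    using ops.op_space_complete[OF complete] compact_op_bounded[OF \<sigma>]
    unfolding ops.op_space.mcomplete_iff by (simp add: op_space_simps image_subset_iff) blast
  then have "compact_op E T" by (rule compact_op_limit[OF \<sigma>])
  with T show "\<exists>T\<in>carrier (compact_op_algebra E).
      (\<lambda>n. nrm (compact_op_algebra E) (\<sigma> n \<ominus>\<^bsub>compact_op_algebra E\<^esub> T)) \<longlonglongrightarrow> 0"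
    by (intro bexI[of _ T]) (auto simp: compact_op_algebra_simps K_diff \<sigma>)
qed

lemma compact_op_algebra_banach: "complex_banach_algebra (compact_op_algebra E)"
proof (intro complex_banach_algebra.intro complex_banach_space.intro complex_banach_space_axioms.intro
    complex_banach_algebra_axioms.intro K.complex_normed_space_axioms K_complete)
  fix S T U :: "'a \<Rightarrow> 'a" and c
  assume S: "S \<in> carrier (compact_op_algebra E)" and T: "T \<in> carrier (compact_op_algebra E)"
  then have S': "compact_op E S" and T': "compact_op E T" by (auto simp: compact_op_algebra_simps)
  note Sb = compact_op_bounded[OF S'] and Tb = compact_op_bounded[OF T']
  note mem = bounded_opsD[OF Sb] bounded_opsD[OF Tb]
  show "S \<otimes>\<^bsub>compact_op_algebra E\<^esub> T \<in> carrier (compact_op_algebra E)"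
    using compact_op_compose_left[OF Sb T'] by (simp add: compact_op_algebra_simps)
  show "(c \<odot>\<^bsub>compact_op_algebra E\<^esub> S) \<otimes>\<^bsub>compact_op_algebra E\<^esub> T = c \<odot>\<^bsub>compact_op_algebra E\<^esub> (S \<otimes>\<^bsub>compact_op_algebra E\<^esub> T)"
    "S \<otimes>\<^bsub>compact_op_algebra E\<^esub> (c \<odot>\<^bsub>compact_op_algebra E\<^esub> T) = c \<odot>\<^bsub>compact_op_algebra E\<^esub> (S \<otimes>\<^bsub>compact_op_algebra E\<^esub> T)"
    using mem by (auto simp: compact_op_algebra_simps compose_def intro!: restrict_ext)
  show "nrm (compact_op_algebra E) (S \<otimes>\<^bsub>compact_op_algebra E\<^esub> T)
      \<le> nrm (compact_op_algebra E) S * nrm (compact_op_algebra E) T"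
    unfolding compact_op_algebra_simps
    by (rule compose_bounded_ops(2)[OF _ _ _ Sb Tb]) unfold_locales
  assume U: "U \<in> carrier (compact_op_algebra E)"
  note mem = mem bounded_opsD[OF compact_op_bounded[of U]]
  show "(S \<otimes>\<^bsub>compact_op_algebra E\<^esub> T) \<otimes>\<^bsub>compact_op_algebra E\<^esub> U = S \<otimes>\<^bsub>compact_op_algebra E\<^esub> (T \<otimes>\<^bsub>compact_op_algebra E\<^esub> U)"
    "S \<otimes>\<^bsub>compact_op_algebra E\<^esub> (T \<oplus>\<^bsub>compact_op_algebra E\<^esub> U) = S \<otimes>\<^bsub>compact_op_algebra E\<^esub> T \<oplus>\<^bsub>compact_op_algebra E\<^esub> S \<otimes>\<^bsub>compact_op_algebra E\<^esub> U"
    "(S \<oplus>\<^bsub>compact_op_algebra E\<^esub> T) \<otimes>\<^bsub>compact_op_algebra E\<^esub> U = S \<otimes>\<^bsub>compact_op_algebra E\<^esub> U \<oplus>\<^bsub>compact_op_algebra E\<^esub> T \<otimes>\<^bsub>compact_op_algebra E\<^esub> U"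
    using mem U by (auto simp: compact_op_algebra_simps compose_def intro!: restrict_ext)
qed

end

section \<open>The multiplier unitization\<close>

lemma (in complex_normed_space) dual_pair: "normed_space_pair E complex_line"
  using complex_normed_space_axioms complex_normed_space_complex_line by (simp add: normed_space_pair_def)

text \<open>The annihilator of the whole space is zero, the range of the zero projection. This
  settles the algebras that are their own unitization.\<close>

lemma (in complex_normed_space) M_ideal_carrier: "M_ideal E (carrier E)"
proof -
  interpret line: normed_space_pair E complex_line by (rule dual_pair)
  let ?D = "dual_space E"
  have D: "complex_normed_space ?D"
    unfolding dual_space_def by (rule line.op_space.complex_normed_space_axioms)
  then interpret D: complex_normed_space ?D .
  have ann: "annihilator E (carrier E) = {\<zero>\<^bsub>?D\<^esub>}"
  proof -
    have "f = \<zero>\<^bsub>?D\<^esub>" if "f \<in> carrier ?D" "\<And>x. x \<in> carrier E \<Longrightarrow> f x = 0" for f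
      using that D.M.zero_closed unfolding dual_space_def
      by (intro op_eqI[of _ E complex_line]) (auto simp: op_space_simps)
    then have "annihilator E (carrier E) \<subseteq> {\<zero>\<^bsub>?D\<^esub>}"
      unfolding annihilator_def by blast
    moreover have "\<zero>\<^bsub>?D\<^esub> \<in> annihilator E (carrier E)"
      unfolding annihilator_def using line.op_zero_mem by (simp add: dual_space_def op_space_simps)
    ultimately show ?thesis by blast
  qed
  have DD: "normed_space_pair ?D ?D" using D by (simp add: normed_space_pair_def)
  have "L_projection ?D (\<lambda>f\<in>carrier ?D. \<zero>\<^bsub>?D\<^esub>)"
    unfolding L_projection_def
    using normed_space_pair.op_zero_mem[OF DD] by (auto simp: compose_def fun_eq_iff)
  moreover have "annihilator E (carrier E) = (\<lambda>f\<in>carrier ?D. \<zero>\<^bsub>?D\<^esub>) ` carrier ?D"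
    unfolding ann using D.M.zero_closed by auto
  ultimately have "L_summand ?D (annihilator E (carrier E))"
    unfolding L_summand_def by blast
  then show ?thesis
    unfolding M_ideal_def using carrier_is_submodule closedin_topspace[of metric.mtopology] by simp
qed

text \<open>The compact contractions that fix given vectors serve two purposes: they force any unit
  of the algebra to be the identity operator, and they let the supremum over compact contractions
  reach the operator norm.\<close>

locale norming_space = complex_banach_space +
  assumes norming: "u \<in> carrier E \<Longrightarrow> \<exists>c. compact_op E c \<and> op_nrm E E c \<le> 1 \<and> c u = u"
begin

abbreviation "K \<equiv> compact_op_algebra E"
abbreviation "K1 \<equiv> mult_unitization K"
abbreviation "idE \<equiv> (\<lambda>x\<in>carrier E. x)"

lemma Id_bounded: "idE \<in> bounded_ops E E" "op_nrm E E idE \<le> 1"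
  by (rule bounded_opsI[where K = 1], auto simp: extensional_def)
    (rule ops.op_nrm_le, auto)

text \<open>A unit of \<open>K\<close> fixes the range of every compact operator, hence every vector
  by \<open>norming\<close>. Conversely, a compact identity is a unit, and it has norm 1 unless the
  space is zero.\<close>

lemma own_iff: "unital K \<or> carrier K = {\<zero>\<^bsub>K\<^esub>} \<longleftrightarrow> compact_op E idE"
proof
  assume "unital K \<or> carrier K = {\<zero>\<^bsub>K\<^esub>}"
  then show "compact_op E idE"
  proof
    assume "unital K"
    then obtain e where e: "compact_op E e" "\<And>a. compact_op E a \<Longrightarrow> compose (carrier E) e a = a"
      unfolding unital_def by (auto simp: compact_op_algebra_simps)
    have "e u = u" if u: "u \<in> carrier E" for u
    proof -
      obtain c where c: "compact_op E c" "c u = u" using norming[OF u] by blast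
      have "compose (carrier E) e c u = c u" by (simp only: e(2)[OF c(1)])
      then show ?thesis using c u by (simp add: compose_eq)
    qed
    then have "e = idE"
      using bounded_opsD(4)[OF compact_op_bounded[OF e(1)]] by (intro extensionalityI[of _ "carrier E"]) auto
    with e show ?thesis by simp
  next
    assume K: "carrier K = {\<zero>\<^bsub>K\<^esub>}"
    have "u = \<zero>" if u: "u \<in> carrier E" for u
    proof -
      obtain c where c: "compact_op E c" "c u = u" using norming[OF u] by blast
      then have "c \<in> carrier K" by (simp add: compact_op_algebra_simps)
      then have "c = (\<lambda>x\<in>carrier E. \<zero>)" unfolding K by (simp add: compact_op_algebra_simps)
      with c u show ?thesis by simp
    qed
    then have "idE = (\<lambda>x\<in>carrier E. \<zero>)" by (auto intro!: restrict_ext)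
    then show ?thesis using compact_op_zero by simp
  qed
next
  assume idE: "compact_op E idE"
  show "unital K \<or> carrier K = {\<zero>\<^bsub>K\<^esub>}"
  proof (cases "op_nrm E E idE = 1")
    case True
    have "compose (carrier E) idE a = a \<and> compose (carrier E) a idE = a" if "compact_op E a" for a
      using bounded_opsD[OF compact_op_bounded[OF that]]
      by (auto intro!: extensionalityI[of _ "carrier E"] simp: compose_eq compose_def)
    then show ?thesis
      using True idE unfolding unital_def by (auto simp: compact_op_algebra_simps)
  next
    case False
    then have lt: "op_nrm E E idE < 1" using Id_bounded by simp
    have z: "x = \<zero>" if x: "x \<in> carrier E" for x
    proof (rule ccontr)
      assume "x \<noteq> \<zero>"
      then have "nrm E x > 0" using x nrm_nonneg[OF x] nrm_eq_0_iff[OF x] by linarith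
      moreover have "nrm E x \<le> op_nrm E E idE * nrm E x"
        using ops.op_nrm_bound[OF Id_bounded(1) x] x by simp
      ultimately show False using lt by simp
    qed
    have "a \<in> {\<zero>\<^bsub>K\<^esub>}" if "a \<in> carrier K" for a
    proof -
      have a: "compact_op E a" using that by (simp add: compact_op_algebra_simps)
      have "a x = \<zero>" if "x \<in> carrier E" for x
        by (rule z[OF bounded_opsD(1)[OF compact_op_bounded[OF a] that]])
      then show ?thesis
        using bounded_opsD(4)[OF compact_op_bounded[OF a]]
        by (intro singleton_iff[THEN iffD2] extensionalityI[of _ "carrier E"])
          (simp_all add: compact_op_algebra_simps)
    qed
    then have "carrier K = {\<zero>\<^bsub>K\<^esub>}"
      using K.M.zero_closed by blast
    then show ?thesis ..
  qed
qed

text \<open>The operator a + s1 on \<open>E\<close> for which the pair \<open>(a, s)\<close> of the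
  unitization stands.\<close>

definition aug :: "('a \<Rightarrow> 'a) \<Rightarrow> complex \<Rightarrow> 'a \<Rightarrow> 'a" where
  "aug a s = (\<lambda>x\<in>carrier E. a x \<oplus> s \<odot> x)"

lemma aug_apply: "x \<in> carrier E \<Longrightarrow> aug a s x = a x \<oplus> s \<odot> x"
  by (simp add: aug_def)

lemma aug_bounded:
  assumes "a \<in> bounded_ops E E" shows "aug a s \<in> bounded_ops E E"
proof -
  have "aug a s = (\<lambda>x\<in>carrier E. a x \<oplus> (\<lambda>x\<in>carrier E. s \<odot> idE x) x)"
    by (auto simp: aug_def intro!: restrict_ext)
  then show ?thesis
    using ops.op_add(1)[OF assms ops.op_smult(1)[OF Id_bounded(1), of s]] by simp
qed

text \<open>Otherwise the compact operator -a/s would be at distance less than 1 from the identity,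
  which would then be compact by \<open>compact_op_identity_if_near\<close>. This makes the
  multiplier norm definite and \<open>chi\<close> contractive.\<close>

lemma cmod_le_aug:
  assumes a: "compact_op E a" and nc: "\<not> compact_op E idE"
  shows "cmod s \<le> op_nrm E E (aug a s)"
proof (rule ccontr)
  assume "\<not> ?thesis"
  then have lt: "op_nrm E E (aug a s) < cmod s" by simp
  note a' = compact_op_bounded[OF a]
  note aug' = aug_bounded[OF a', of s]
  have s: "s \<noteq> 0" using lt ops.op_nrm_nonneg[OF aug'] by auto
  define b where "b = (\<lambda>x\<in>carrier E. (- inverse s) \<odot> a x)"
  have b: "compact_op E b" unfolding b_def by (rule compact_op_smult[OF a])
  have "compact_op E idE"
  proof (rule compact_op_identity_if_near[OF b])
    show "op_nrm E E (aug a s) / cmod s < 1" using lt s by simp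
    fix x assume x: "x \<in> unit_ball E"
    then have xE: "x \<in> carrier E" by (simp add: unit_ball_def)
    have ax: "a x \<in> carrier E" using bounded_opsD(1)[OF a' xE] .
    have "x \<ominus> b x = inverse s \<odot> aug a s x"
      using xE ax s by (simp add: b_def diff_smult aug_apply smult_add_right M.a_comm)
    then have "nrm E (x \<ominus> b x) = nrm E (aug a s x) / cmod s"
      using bounded_opsD(1)[OF aug' xE] by (simp add: nrm_smult norm_inverse divide_inverse)
    then show "nrm E (x \<ominus> b x) \<le> op_nrm E E (aug a s) / cmod s"
      using ops.op_nrm_unit_ball[OF aug' x] by (simp add: divide_right_mono)
  qed
  with nc show False by blast
qed

lemma unitization_simps:
  "carrier K1 = (if compact_op E idE then carrier K \<times> {0} else carrier K \<times> UNIV)"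
  "\<zero>\<^bsub>K1\<^esub> = (\<zero>\<^bsub>K\<^esub>, 0)"
  "(a, s) \<oplus>\<^bsub>K1\<^esub> (b, t) = (a \<oplus>\<^bsub>K\<^esub> b, s + t)"
  "r \<odot>\<^bsub>K1\<^esub> (a, s) = (r \<odot>\<^bsub>K\<^esub> a, r * s)"
  by (simp_all add: mult_unitization_def own_iff Let_def)

text \<open>Composition with a contraction does not increase the norm. The supremum is not smaller
  either, because each \<open>u\<close> in the unit ball is \<open>c u\<close> for some compact
  contraction \<open>c\<close>.\<close>

lemma nrm_unitization:
  assumes a: "compact_op E a"
  shows "nrm K1 (a, s) = (if compact_op E idE then op_nrm E E a else op_nrm E E (aug a s))"
proof (cases "compact_op E idE")
  case True
  then show ?thesis
    using own_iff by (simp add: mult_unitization_def Let_def compact_op_algebra_simps)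
next
  case False
  note a' = compact_op_bounded[OF a]
  note aug' = aug_bounded[OF a', of s]
  have eq: "nrm K1 (a, s) = (SUP c\<in>unit_ball K. op_nrm E E (compose (carrier E) (aug a s) c))"
  proof -
    have "a \<otimes>\<^bsub>K\<^esub> c \<oplus>\<^bsub>K\<^esub> s \<odot>\<^bsub>K\<^esub> c = compose (carrier E) (aug a s) c" if "c \<in> unit_ball K" for c
    proof -
      have "c x \<in> carrier E" if "x \<in> carrier E" for x
        using bounded_opsD(1)[OF compact_op_bounded that] \<open>c \<in> unit_ball K\<close>
        by (simp add: unit_ball_def compact_op_algebra_simps)
      then show ?thesis
        unfolding compact_op_algebra_simps compose_def by (intro restrict_ext) (simp add: aug_apply)
    qed
    then show ?thesis
      using False own_iff by (simp add: mult_unitization_def Let_def) (simp add: compact_op_algebra_simps)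
  qed
  have le: "op_nrm E E (compose (carrier E) (aug a s) c) \<le> op_nrm E E (aug a s)" if "c \<in> unit_ball K" for c
  proof -
    have c: "c \<in> bounded_ops E E" "op_nrm E E c \<le> 1"
      using that compact_op_bounded by (auto simp: unit_ball_def compact_op_algebra_simps)
    have "op_nrm E E (compose (carrier E) (aug a s) c) \<le> op_nrm E E (aug a s) * op_nrm E E c"
      by (rule compose_bounded_ops(2)[OF _ _ _ aug' c(1)]) unfold_locales
    also have "\<dots> \<le> op_nrm E E (aug a s) * 1"
      using c ops.op_nrm_nonneg[OF aug'] by (intro mult_left_mono) auto
    finally show ?thesis by simp
  qed
  have "nrm K1 (a, s) = op_nrm E E (aug a s)"
  proof (rule antisym)
    show "nrm K1 (a, s) \<le> op_nrm E E (aug a s)"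
      unfolding eq by (intro cSUP_least le) (use K.zero_in_unit_ball in blast)
    have bdd: "bdd_above ((\<lambda>c. op_nrm E E (compose (carrier E) (aug a s) c)) ` unit_ball K)"
      using le by (auto simp: bdd_above_def)
    show "op_nrm E E (aug a s) \<le> nrm K1 (a, s)"
    proof (rule ops.op_nrm_leI)
      fix u assume u: "u \<in> unit_ball E"
      then have uE: "u \<in> carrier E" by (simp add: unit_ball_def)
      obtain c where c: "compact_op E c" "op_nrm E E c \<le> 1" "c u = u" using norming[OF uE] by blast
      then have cK: "c \<in> unit_ball K" by (simp add: unit_ball_def compact_op_algebra_simps)
      have "compose (carrier E) (aug a s) c \<in> bounded_ops E E"
        by (rule compose_bounded_ops(1)[OF _ _ _ aug' compact_op_bounded[OF c(1)]]) unfold_locales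
      from ops.op_nrm_unit_ball[OF this u]
      have "nrm E (aug a s u) \<le> op_nrm E E (compose (carrier E) (aug a s) c)"
        using c uE by (simp add: compose_eq)
      also have "\<dots> \<le> nrm K1 (a, s)" unfolding eq by (rule cSUP_upper[OF cK bdd])
      finally show "nrm E (aug a s u) \<le> nrm K1 (a, s)" .
    qed
  qed
  with False show ?thesis by simp
qed

lemma aug_zero: "aug (\<lambda>x\<in>carrier E. \<zero>) s = (\<lambda>x\<in>carrier E. s \<odot> x)"
  by (auto simp: aug_def intro!: restrict_ext)

lemma aug_0: "a \<in> bounded_ops E E \<Longrightarrow> aug a 0 = a"
  using bounded_opsD[of a E E] by (auto simp: aug_def intro!: extensionalityI[of _ "carrier E"])

lemma aug_add:
  "\<lbrakk>a \<in> bounded_ops E E; b \<in> bounded_ops E E\<rbrakk>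
    \<Longrightarrow> aug (a \<oplus>\<^bsub>K\<^esub> b) (s + t) = (\<lambda>x\<in>carrier E. aug a s x \<oplus> aug b t x)"
  using bounded_opsD(1)[of a E E] bounded_opsD(1)[of b E E]
  unfolding aug_def compact_op_algebra_simps by (intro restrict_ext) (simp add: smult_add_left M.a_ac)

lemma aug_smult:
  "a \<in> bounded_ops E E \<Longrightarrow> aug (r \<odot>\<^bsub>K\<^esub> a) (r * s) = (\<lambda>x\<in>carrier E. r \<odot> aug a s x)"
  using bounded_opsD(1)[of a E E]
  unfolding aug_def compact_op_algebra_simps by (intro restrict_ext) (simp add: smult_add_right)

lemma nrm_unitization_aug:
  "(a, s) \<in> carrier K1 \<Longrightarrow> nrm K1 (a, s) = op_nrm E E (aug a s)"
  by (auto simp: nrm_unitization unitization_simps compact_op_algebra_simps aug_0 compact_op_bounded split: if_splits)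

lemma unitization_bounded:
  "(a, s) \<in> carrier K1 \<Longrightarrow> compact_op E a \<and> a \<in> bounded_ops E E \<and> aug a s \<in> bounded_ops E E"
  by (auto simp: unitization_simps compact_op_algebra_simps compact_op_bounded aug_bounded split: if_splits)

sublocale K1: complex_normed_space K1
proof (rule complex_normed_spaceI)
  fix X Y Z :: "('a \<Rightarrow> 'a) \<times> complex" and r q
  show "\<zero>\<^bsub>K1\<^esub> \<in> carrier K1"
    by (simp add: unitization_simps)
  assume X: "X \<in> carrier K1"
  obtain a s where [simp]: "X = (a, s)" by (cases X)
  have a: "a \<in> carrier K" using X by (auto simp: unitization_simps split: if_splits)
  note a' = unitization_bounded[OF X[unfolded \<open>X = (a, s)\<close>]]
  have nX: "nrm K1 X = op_nrm E E (aug a s)" using nrm_unitization_aug X by simp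
  show rX: "r \<odot>\<^bsub>K1\<^esub> X \<in> carrier K1"
    using X by (auto simp: unitization_simps split: if_splits)
  show "\<zero>\<^bsub>K1\<^esub> \<oplus>\<^bsub>K1\<^esub> X = X" "0 \<odot>\<^bsub>K1\<^esub> X = \<zero>\<^bsub>K1\<^esub>" "1 \<odot>\<^bsub>K1\<^esub> X = X"
    "(r + q) \<odot>\<^bsub>K1\<^esub> X = r \<odot>\<^bsub>K1\<^esub> X \<oplus>\<^bsub>K1\<^esub> q \<odot>\<^bsub>K1\<^esub> X" "(r * q) \<odot>\<^bsub>K1\<^esub> X = r \<odot>\<^bsub>K1\<^esub> (q \<odot>\<^bsub>K1\<^esub> X)"
    using a by (auto simp: unitization_simps K.smult_add_left distrib_right)
  show "0 \<le> nrm K1 X"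
    using nX ops.op_nrm_nonneg a' by simp
  show "nrm K1 (r \<odot>\<^bsub>K1\<^esub> X) = cmod r * nrm K1 X"
    using nX rX a' by (simp add: unitization_simps(4) nrm_unitization_aug aug_smult ops.op_smult(2))
  show "X = \<zero>\<^bsub>K1\<^esub>" if z: "nrm K1 X = 0"
  proof -
    have "s = 0"
    proof (cases "compact_op E idE")
      case True
      then show ?thesis using X by (simp add: unitization_simps)
    next
      case False
      then show ?thesis using cmod_le_aug[of a s] a' nX z by simp
    qed
    then have "nrm K a = 0" using nX z a' by (simp add: aug_0 compact_op_algebra_simps)
    with a \<open>s = 0\<close> show ?thesis by (simp add: K.nrm_eq_0_iff unitization_simps)
  qed
  assume Y: "Y \<in> carrier K1"
  obtain b t where [simp]: "Y = (b, t)" by (cases Y)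
  have b: "b \<in> carrier K" using Y by (auto simp: unitization_simps split: if_splits)
  note b' = unitization_bounded[OF Y[unfolded \<open>Y = (b, t)\<close>]]
  have nY: "nrm K1 Y = op_nrm E E (aug b t)" using nrm_unitization_aug Y by simp
  show XY: "X \<oplus>\<^bsub>K1\<^esub> Y \<in> carrier K1"
    using X Y by (auto simp: unitization_simps split: if_splits)
  show "X \<oplus>\<^bsub>K1\<^esub> Y = Y \<oplus>\<^bsub>K1\<^esub> X" "r \<odot>\<^bsub>K1\<^esub> (X \<oplus>\<^bsub>K1\<^esub> Y) = r \<odot>\<^bsub>K1\<^esub> X \<oplus>\<^bsub>K1\<^esub> r \<odot>\<^bsub>K1\<^esub> Y"
    using a b by (auto simp: unitization_simps K.smult_add_right K.M.a_comm algebra_simps)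
  show "nrm K1 (X \<oplus>\<^bsub>K1\<^esub> Y) \<le> nrm K1 X + nrm K1 Y"
    using nX nY XY a' b' by (simp add: unitization_simps(3) nrm_unitization_aug aug_add ops.op_add(2))
  assume Z: "Z \<in> carrier K1"
  then show "X \<oplus>\<^bsub>K1\<^esub> Y \<oplus>\<^bsub>K1\<^esub> Z = X \<oplus>\<^bsub>K1\<^esub> (Y \<oplus>\<^bsub>K1\<^esub> Z)"
    using a b by (cases Z) (auto simp: unitization_simps K.M.a_assoc split: if_splits)
qed

lemma unitization_diff:
  assumes "(a, s) \<in> carrier K1" "(b, t) \<in> carrier K1"
  shows "(a, s) \<ominus>\<^bsub>K1\<^esub> (b, t) = (a \<ominus>\<^bsub>K\<^esub> b, s - t)"
proof -
  have "a \<in> carrier K" "b \<in> carrier K" using assms by (auto simp: unitization_simps split: if_splits)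
  then show ?thesis
    using assms by (simp add: K1.diff_smult K.diff_smult unitization_simps)
qed

lemma M_ideal_if_identity_compact:
  assumes "compact_op E idE" shows "M_ideal K1 (carrier K \<times> {0})"
  using K1.M_ideal_carrier assms by (simp add: unitization_simps)

definition chi :: "('a \<Rightarrow> 'a) \<times> complex \<Rightarrow> complex" where
  "chi = (\<lambda>X\<in>carrier K1. snd X)"

sublocale K1_dual: normed_space_pair K1 complex_line
  by (rule K1.dual_pair)

end

section \<open>The unitization and its dual when the identity is not compact\<close>

locale norming_space_noncompact = norming_space +
  assumes Id_noncompact: "\<not> compact_op E idE"
begin

lemma mem_unitization_iff: "(a, s) \<in> carrier K1 \<longleftrightarrow> compact_op E a"
  using Id_noncompact by (simp add: unitization_simps compact_op_algebra_simps)

lemma nrm_unitization_eq: "compact_op E a \<Longrightarrow> nrm K1 (a, s) = op_nrm E E (aug a s)"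
  by (simp add: mem_unitization_iff nrm_unitization_aug)

lemma cmod_snd_le: "X \<in> carrier K1 \<Longrightarrow> cmod (snd X) \<le> nrm K1 X"
  using cmod_le_aug[OF _ Id_noncompact] by (cases X) (simp add: mem_unitization_iff nrm_unitization_eq)

lemma chi_bounded: "chi \<in> bounded_ops K1 complex_line" "op_nrm K1 complex_line chi = 1"
proof -
  have le: "nrm complex_line (chi X) \<le> 1 * nrm K1 X" if "X \<in> carrier K1" for X
    using cmod_snd_le that by (simp add: chi_def)
  have add: "snd (X \<oplus>\<^bsub>K1\<^esub> Y) = snd X + snd Y" and smult: "snd (c \<odot>\<^bsub>K1\<^esub> X) = c * snd X" for X Y c
    by (cases X; cases Y; simp add: unitization_simps)+
  show chi: "chi \<in> bounded_ops K1 complex_line"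
    by (rule bounded_opsI[OF _ _ _ _ le]) (auto simp: chi_def add smult extensional_def)
  show "op_nrm K1 complex_line chi = 1"
  proof (rule antisym)
    show "op_nrm K1 complex_line chi \<le> 1" by (rule K1_dual.op_nrm_le[OF le]) auto
    let ?one = "(\<lambda>x\<in>carrier E. \<zero>, 1)"
    have "nrm K1 ?one \<le> 1"
      using Id_bounded by (simp add: nrm_unitization_eq compact_op_zero aug_zero cong: restrict_cong)
    then have "?one \<in> unit_ball K1"
      by (simp add: unit_ball_def mem_unitization_iff compact_op_zero)
    from K1_dual.op_nrm_unit_ball[OF chi this] show "1 \<le> op_nrm K1 complex_line chi"
      by (simp add: chi_def mem_unitization_iff compact_op_zero)
  qed
qed

lemma functional_split:
  assumes f: "f \<in> bounded_ops K1 complex_line" and a: "compact_op E a"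
  shows "f (a, s) = f (a, 0) + s * f (\<zero>\<^bsub>K\<^esub>, 1)"
proof -
  have aK: "a \<in> carrier K" using a by (simp add: compact_op_algebra_simps)
  have mem: "(a, 0) \<in> carrier K1" "(\<zero>\<^bsub>K\<^esub>, 1) \<in> carrier K1"
    using aK Id_noncompact by (auto simp: unitization_simps)
  have "f (a, s) = f ((a, 0) \<oplus>\<^bsub>K1\<^esub> s \<odot>\<^bsub>K1\<^esub> (\<zero>\<^bsub>K\<^esub>, 1))" using aK by (simp add: unitization_simps)
  also have "\<dots> = f (a, 0) + s * f (\<zero>\<^bsub>K\<^esub>, 1)"
    using mem bounded_opsD(2)[OF f mem(1) K1.smult_closed'[OF mem(2)], of s] bounded_opsD(3)[OF f mem(2), of s]
    by simp
  finally show ?thesis .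
qed

text \<open>By \<open>functional_split\<close> a functional is determined by its values on
  \<open>K\<close> and at the unit, so one that vanishes on \<open>K\<close> has a single free
  parameter.\<close>

lemma annihilator_unitization:
  "annihilator K1 (carrier K \<times> {0}) = range (\<lambda>t. t \<odot>\<^bsub>dual_space K1\<^esub> chi)"
proof -
  have "f = f (\<zero>\<^bsub>K\<^esub>, 1) \<odot>\<^bsub>dual_space K1\<^esub> chi"
    if f: "f \<in> bounded_ops K1 complex_line" and z: "\<And>a. a \<in> carrier K \<Longrightarrow> f (a, 0) = 0" for f
  proof -
    have "f (a, s) = f (\<zero>\<^bsub>K\<^esub>, 1) * s" if "compact_op E a" for a s
      using functional_split[OF f that, of s] z[of a] that by (simp add: compact_op_algebra_simps)
    then have "f X = f (\<zero>\<^bsub>K\<^esub>, 1) * snd X" if "X \<in> carrier K1" for X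
      using that by (cases X) (simp add: mem_unitization_iff)
    then show ?thesis
      using bounded_opsD(4)[OF f]
      by (auto intro!: extensionalityI[of _ "carrier K1"] simp: dual_space_def op_space_simps chi_def)
  qed
  moreover have "t \<odot>\<^bsub>dual_space K1\<^esub> chi \<in> annihilator K1 (carrier K \<times> {0})" for t
    using K1_dual.op_smult(1)[OF chi_bounded(1), of t] Id_noncompact
    by (auto simp: annihilator_def dual_space_def op_space_simps chi_def unitization_simps)
  moreover have "annihilator K1 (carrier K \<times> {0}) \<subseteq>
      {f \<in> bounded_ops K1 complex_line. \<forall>a\<in>carrier K. f (a, 0) = 0}"
    by (auto simp: annihilator_def dual_space_def op_space_simps)
  ultimately show ?thesis by blast
qed

text \<open>The scalar part is contractive, so a point with scalar part \<open>s\<close> is at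
  distance at least \<open>cmod s\<close> from \<open>K\<close>.\<close>

lemma closedin_K: "closedin K1.metric.mtopology (carrier K \<times> {0})"
  unfolding K1.metric.closedin_metric
proof (intro conjI allI impI)
  show "carrier K \<times> {0} \<subseteq> carrier K1" by (auto simp: unitization_simps)
  fix X assume X: "X \<in> carrier K1 - carrier K \<times> {0}"
  obtain a s where [simp]: "X = (a, s)" by (cases X)
  have s: "s \<noteq> 0" and a: "compact_op E a"
    using X by (auto simp: mem_unitization_iff compact_op_algebra_simps)
  have "cmod s \<le> norm_dist K1 X (b, 0)" if b: "compact_op E b" for b
  proof -
    have mem: "X \<in> carrier K1" "(b, 0) \<in> carrier K1" using a b by (auto simp: mem_unitization_iff)
    then have "X \<ominus>\<^bsub>K1\<^esub> (b, 0) \<in> carrier K1" by simp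
    from cmod_snd_le[OF this] show ?thesis
      using mem by (simp add: K1.norm_dist_eq unitization_diff)
  qed
  then have "disjnt (carrier K \<times> {0}) (K1.metric.mball X (cmod s))"
    by (fastforce simp: disjnt_def compact_op_algebra_simps)
  then show "\<exists>r>0. disjnt (carrier K \<times> {0}) (K1.metric.mball X r)"
    using s by (intro exI[of _ "cmod s"]) auto
qed

lemma submodule_K: "submodule (carrier K \<times> {0}) complex_scalars K1"
proof (rule K1.submoduleI)
  fix X assume "X \<in> carrier K \<times> {0 :: complex}"
  then show "\<ominus>\<^bsub>K1\<^esub> X \<in> carrier K \<times> {0}"
    using Id_noncompact by (auto simp: K1.minus_smult unitization_simps)
qed (use Id_noncompact in \<open>auto simp: unitization_simps\<close>)

end

section \<open>Orthogonal decompositions of \<open>\<ell>\<^sup>p\<close> type\<close>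

text \<open>The intended \<open>e i\<close> is restriction to an atom. \<open>e_split\<close> says
  that each \<open>e i\<close> splits the norm in the \<ell>^p manner, and \<open>e_dense\<close>
  that the finite partial sums approximate every vector; there is no bound on the cardinality of
  \<open>I\<close>.\<close>

locale lp_decomposition = norming_space +
  fixes p :: real and I :: "'i set" and e :: "'i \<Rightarrow> 'a \<Rightarrow> 'a"
  assumes p_gt_1: "1 < p"
    and e_compact: "i \<in> I \<Longrightarrow> compact_op E (e i)"
    and e_idem: "\<lbrakk>i \<in> I; x \<in> carrier E\<rbrakk> \<Longrightarrow> e i (e i x) = e i x"
    and e_orth: "\<lbrakk>i \<in> I; j \<in> I; i \<noteq> j; x \<in> carrier E\<rbrakk> \<Longrightarrow> e i (e j x) = \<zero>"
    and e_split: "\<lbrakk>i \<in> I; x \<in> carrier E\<rbrakk>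
      \<Longrightarrow> nrm E x powr p = nrm E (e i x) powr p + nrm E (x \<ominus> e i x) powr p"
    and e_dense: "\<lbrakk>x \<in> carrier E; \<epsilon> > 0\<rbrakk>
      \<Longrightarrow> \<exists>F. finite F \<and> F \<subseteq> I \<and> nrm E (x \<ominus> (\<Oplus>i\<in>F. e i x)) < \<epsilon>"
begin

lemma e_bounded: "i \<in> I \<Longrightarrow> e i \<in> bounded_ops E E"
  by (rule compact_op_bounded[OF e_compact])

lemmas e_closed = bounded_opsD(1)[OF e_bounded]

text \<open>Diagonal operators on the blocks in \<open>F\<close>. General coefficients are allowed
  so that the blocks can be rotated by unimodular scalars in
  \<open>functional_abs_sum_le\<close>.\<close>

definition D :: "('i \<Rightarrow> complex) \<Rightarrow> 'i set \<Rightarrow> 'a \<Rightarrow> 'a" where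
  "D \<theta> F = (\<Oplus>\<^bsub>K\<^esub>i\<in>F. \<theta> i \<odot>\<^bsub>K\<^esub> e i)"

abbreviation "P \<equiv> D (\<lambda>_. 1)"

lemma e_in_K: "F \<subseteq> I \<Longrightarrow> (\<lambda>i. \<theta> i \<odot>\<^bsub>K\<^esub> e i) \<in> F \<rightarrow> carrier K"
proof
  fix i assume "i \<in> F" "F \<subseteq> I"
  then have "e i \<in> carrier K" using e_compact by (auto simp: compact_op_algebra_simps)
  then show "\<theta> i \<odot>\<^bsub>K\<^esub> e i \<in> carrier K" by simp
qed

lemma D_in_K: "F \<subseteq> I \<Longrightarrow> D \<theta> F \<in> carrier K"
  unfolding D_def by (rule K.M.finsum_closed[OF e_in_K])

lemma D_compact: "F \<subseteq> I \<Longrightarrow> compact_op E (D \<theta> F)"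
  using D_in_K by (simp add: compact_op_algebra_simps)

lemma D_bounded: "F \<subseteq> I \<Longrightarrow> D \<theta> F \<in> bounded_ops E E"
  by (rule compact_op_bounded[OF D_compact])

lemmas D_closed = bounded_opsD(1)[OF D_bounded]

lemma D_empty: "x \<in> carrier E \<Longrightarrow> D \<theta> {} x = \<zero>"
  by (simp add: D_def compact_op_algebra_simps)

lemma D_insert:
  assumes "finite F" "insert j F \<subseteq> I" "j \<notin> F" "x \<in> carrier E"
  shows "D \<theta> (insert j F) x = \<theta> j \<odot> e j x \<oplus> D \<theta> F x"
proof -
  have "D \<theta> (insert j F) = (\<theta> j \<odot>\<^bsub>K\<^esub> e j) \<oplus>\<^bsub>K\<^esub> D \<theta> F"
    unfolding D_def using assms e_in_K[of "insert j F" \<theta>]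
    by (intro K.M.finsum_insert) (auto simp: Pi_iff)
  with assms show ?thesis by (simp add: compact_op_algebra_simps)
qed

lemma D_Un:
  assumes "finite F" "finite G" "F \<inter> G = {}" "F \<union> G \<subseteq> I" "x \<in> carrier E"
  shows "D \<theta> (F \<union> G) x = D \<theta> F x \<oplus> D \<theta> G x"
proof -
  have "D \<theta> (F \<union> G) = D \<theta> F \<oplus>\<^bsub>K\<^esub> D \<theta> G"
    unfolding D_def using assms e_in_K[of F \<theta>] e_in_K[of G \<theta>]
    by (intro K.M.finsum_Un_disjoint) auto
  with assms show ?thesis by (simp add: compact_op_algebra_simps)
qed

lemma P_eq_finsum:
  assumes "finite F" "F \<subseteq> I" "x \<in> carrier E"
  shows "P F x = (\<Oplus>i\<in>F. e i x)"
  using assms(1,2)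
proof (induction F rule: finite_induct)
  case empty
  then show ?case using assms(3) by (simp add: D_empty)
next
  case (insert j F)
  moreover have "(\<Oplus>i\<in>insert j F. e i x) = e j x \<oplus> (\<Oplus>i\<in>F. e i x)"
    using insert assms(3) e_closed by (intro M.finsum_insert) auto
  ultimately show ?case
    using assms(3) e_closed[of j x] by (simp add: D_insert)
qed

lemma e_D:
  assumes "finite F" "F \<subseteq> I" "i \<in> I" "x \<in> carrier E"
  shows "e i (D \<theta> F x) = (if i \<in> F then \<theta> i \<odot> e i x else \<zero>)"
  using assms(1,2)
proof (induction F rule: finite_induct)
  case empty
  then show ?case using assms by (simp add: D_empty ops.op_zero e_bounded)
next
  case (insert j F)
  have mem: "e j x \<in> carrier E" "D \<theta> F x \<in> carrier E" "e i x \<in> carrier E"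
    using insert assms e_closed D_closed by auto
  have "e i (D \<theta> (insert j F) x) = \<theta> j \<odot> e i (e j x) \<oplus> e i (D \<theta> F x)"
    using insert mem assms bounded_opsD(2,3)[OF e_bounded[OF assms(3)]] by (simp add: D_insert)
  then show ?case
    using insert mem assms e_idem[of i x] e_orth[of i j x] by (cases "i = j") auto
qed

lemma nrm_D:
  assumes "finite F" "F \<subseteq> I" "x \<in> carrier E"
  shows "nrm E (D \<theta> F x) powr p = (\<Sum>i\<in>F. (cmod (\<theta> i) * nrm E (e i x)) powr p)"
  using assms(1,2)
proof (induction F rule: finite_induct)
  case empty
  then show ?case using assms(3) by (simp add: D_empty)
next
  case (insert j F)
  have jI: "j \<in> I" and FI: "F \<subseteq> I" using insert by auto
  have mem: "D \<theta> (insert j F) x \<in> carrier E" "D \<theta> F x \<in> carrier E" "e j x \<in> carrier E"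
    using assms(3) D_closed[OF insert.prems] D_closed[OF FI] e_closed[OF jI] by auto
  have ej: "e j (D \<theta> (insert j F) x) = \<theta> j \<odot> e j x"
    using insert assms(3) by (simp add: e_D)
  have "D \<theta> (insert j F) x \<ominus> \<theta> j \<odot> e j x = D \<theta> F x"
    using insert assms(3) mem by (simp add: D_insert)
  then show ?case
    using e_split[OF jI mem(1)] insert mem by (simp add: ej nrm_smult)
qed

lemma D_eq_zero:
  assumes "finite F" "F \<subseteq> I" "x \<in> carrier E" "\<And>i. i \<in> F \<Longrightarrow> e i x = \<zero>"
  shows "D \<theta> F x = \<zero>"
proof -
  have "nrm E (D \<theta> F x) powr p = 0" using assms by (simp add: nrm_D)
  then show ?thesis using D_closed[of F x \<theta>] assms nrm_eq_0_iff by simp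
qed

lemma P_split:
  assumes "finite F" "F \<subseteq> I" "x \<in> carrier E"
  shows "nrm E x powr p = nrm E (P F x) powr p + nrm E (x \<ominus> P F x) powr p"
  using assms
proof (induction F arbitrary: x rule: finite_induct)
  case empty
  then show ?case by (simp add: D_empty)
next
  case (insert j F)
  have jI: "j \<in> I" and FI: "F \<subseteq> I" using insert by auto
  \<comment> \<open>By orthogonality the removal of block \<open>j\<close> does not change
    \<open>P F x\<close>, so the induction hypothesis for \<open>y\<close> gives the remaining part
    of the splitting.\<close>
  define y where "y = x \<ominus> e j x"
  have mem: "P F x \<in> carrier E" "e j x \<in> carrier E" "y \<in> carrier E" "P F (e j x) \<in> carrier E"
    using insert.prems D_closed[OF FI] e_closed[OF jI] by (auto simp: y_def)
  have "P F (e j x) = \<zero>"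
  proof (rule D_eq_zero)
    fix i assume "i \<in> F"
    then have "i \<in> I" "i \<noteq> j" using insert FI by auto
    then show "e i (e j x) = \<zero>" using e_orth jI insert.prems by simp
  qed (use insert FI mem in auto)
  then have PFy: "P F y = P F x"
    using mem insert.prems by (simp add: y_def ops.op_diff[OF D_bounded[OF FI]])
  have "x \<ominus> P (insert j F) x = y \<ominus> P F x"
    using insert mem by (simp add: D_insert y_def diff_smult smult_add_right M.a_assoc)
  moreover have "nrm E (P (insert j F) x) powr p = nrm E (e j x) powr p + nrm E (P F x) powr p"
    using insert FI by (simp add: nrm_D)
  ultimately show ?case
    using e_split[OF jI insert.prems(2)] insert.IH[OF FI mem(3)] by (simp add: PFy flip: y_def)
qed

lemma powr_le_imp_le: "\<lbrakk>a powr p \<le> b powr p; 0 \<le> a; 0 \<le> b\<rbrakk> \<Longrightarrow> a \<le> b"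
  using powr_less_mono2[of p b a] p_gt_1 by linarith

lemma P_contraction:
  assumes "finite F" "F \<subseteq> I" "x \<in> carrier E"
  shows "nrm E (P F x) \<le> nrm E x" "nrm E (x \<ominus> P F x) \<le> nrm E x"
proof -
  have "0 \<le> nrm E (P F x)" "0 \<le> nrm E (x \<ominus> P F x)" "0 \<le> nrm E x"
    using D_closed[OF assms(2,3)] assms(3) by (simp_all add: nrm_nonneg)
  then show "nrm E (P F x) \<le> nrm E x" "nrm E (x \<ominus> P F x) \<le> nrm E x"
    using P_split[OF assms] by (auto intro: powr_le_imp_le)
qed

lemma D_contraction:
  assumes F: "finite F" "F \<subseteq> I" and x: "x \<in> carrier E" and \<theta>: "\<And>i. i \<in> F \<Longrightarrow> cmod (\<theta> i) \<le> 1"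
  shows "nrm E (D \<theta> F x) \<le> nrm E x"
proof -
  have "nrm E (D \<theta> F x) powr p \<le> nrm E (P F x) powr p"
    unfolding nrm_D[OF F x]
  proof (rule sum_mono)
    fix i assume i: "i \<in> F"
    then have "0 \<le> nrm E (e i x)" using F x e_closed[of i x] nrm_nonneg by auto
    with \<theta>[OF i] p_gt_1 show "(cmod (\<theta> i) * nrm E (e i x)) powr p \<le> (cmod 1 * nrm E (e i x)) powr p"
      by (intro powr_mono2 mult_right_mono mult_nonneg_nonneg) auto
  qed
  then have "nrm E (D \<theta> F x) \<le> nrm E (P F x)"
    using D_closed[OF F(2) x] by (rule_tac powr_le_imp_le) (simp_all add: nrm_nonneg)
  with P_contraction(1)[OF F x] show ?thesis by simp
qed

lemma op_nrm_D:
  assumes "finite F" "F \<subseteq> I" "\<And>i. i \<in> F \<Longrightarrow> cmod (\<theta> i) \<le> 1" shows "op_nrm E E (D \<theta> F) \<le> 1"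
  by (rule ops.op_nrm_le) (use D_contraction[OF assms(1,2) _ assms(3)] in auto)

lemma P_idem:
  assumes F: "finite F" "F \<subseteq> I" and x: "x \<in> carrier E" shows "P F (P F x) = P F x"
proof -
  note mem = D_closed[OF F(2) x, of "\<lambda>_. 1"] D_closed[OF F(2) D_closed[OF F(2) x, of "\<lambda>_. 1"], of "\<lambda>_. 1"]
  have "P F (P F x \<ominus> x) = \<zero>"
    by (rule D_eq_zero)
      (use F x mem e_closed in \<open>auto simp: ops.op_diff[OF e_bounded] e_D subset_iff\<close>)
  then show ?thesis
    using mem x by (simp add: ops.op_diff[OF D_bounded[OF F(2)]] diff_eq_0_iff)
qed

text \<open>The remainder for \<open>G\<close> is the contraction \<open>1 - P G\<close> applied to
  the remainder for \<open>F\<close>. An approximation achieved by \<open>F\<close> therefore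
  persists for all larger sets, as convergence along finite subsets demands.\<close>

lemma P_mono:
  assumes "F \<subseteq> G" and G: "finite G" "G \<subseteq> I" and x: "x \<in> carrier E"
  shows "P G (P F x) = P F x"
    and "nrm E (x \<ominus> P G x) \<le> nrm E (x \<ominus> P F x)"
proof -
  have F: "finite F" "F \<subseteq> I" using assms finite_subset by auto
  note mem = D_closed[OF F(2) x, of "\<lambda>_. 1"] D_closed[OF G(2) x, of "\<lambda>_. 1"]
  have "P G (P F x) = P F (P F x) \<oplus> P (G - F) (P F x)"
    using D_Un[of F "G - F" "P F x" "\<lambda>_. 1"] assms F mem by (simp add: Un_absorb1)
  moreover have "P (G - F) (P F x) = \<zero>"
    by (rule D_eq_zero) (use F G x mem in \<open>auto simp: e_D subset_iff\<close>)
  ultimately show eq: "P G (P F x) = P F x"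
    using mem by (simp add: P_idem F x)
  have "x \<ominus> P G x = (x \<ominus> P F x) \<ominus> P G (x \<ominus> P F x)"
    using mem x by (simp add: ops.op_diff[OF D_bounded[OF G(2)]] eq diff_diff_cancel)
  then show "nrm E (x \<ominus> P G x) \<le> nrm E (x \<ominus> P F x)"
    using P_contraction(2)[OF G, of "x \<ominus> P F x"] mem x by simp
qed

text \<open>Contractions that converge strongly converge uniformly on the totally bounded image of
  the unit ball. The finitely many net points are handled by the union of their index sets.\<close>

lemma P_compose_tendsto:
  assumes a: "compact_op E a" and \<epsilon>: "\<epsilon> > 0"
  obtains F where "finite F" "F \<subseteq> I"
    "\<And>G x. \<lbrakk>finite G; F \<subseteq> G; G \<subseteq> I; x \<in> unit_ball E\<rbrakk> \<Longrightarrow> nrm E (a x \<ominus> P G (a x)) \<le> \<epsilon>"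
proof -
  have \<epsilon>3: "\<epsilon> / 3 > 0" using \<epsilon> by simp
  obtain Z where Z: "finite Z" "Z \<subseteq> carrier E" "\<And>x. x \<in> unit_ball E \<Longrightarrow> \<exists>z\<in>Z. nrm E (a x \<ominus> z) < \<epsilon> / 3"
    using compact_op_net[OF a \<epsilon>3] by blast
  have "\<exists>F. finite F \<and> F \<subseteq> I \<and> nrm E (z \<ominus> P F z) < \<epsilon> / 3" if "z \<in> Z" for z
  proof -
    have z: "z \<in> carrier E" using that Z by blast
    from e_dense[OF z \<epsilon>3] show ?thesis using P_eq_finsum[OF _ _ z] by metis
  qed
  then obtain H where H: "\<And>z. z \<in> Z \<Longrightarrow> finite (H z) \<and> H z \<subseteq> I \<and> nrm E (z \<ominus> P (H z) z) < \<epsilon> / 3"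
    by metis
  show thesis
  proof (rule that[of "\<Union>z\<in>Z. H z"])
    show "finite (\<Union>z\<in>Z. H z)" "(\<Union>z\<in>Z. H z) \<subseteq> I" using Z H by auto
    fix G x assume G: "finite G" "(\<Union>z\<in>Z. H z) \<subseteq> G" "G \<subseteq> I" and x: "x \<in> unit_ball E"
    then have ax: "a x \<in> carrier E"
      using bounded_opsD(1)[OF compact_op_bounded[OF a]] by (simp add: unit_ball_def)
    obtain z where z: "z \<in> Z" "nrm E (a x \<ominus> z) < \<epsilon> / 3" using Z(3)[OF x] by blast
    have zE: "z \<in> carrier E" using z Z by blast
    have HG: "H z \<subseteq> G" using G z by blast
    note mem = ax zE D_closed[OF G(3) ax, of "\<lambda>_. 1"] D_closed[OF G(3) zE, of "\<lambda>_. 1"]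
    have 1: "nrm E (z \<ominus> P G z) < \<epsilon> / 3"
      using P_mono(2)[OF HG G(1,3) zE] H[OF z(1)] by simp
    have "P G z \<ominus> P G (a x) = P G (z \<ominus> a x)"
      using mem by (simp add: ops.op_diff[OF D_bounded[OF G(3)]])
    then have 2: "nrm E (P G z \<ominus> P G (a x)) \<le> nrm E (a x \<ominus> z)"
      using P_contraction(1)[OF G(1,3), of "z \<ominus> a x"] mem nrm_diff_commute[of z "a x"] by simp
    have "nrm E (a x \<ominus> P G (a x)) \<le> nrm E (a x \<ominus> z) + (nrm E (z \<ominus> P G z) + nrm E (P G z \<ominus> P G (a x)))"
      using nrm_diff_trans[of "a x" z "P G (a x)"] nrm_diff_trans[of z "P G z" "P G (a x)"] mem by simp
    then show "nrm E (a x \<ominus> P G (a x)) \<le> \<epsilon>" using 1 2 z by simp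
  qed
qed

text \<open>If the tails \<open>a (1 - P F)\<close> stayed away from \<open>0\<close>, one could find blocks of norm at most 1 with
  disjoint supports whose images under \<open>a\<close> cluster at a nonzero vector.  A sum of \<open>N\<close> of these has norm at
  most \<open>N powr (1 / p)\<close>, but its image has norm of order \<open>N\<close>.\<close>

lemma compose_P_tendsto:
  assumes a: "compact_op E a" and \<epsilon>: "\<epsilon> > 0"
  obtains F where "finite F" "F \<subseteq> I"
    "\<And>G x. \<lbrakk>finite G; F \<subseteq> G; G \<subseteq> I; x \<in> unit_ball E\<rbrakk> \<Longrightarrow> nrm E (a (x \<ominus> P G x)) \<le> \<epsilon>"
proof -
  have "\<exists>F. finite F \<and> F \<subseteq> I \<and>
    (\<forall>G x. finite G \<longrightarrow> F \<subseteq> G \<longrightarrow> G \<subseteq> I \<longrightarrow> x \<in> unit_ball E \<longrightarrow> nrm E (a (x \<ominus> P G x)) \<le> \<epsilon>)"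
  proof (rule ccontr)
    assume neg: "\<not> ?thesis"
    note a' = compact_op_bounded[OF a]
    have block: "\<exists>B x. finite B \<and> B \<subseteq> I \<and> B \<inter> F = {} \<and> x \<in> unit_ball E \<and> nrm E (a (P B x)) > \<epsilon> / 2"
      if F: "finite F" "F \<subseteq> I" for F
    proof -
      obtain G x where G: "finite G" "F \<subseteq> G" "G \<subseteq> I" and x: "x \<in> unit_ball E" "nrm E (a (x \<ominus> P G x)) > \<epsilon>"
        using neg F by (meson not_le)
      have xE: "x \<in> carrier E" using x by (simp add: unit_ball_def)
      \<comment> \<open>\<open>y\<close> has no component in \<open>G\<close>, so a finite
        \<open>H\<close> that approximates it may be replaced by \<open>H - G\<close>. This keeps
        the new block disjoint from \<open>F\<close>.\<close>
      define y where "y = x \<ominus> P G x"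
      have PGx: "P G x \<in> carrier E" by (rule D_closed[OF G(3) xE])
      have y: "y \<in> unit_ball E" "nrm E (a y) > \<epsilon>"
        using x P_contraction(2)[OF G(1,3) xE] xE PGx by (auto simp: y_def unit_ball_def)
      have yE: "y \<in> carrier E" using y by (simp add: unit_ball_def)
      have ey: "e i y = \<zero>" if "i \<in> G" for i
      proof -
        have iI: "i \<in> I" using that G by blast
        show ?thesis
          using that G xE PGx e_closed[OF iI xE]
          by (simp add: y_def ops.op_diff[OF e_bounded[OF iI]] e_D iI)
      qed
      define \<delta> where "\<delta> = \<epsilon> / (2 * (op_nrm E E a + 1))"
      have pos: "op_nrm E E a + 1 > 0" using ops.op_nrm_nonneg[OF a'] by simp
      then have \<delta>: "\<delta> > 0" using \<epsilon> by (simp add: \<delta>_def)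
      obtain H where H: "finite H" "H \<subseteq> I" "nrm E (y \<ominus> P H y) < \<delta>"
        using e_dense[OF yE \<delta>] P_eq_finsum[OF _ _ yE] by metis
      have HG: "H - G \<subseteq> I" "H \<inter> G \<subseteq> I" using H by auto
      have "P H y = P (H - G) y \<oplus> P (H \<inter> G) y"
      proof -
        have "(H - G) \<union> (H \<inter> G) = H" by blast
        moreover have "P ((H - G) \<union> (H \<inter> G)) y = P (H - G) y \<oplus> P (H \<inter> G) y"
          by (rule D_Un) (use H yE in auto)
        ultimately show ?thesis by simp
      qed
      moreover have "P (H \<inter> G) y = \<zero>"
        by (rule D_eq_zero) (use H yE ey in auto)
      ultimately have PH: "P H y = P (H - G) y"
        using D_closed[OF HG(1) yE] by simp
      have mem: "P H y \<in> carrier E" by (rule D_closed[OF H(2) yE])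
      have "nrm E (a y) \<le> nrm E (a (y \<ominus> P H y)) + nrm E (a (P H y))"
        using nrm_le_diff[of "a y" "a (P H y)"] yE mem bounded_opsD(1)[OF a'] by (simp add: ops.op_diff[OF a'])
      moreover have "nrm E (a (y \<ominus> P H y)) \<le> \<epsilon> / 2"
      proof -
        have "nrm E (a (y \<ominus> P H y)) \<le> op_nrm E E a * nrm E (y \<ominus> P H y)"
          using ops.op_nrm_bound[OF a'] yE mem by simp
        also have "\<dots> \<le> (op_nrm E E a + 1) * \<delta>"
          using H pos ops.op_nrm_nonneg[OF a'] nrm_nonneg[of "y \<ominus> P H y"] yE mem by (intro mult_mono) auto
        also have "\<dots> = \<epsilon> / 2" using pos by (simp add: \<delta>_def field_simps)
        finally show ?thesis .
      qed
      ultimately have "nrm E (a (P (H - G) y)) > \<epsilon> / 2" using y PH by simp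
      with H G y HG show ?thesis by (intro exI[of _ "H - G"] exI[of _ y]) auto
    qed
    then obtain B X where BX: "\<And>F. finite F \<Longrightarrow> F \<subseteq> I \<Longrightarrow> finite (B F) \<and> B F \<subseteq> I \<and> B F \<inter> F = {} \<and>
        X F \<in> unit_ball E \<and> nrm E (a (P (B F) (X F))) > \<epsilon> / 2"
      by metis
    \<comment> \<open>\<open>S n\<close> collects all indices used before stage \<open>n\<close>;
      the next block is chosen to avoid them.\<close>
    define S where "S = rec_nat {} (\<lambda>_ F. F \<union> B F)"
    have S_simps: "S 0 = {}" "S (Suc n) = S n \<union> B (S n)" for n by (simp_all add: S_def)
    have S: "finite (S n) \<and> S n \<subseteq> I" for n
      by (induction n) (use BX in \<open>auto simp: S_simps\<close>)
    have S_mono: "S m \<subseteq> S n" if "m \<le> n" for m n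
      using lift_Suc_mono_le[of S, OF _ that] by (simp add: S_simps)
    define b where "b n = B (S n)" for n
    define x where "x n = P (b n) (X (S n))" for n
    have b: "finite (b n)" "b n \<subseteq> I" for n using BX S by (auto simp: b_def)
    have X: "X (S n) \<in> unit_ball E" "X (S n) \<in> carrier E" for n using BX S by (auto simp: unit_ball_def)
    have xE: "x n \<in> carrier E" for n unfolding x_def by (rule D_closed[OF b(2) X(2)])
    have x1: "nrm E (x n) \<le> 1" for n
      using P_contraction(1)[OF b(1)[of n] b(2)[of n] X(2)[of n]] X(1)[of n]
      by (simp add: x_def unit_ball_def)
    have ax: "nrm E (a (x n)) > \<epsilon> / 2" for n using BX S by (auto simp: x_def b_def)
    have b_disj: "b m \<inter> b n = {}" if "m \<noteq> n" for m n
    proof -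
      have "b m \<inter> b n = {}" if "m < n" for m n
      proof -
        have "b m \<subseteq> S n" using S_mono[of "Suc m" n] that by (auto simp: S_simps b_def)
        moreover have "b n \<inter> S n = {}" using BX S by (auto simp: b_def)
        ultimately show ?thesis by blast
      qed
      then show ?thesis using that by (metis Int_commute linorder_neqE_nat)
    qed
    have ex: "e i (x n) = \<zero>" if "i \<in> I" "i \<notin> b n" for i n
      using that X b by (simp add: x_def e_D)
    obtain Z where Z: "finite Z" "Z \<subseteq> carrier E" "\<And>x. x \<in> unit_ball E \<Longrightarrow> \<exists>z\<in>Z. nrm E (a x \<ominus> z) < \<epsilon> / 8"
      using compact_op_net[OF a, of "\<epsilon> / 8"] \<epsilon> by auto
    have "\<exists>z\<in>Z. nrm E (a (x n) \<ominus> z) < \<epsilon> / 8" for n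
      by (rule Z(3)) (use xE x1 in \<open>auto simp: unit_ball_def\<close>)
    then obtain \<zeta> where \<zeta>: "\<And>n. \<zeta> n \<in> Z" "\<And>n. nrm E (a (x n) \<ominus> \<zeta> n) < \<epsilon> / 8" by metis
    \<comment> \<open>Pigeonhole on the net: infinitely many of the images \<open>a (x n)\<close>
      lie within \<epsilon> / 8 of one net point.\<close>
    have "\<exists>n0. \<not> finite {n\<in>UNIV. \<zeta> n = \<zeta> n0}"
      using pigeonhole_infinite[of "UNIV :: nat set" \<zeta>] Z \<zeta> by (metis finite_subset image_subsetI infinite_UNIV_nat)
    then obtain n0 where inf: "infinite {n. \<zeta> n = \<zeta> n0}" by auto
    define z where "z = \<zeta> n0"
    have zE: "z \<in> carrier E" using \<zeta> Z by (auto simp: z_def)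
    \<comment> \<open>The images have norm above \<epsilon> / 2, and \<epsilon> / 8 is lost in
      passing to the net point.\<close>
    have z_lower: "nrm E z \<ge> 3 * \<epsilon> / 8"
    proof -
      have aE: "a (x n0) \<in> carrier E" using bounded_opsD(1)[OF a' xE] .
      show ?thesis
        using nrm_le_diff[OF aE zE] ax[of n0] \<zeta>(2)[of n0] by (simp add: z_def)
    qed
    \<comment> \<open>\<open>w\<close> is the sum of the \<open>x n\<close> for \<open>n\<close> in
      \<open>T\<close>. The clause on \<open>e i w\<close> records its support, which makes
      \<open>P_split\<close> at the next block separate \<open>x m\<close> from
      \<open>w\<close>.\<close>
    have sums: "finite T \<Longrightarrow> T \<subseteq> {n. \<zeta> n = \<zeta> n0} \<Longrightarrow>
       \<exists>w\<in>carrier E. (\<forall>i\<in>I. (\<forall>n\<in>T. i \<notin> b n) \<longrightarrow> e i w = \<zero>) \<and> nrm E w powr p \<le> card T \<and>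
         nrm E (a w \<ominus> complex_of_real (card T) \<odot> z) \<le> card T * (\<epsilon> / 8)" for T
    proof (induction T rule: finite_induct)
      case empty
      then show ?case
        using zE by (intro bexI[of _ \<zero>]) (auto simp: ops.op_zero e_bounded a')
    next
      case (insert m T)
      then obtain w where w: "w \<in> carrier E" "\<And>i. i \<in> I \<Longrightarrow> (\<forall>n\<in>T. i \<notin> b n) \<Longrightarrow> e i w = \<zero>"
        "nrm E w powr p \<le> card T" "nrm E (a w \<ominus> complex_of_real (card T) \<odot> z) \<le> card T * (\<epsilon> / 8)"
        by auto
      have awE: "a w \<in> carrier E" "a (x m) \<in> carrier E"
        using bounded_opsD(1)[OF a'] xE w by auto
      have "P (b m) w = \<zero>"
      proof (rule D_eq_zero)
        fix i assume i: "i \<in> b m"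
        have "i \<notin> b n" if "n \<in> T" for n
          using b_disj[of m n] that i insert.hyps by auto
        then show "e i w = \<zero>" using w(2)[of i] i b by blast
      qed (use b w in auto)
      moreover have "P (b m) (x m) = x m" unfolding x_def by (rule P_idem[OF b X(2)])
      ultimately have Pm: "P (b m) (x m \<oplus> w) = x m"
        using bounded_opsD(2)[OF D_bounded[OF b(2)[of m], of "\<lambda>_. 1"] xE[of m] w(1)] xE by simp
      have "nrm E (x m) powr p \<le> 1"
        using x1[of m] nrm_nonneg[OF xE[of m]] p_gt_1 powr_mono2[of p "nrm E (x m)" 1] by simp
      then have 1: "nrm E (x m \<oplus> w) powr p \<le> card (insert m T)"
        using P_split[OF b(1)[of m] b(2)[of m], of "x m \<oplus> w"] xE[of m] w insert.hyps by (simp add: Pm)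
      have "a (x m \<oplus> w) \<ominus> complex_of_real (card (insert m T)) \<odot> z
          = (a (x m) \<ominus> z) \<oplus> (a w \<ominus> complex_of_real (card T) \<odot> z)"
        using xE w zE awE insert.hyps bounded_opsD(2)[OF a'] smult_add_left[OF zE, of 1 "complex_of_real (card T)"]
        by (simp add: add_diff_add)
      then have 2: "nrm E (a (x m \<oplus> w) \<ominus> complex_of_real (card (insert m T)) \<odot> z) \<le> card (insert m T) * (\<epsilon> / 8)"
        using nrm_triangle[of "a (x m) \<ominus> z" "a w \<ominus> complex_of_real (card T) \<odot> z"] awE zE w(4) \<zeta>(2)[of m]
          insert.hyps insert.prems by (simp add: z_def algebra_simps)
      have 3: "e i (x m \<oplus> w) = \<zero>" if "i \<in> I" "\<forall>n\<in>insert m T. i \<notin> b n" for i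
        using that ex[of i m] w bounded_opsD(2)[OF e_bounded[OF that(1)] xE[of m] w(1)] by simp
      show ?case
        by (rule bexI[of _ "x m \<oplus> w"]) (use 1 2 3 xE w in auto)
    qed
    have bound: "real N powr (1 - 1 / p) \<le> 4 * op_nrm E E a / \<epsilon>" if "N > 0" for N
    proof -
      obtain T where T: "T \<subseteq> {n. \<zeta> n = \<zeta> n0}" "finite T" "card T = N"
        using infinite_arbitrarily_large[OF inf] by blast
      from sums[OF T(2,1)] obtain w where w: "w \<in> carrier E" "nrm E w powr p \<le> N"
        "nrm E (a w \<ominus> complex_of_real N \<odot> z) \<le> N * (\<epsilon> / 8)" using T(3) by auto
      have aw: "a w \<in> carrier E" using bounded_opsD(1)[OF a' w(1)] .
      have "nrm E w = (nrm E w powr p) powr (1 / p)"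
        using nrm_nonneg[OF w(1)] p_gt_1 by (simp add: powr_powr)
      also have "\<dots> \<le> real N powr (1 / p)" using w p_gt_1 by (intro powr_mono2) auto
      finally have wn: "nrm E w \<le> real N powr (1 / p)" .
      \<comment> \<open>The lower bound 3\<epsilon>/8 per block less the accumulated error
        \<epsilon>/8 leaves \<epsilon>/4 per block.\<close>
      have "N * (3 * \<epsilon> / 8) \<le> nrm E (complex_of_real N \<odot> z)"
        using mult_left_mono[OF z_lower, of "real N"] zE by (simp add: nrm_smult)
      also have "\<dots> \<le> nrm E (complex_of_real N \<odot> z \<ominus> a w) + nrm E (a w)"
        by (rule nrm_le_diff) (use zE aw in auto)
      also have "\<dots> \<le> N * (\<epsilon> / 8) + op_nrm E E a * (real N powr (1 / p))"
        using w(3) nrm_diff_commute[of "a w" "complex_of_real N \<odot> z"] aw zE ops.op_nrm_bound[OF a' w(1)]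
          mult_left_mono[OF wn ops.op_nrm_nonneg[OF a']] by simp
      finally have "N * (\<epsilon> / 4) \<le> op_nrm E E a * (real N powr (1 / p))" by (simp add: mult_ac)
      moreover have "real N = real N powr (1 - 1 / p) * real N powr (1 / p)"
        using that by (simp flip: powr_add)
      ultimately have "real N powr (1 - 1 / p) * (\<epsilon> / 4) * real N powr (1 / p) \<le> op_nrm E E a * real N powr (1 / p)"
        by (metis mult.assoc mult.commute)
      then have "real N powr (1 - 1 / p) * (\<epsilon> / 4) \<le> op_nrm E E a"
        using that by (simp add: mult_le_cancel_right)
      then show ?thesis using \<epsilon> by (simp add: field_simps)
    qed
    \<comment> \<open>Since p > 1, the exponent \<open>q\<close> is positive, and
      \<open>N powr q\<close> exceeds the fixed bound for large \<open>N\<close>.\<close>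
    define q where "q = 1 - 1 / p"
    define c where "c = 4 * op_nrm E E a / \<epsilon> + 1"
    have q: "q > 0" using p_gt_1 by (simp add: q_def)
    have c: "c > 0" using ops.op_nrm_nonneg[OF a'] \<epsilon> by (simp add: c_def add_nonneg_pos)
    obtain N :: nat where N: "c powr (1 / q) < real N" using reals_Archimedean2 by blast
    have "c powr (1 / q) > 0" using c by simp
    then have "N > 0" using N by linarith
    have "c = (c powr (1 / q)) powr q" using q c by (simp add: powr_powr)
    also have "\<dots> \<le> real N powr q" using q N by (intro powr_mono2) auto
    finally have "c \<le> real N powr (1 - 1 / p)" by (simp add: q_def)
    then show False using bound[OF \<open>N > 0\<close>] by (simp add: c_def)
  qed
  with that show thesis by blast
qed

lemma K_tendsto_zeroI:
  assumes "\<And>\<epsilon>. \<epsilon> > 0 \<Longrightarrow> \<exists>F. finite F \<and> F \<subseteq> I \<and>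
      (\<forall>G x. finite G \<longrightarrow> F \<subseteq> G \<longrightarrow> G \<subseteq> I \<longrightarrow> x \<in> unit_ball E \<longrightarrow> nrm E (T G x \<ominus> a x) \<le> \<epsilon>)"
    and T: "\<And>G. G \<subseteq> I \<Longrightarrow> compact_op E (T G)" and a: "compact_op E a"
  shows "((\<lambda>F. nrm K (T F \<ominus>\<^bsub>K\<^esub> a)) \<longlongrightarrow> 0) (finite_subsets_at_top I)"
proof (rule tendstoI)
  fix \<epsilon> :: real assume "\<epsilon> > 0"
  then obtain F where F: "finite F" "F \<subseteq> I"
    "\<And>G x. \<lbrakk>finite G; F \<subseteq> G; G \<subseteq> I; x \<in> unit_ball E\<rbrakk> \<Longrightarrow> nrm E (T G x \<ominus> a x) \<le> \<epsilon> / 2"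
    using assms(1)[of "\<epsilon> / 2"] by (meson half_gt_zero)
  have "dist (nrm K (T G \<ominus>\<^bsub>K\<^esub> a)) 0 < \<epsilon>" if G: "finite G" "F \<subseteq> G" "G \<subseteq> I" for G
  proof -
    have mem: "T G \<in> carrier K" "a \<in> carrier K" using T[OF G(3)] a by (auto simp: compact_op_algebra_simps)
    have "nrm K (T G \<ominus>\<^bsub>K\<^esub> a) \<le> \<epsilon> / 2"
      unfolding compact_op_algebra_simps
      by (rule ops.op_nrm_leI) (use F(3)[OF G] T[OF G(3)] a in \<open>simp add: K_diff_apply unit_ball_closed\<close>)
    then show ?thesis using \<open>\<epsilon> > 0\<close> K.nrm_nonneg[of "T G \<ominus>\<^bsub>K\<^esub> a"] mem by simp
  qed
  then show "\<forall>\<^sub>F G in finite_subsets_at_top I. dist (nrm K (T G \<ominus>\<^bsub>K\<^esub> a)) 0 < \<epsilon>"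
    unfolding eventually_finite_subsets_at_top using F by blast
qed

lemma compact_op_compose: "\<lbrakk>compact_op E a; compact_op E b\<rbrakk> \<Longrightarrow> compact_op E (compose (carrier E) a b)"
  by (rule compact_op_compose_left[OF compact_op_bounded])

lemma P_a_tendsto:
  assumes a: "compact_op E a"
  shows "((\<lambda>F. nrm K (P F \<otimes>\<^bsub>K\<^esub> a \<ominus>\<^bsub>K\<^esub> a)) \<longlongrightarrow> 0) (finite_subsets_at_top I)"
proof (rule K_tendsto_zeroI[OF _ _ a])
  note a' = compact_op_bounded[OF a]
  show "compact_op E (P G \<otimes>\<^bsub>K\<^esub> a)" if "G \<subseteq> I" for G
    unfolding compact_op_algebra_simps by (intro compact_op_compose D_compact that a)
  fix \<epsilon> :: real assume \<epsilon>: "\<epsilon> > 0"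
  obtain F where F: "finite F" "F \<subseteq> I"
    "\<And>G x. \<lbrakk>finite G; F \<subseteq> G; G \<subseteq> I; x \<in> unit_ball E\<rbrakk> \<Longrightarrow> nrm E (a x \<ominus> P G (a x)) \<le> \<epsilon>"
    using P_compose_tendsto[OF a \<epsilon>] by metis
  have "nrm E ((P G \<otimes>\<^bsub>K\<^esub> a) x \<ominus> a x) \<le> \<epsilon>" if G: "finite G" "F \<subseteq> G" "G \<subseteq> I" "x \<in> unit_ball E" for G x
  proof -
    have x: "x \<in> carrier E" using G by (simp add: unit_ball_def)
    then have "nrm E (P G (a x) \<ominus> a x) \<le> \<epsilon>"
      using F(3)[OF G] nrm_diff_commute[of "P G (a x)" "a x"] D_closed[OF G(3)] bounded_opsD(1)[OF a'] by simp
    then show ?thesis using x by (simp add: compact_op_algebra_simps compose_eq)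
  qed
  with F show "\<exists>F. finite F \<and> F \<subseteq> I \<and>
      (\<forall>G x. finite G \<longrightarrow> F \<subseteq> G \<longrightarrow> G \<subseteq> I \<longrightarrow> x \<in> unit_ball E \<longrightarrow> nrm E ((P G \<otimes>\<^bsub>K\<^esub> a) x \<ominus> a x) \<le> \<epsilon>)"
    by blast
qed

lemma a_P_tendsto:
  assumes a: "compact_op E a"
  shows "((\<lambda>F. nrm K (a \<otimes>\<^bsub>K\<^esub> P F \<ominus>\<^bsub>K\<^esub> a)) \<longlongrightarrow> 0) (finite_subsets_at_top I)"
proof (rule K_tendsto_zeroI[OF _ _ a])
  note a' = compact_op_bounded[OF a]
  show "compact_op E (a \<otimes>\<^bsub>K\<^esub> P G)" if "G \<subseteq> I" for G
    unfolding compact_op_algebra_simps by (intro compact_op_compose D_compact that a)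
  fix \<epsilon> :: real assume \<epsilon>: "\<epsilon> > 0"
  obtain F where F: "finite F" "F \<subseteq> I"
    "\<And>G x. \<lbrakk>finite G; F \<subseteq> G; G \<subseteq> I; x \<in> unit_ball E\<rbrakk> \<Longrightarrow> nrm E (a (x \<ominus> P G x)) \<le> \<epsilon>"
    using compose_P_tendsto[OF a \<epsilon>] by metis
  have "nrm E ((a \<otimes>\<^bsub>K\<^esub> P G) x \<ominus> a x) \<le> \<epsilon>" if G: "finite G" "F \<subseteq> G" "G \<subseteq> I" "x \<in> unit_ball E" for G x
  proof -
    have x: "x \<in> carrier E" using G by (simp add: unit_ball_def)
    then have "nrm E (a (P G x) \<ominus> a x) \<le> \<epsilon>"
      using F(3)[OF G] nrm_diff_commute[of "a (P G x)" "a x"] D_closed[OF G(3)] bounded_opsD(1)[OF a']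
      by (simp add: ops.op_diff[OF a'])
    then show ?thesis using x by (simp add: compact_op_algebra_simps compose_eq)
  qed
  with F show "\<exists>F. finite F \<and> F \<subseteq> I \<and>
      (\<forall>G x. finite G \<longrightarrow> F \<subseteq> G \<longrightarrow> G \<subseteq> I \<longrightarrow> x \<in> unit_ball E \<longrightarrow> nrm E ((a \<otimes>\<^bsub>K\<^esub> P G) x \<ominus> a x) \<le> \<epsilon>)"
    by blast
qed

lemma approximately_unital_K: "approximately_unital K"
  unfolding approximately_unital_def
proof (intro exI[of _ "filtermap P (finite_subsets_at_top I)"] conjI ballI)
  show "filtermap P (finite_subsets_at_top I) \<noteq> bot"
    by (simp add: filtermap_bot_iff)
  have "P F \<in> unit_ball K" if "finite F" "F \<subseteq> I" for F
    using that D_in_K op_nrm_D[of F "\<lambda>_. 1"] by (simp add: unit_ball_def compact_op_algebra_simps)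
  then show "\<forall>\<^sub>F e in filtermap P (finite_subsets_at_top I). e \<in> unit_ball K"
    unfolding eventually_filtermap by (intro eventually_finite_subsets_at_top_weakI)
  fix a assume "a \<in> carrier K"
  then have a: "compact_op E a" by (simp add: compact_op_algebra_simps)
  show "((\<lambda>e. nrm K (e \<otimes>\<^bsub>K\<^esub> a \<ominus>\<^bsub>K\<^esub> a)) \<longlongrightarrow> 0) (filtermap P (finite_subsets_at_top I))"
    "((\<lambda>e. nrm K (a \<otimes>\<^bsub>K\<^esub> e \<ominus>\<^bsub>K\<^esub> a)) \<longlongrightarrow> 0) (filtermap P (finite_subsets_at_top I))"
    unfolding filterlim_filtermap by (rule P_a_tendsto[OF a] a_P_tendsto[OF a])+
qed

text \<open>P a P - a = P (a P - a) + (P a - a), and the outer \<open>P\<close> is a contraction;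
  both one-sided limits enter.\<close>

lemma P_a_P_tendsto:
  assumes a: "compact_op E a"
  shows "((\<lambda>F. nrm K (P F \<otimes>\<^bsub>K\<^esub> (a \<otimes>\<^bsub>K\<^esub> P F) \<ominus>\<^bsub>K\<^esub> a)) \<longlongrightarrow> 0) (finite_subsets_at_top I)"
proof (rule K_tendsto_zeroI[OF _ _ a])
  note a' = compact_op_bounded[OF a]
  show "compact_op E (P G \<otimes>\<^bsub>K\<^esub> (a \<otimes>\<^bsub>K\<^esub> P G))" if "G \<subseteq> I" for G
    unfolding compact_op_algebra_simps by (intro compact_op_compose D_compact that a)
  fix \<epsilon> :: real assume "\<epsilon> > 0"
  then have \<epsilon>: "\<epsilon> / 2 > 0" by simp
  obtain F where F: "finite F" "F \<subseteq> I"
    "\<And>G x. \<lbrakk>finite G; F \<subseteq> G; G \<subseteq> I; x \<in> unit_ball E\<rbrakk> \<Longrightarrow> nrm E (a (x \<ominus> P G x)) \<le> \<epsilon> / 2"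
    using compose_P_tendsto[OF a \<epsilon>] by metis
  obtain F' where F': "finite F'" "F' \<subseteq> I"
    "\<And>G x. \<lbrakk>finite G; F' \<subseteq> G; G \<subseteq> I; x \<in> unit_ball E\<rbrakk> \<Longrightarrow> nrm E (a x \<ominus> P G (a x)) \<le> \<epsilon> / 2"
    using P_compose_tendsto[OF a \<epsilon>] by metis
  have "nrm E ((P G \<otimes>\<^bsub>K\<^esub> (a \<otimes>\<^bsub>K\<^esub> P G)) x \<ominus> a x) \<le> \<epsilon>"
    if G: "finite G" "F \<union> F' \<subseteq> G" "G \<subseteq> I" "x \<in> unit_ball E" for G x
  proof -
    have x: "x \<in> carrier E" using G by (simp add: unit_ball_def)
    note mem = x D_closed[OF G(3) x, of "\<lambda>_. 1"] bounded_opsD(1)[OF a']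
      D_closed[OF G(3), of _ "\<lambda>_. 1"]
    have "P G (a (P G x)) \<ominus> P G (a x) = P G (a (P G x \<ominus> x))"
      using mem by (simp add: ops.op_diff[OF a'] ops.op_diff[OF D_bounded[OF G(3)]])
    moreover have "nrm E (P G (a (P G x \<ominus> x))) \<le> nrm E (a (P G x \<ominus> x))"
      by (rule P_contraction) (use G mem in auto)
    moreover have "nrm E (a (P G x \<ominus> x)) = nrm E (a (x \<ominus> P G x))"
      using mem nrm_diff_commute[of "a x" "a (P G x)"] by (simp add: ops.op_diff[OF a'])
    moreover have "nrm E (a (x \<ominus> P G x)) \<le> \<epsilon> / 2" "nrm E (a x \<ominus> P G (a x)) \<le> \<epsilon> / 2"
      using F(3)[of G x] F'(3)[of G x] G by auto
    moreover have "nrm E (P G (a x) \<ominus> a x) = nrm E (a x \<ominus> P G (a x))"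
      using mem nrm_diff_commute by simp
    moreover have "nrm E (P G (a (P G x)) \<ominus> a x)
        \<le> nrm E (P G (a (P G x)) \<ominus> P G (a x)) + nrm E (P G (a x) \<ominus> a x)"
      using mem by (intro nrm_diff_trans) auto
    ultimately have "nrm E (P G (a (P G x)) \<ominus> a x) \<le> \<epsilon>" by simp
    then show ?thesis using x by (simp add: compact_op_algebra_simps compose_eq)
  qed
  with F F' show "\<exists>F. finite F \<and> F \<subseteq> I \<and> (\<forall>G x. finite G \<longrightarrow> F \<subseteq> G \<longrightarrow> G \<subseteq> I \<longrightarrow> x \<in> unit_ball E \<longrightarrow>
        nrm E ((P G \<otimes>\<^bsub>K\<^esub> (a \<otimes>\<^bsub>K\<^esub> P G)) x \<ominus> a x) \<le> \<epsilon>)"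
    by (intro exI[of _ "F \<union> F'"]) blast
qed

end

lemma ex_unimodular_mult:
  fixes z :: complex
  obtains \<alpha> where "cmod \<alpha> = 1" "\<alpha> * z = complex_of_real (cmod z)"
proof (cases "z = 0")
  case True
  then show ?thesis using that[of 1] by simp
next
  case False
  then show ?thesis using that[of "cnj z / cmod z"]
    by (simp add: norm_divide field_simps complex_norm_square[symmetric] power2_eq_square)
qed

section \<open>The L-projection onto the annihilator of the compact operators\<close>

locale lp_decomposition_noncompact = lp_decomposition + norming_space_noncompact
begin

context
  fixes f assumes f: "f \<in> bounded_ops K1 complex_line"
begin

lemma functional_add: "\<lbrakk>a \<in> carrier K; b \<in> carrier K\<rbrakk> \<Longrightarrow> f (a \<oplus>\<^bsub>K\<^esub> b, 0) = f (a, 0) + f (b, 0)"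
  using bounded_opsD(2)[OF f, of "(a, 0)" "(b, 0)"] Id_noncompact by (simp add: unitization_simps)

lemma functional_smult: "a \<in> carrier K \<Longrightarrow> f (c \<odot>\<^bsub>K\<^esub> a, 0) = c * f (a, 0)"
  using bounded_opsD(3)[OF f, of "(a, 0)" c] Id_noncompact by (simp add: unitization_simps)

lemma functional_zero: "f (\<zero>\<^bsub>K\<^esub>, 0) = 0"
  using functional_smult[of "\<zero>\<^bsub>K\<^esub>" 0] by simp

lemma functional_diff: "\<lbrakk>a \<in> carrier K; b \<in> carrier K\<rbrakk> \<Longrightarrow> f (a \<ominus>\<^bsub>K\<^esub> b, 0) = f (a, 0) - f (b, 0)"
  by (simp add: K.diff_smult functional_add functional_smult)

lemma functional_bound: "a \<in> carrier K \<Longrightarrow> cmod (f (a, 0)) \<le> op_nrm K1 complex_line f * nrm K a"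
  using K1_dual.op_nrm_bound[OF f, of "(a, 0)"] aug_0[OF compact_op_bounded, of a]
  by (simp add: mem_unitization_iff nrm_unitization_eq compact_op_algebra_simps)

lemma functional_unit:
  assumes "compact_op E a" "\<And>x. x \<in> carrier E \<Longrightarrow> nrm E (aug a s x) \<le> nrm E x"
  shows "cmod (f (a, s)) \<le> op_nrm K1 complex_line f"
proof -
  have "op_nrm E E (aug a s) \<le> 1" by (rule ops.op_nrm_le) (use assms in auto)
  then have "(a, s) \<in> unit_ball K1"
    using assms by (simp add: unit_ball_def mem_unitization_iff nrm_unitization_eq)
  from K1_dual.op_nrm_unit_ball[OF f this] show ?thesis by simp
qed

lemma functional_D:
  assumes "finite F" "F \<subseteq> I" shows "f (D \<theta> F, 0) = (\<Sum>i\<in>F. \<theta> i * f (e i, 0))"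
  using assms
proof (induction F rule: finite_induct)
  case empty
  then show ?case by (simp add: D_def functional_zero)
next
  case (insert j F)
  have "D \<theta> (insert j F) = \<theta> j \<odot>\<^bsub>K\<^esub> e j \<oplus>\<^bsub>K\<^esub> D \<theta> F"
    unfolding D_def using insert e_in_K[of "insert j F" \<theta>] by (intro K.M.finsum_insert) (auto simp: Pi_iff)
  moreover have "e j \<in> carrier K" using insert e_compact by (auto simp: compact_op_algebra_simps)
  ultimately show ?case
    using insert D_in_K[of F \<theta>] by (simp add: functional_add functional_smult)
qed

text \<open>Unimodular coefficients \<theta> align the values of \<open>f\<close> on the blocks, and
  the diagonal operator with these coefficients is still a contraction. The summability of
  \<open>f (e i, 0)\<close> follows, and with it the convergence of
  \<open>f (P F, 0)\<close>.\<close>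

lemma functional_abs_sum_le:
  assumes F: "finite F" "F \<subseteq> I"
  shows "(\<Sum>i\<in>F. cmod (f (e i, 0))) \<le> op_nrm K1 complex_line f"
proof -
  have "\<exists>\<alpha>. cmod \<alpha> = 1 \<and> \<alpha> * f (e i, 0) = complex_of_real (cmod (f (e i, 0)))" for i
    by (rule ex_unimodular_mult[of "f (e i, 0)"]) blast
  then obtain \<theta> where \<theta>: "\<And>i. cmod (\<theta> i) = 1" "\<And>i. \<theta> i * f (e i, 0) = complex_of_real (cmod (f (e i, 0)))"
    by metis
  have "cmod (f (D \<theta> F, 0)) = (\<Sum>i\<in>F. cmod (f (e i, 0)))"
    by (simp add: functional_D[OF F] \<theta>(2) sum_nonneg flip: of_real_sum)
  moreover have "cmod (f (D \<theta> F, 0)) \<le> op_nrm K1 complex_line f * 1"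
  proof (rule order_trans[OF functional_bound[OF D_in_K[OF F(2)]]])
    show "op_nrm K1 complex_line f * nrm K (D \<theta> F) \<le> op_nrm K1 complex_line f * 1"
      unfolding compact_op_algebra_simps
      by (intro mult_left_mono op_nrm_D[OF F] K1_dual.op_nrm_nonneg[OF f]) (simp add: \<theta>(1))
  qed
  ultimately show ?thesis by simp
qed

lemma functional_summable: "(\<lambda>i. f (e i, 0)) summable_on I"
proof -
  have "(\<lambda>i. norm (f (e i, 0))) summable_on I"
    by (rule nonneg_bdd_above_summable_on) (use functional_abs_sum_le in \<open>auto simp: bdd_above_def\<close>)
  then show ?thesis by (rule abs_summable_summable)
qed

end

text \<open>The infinite sum is the limit of \<open>f (P F, 0)\<close> along the finite subsets;
  written as a sum it is plainly linear in \<open>f\<close>.\<close>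

definition lam :: "(('a \<Rightarrow> 'a) \<times> complex \<Rightarrow> complex) \<Rightarrow> complex" where
  "lam f = f (\<zero>\<^bsub>K\<^esub>, 1) - (\<Sum>\<^sub>\<infinity>i\<in>I. f (e i, 0))"

text \<open>The two terms are limits of the moduli of \<open>f\<close> at the compression of a + s1
  to the range of \<open>P F\<close> and at \<open>1 - P F\<close>. For fixed \<open>F\<close> both
  moduli are picked up at once by a single contraction, so the inequality holds before the limit.
  The supremum over the unit ball is the nontrivial half of the L-decomposition.\<close>

lemma lam_ineq:
  assumes f: "f \<in> bounded_ops K1 complex_line" and X: "(a, s) \<in> unit_ball K1"
  shows "cmod (f (a, s) - lam f * s) + cmod (lam f) \<le> op_nrm K1 complex_line f"
proof -
  have a: "compact_op E a" and aK: "a \<in> carrier K"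
    using X by (auto simp: unit_ball_def mem_unitization_iff compact_op_algebra_simps)
  note a' = compact_op_bounded[OF a] note aug' = aug_bounded[OF a', of s]
  have n1: "op_nrm E E (aug a s) \<le> 1"
    using X a by (simp add: unit_ball_def nrm_unitization_eq)
  \<comment> \<open>The compression of a + s1 by \<open>P F\<close>. Its scalar part becomes
    \<open>s\<close> times the compact operator \<open>P F\<close>, so \<open>T F\<close> lies in
    \<open>K\<close>.\<close>
  define T where "T F = P F \<otimes>\<^bsub>K\<^esub> (a \<otimes>\<^bsub>K\<^esub> P F) \<oplus>\<^bsub>K\<^esub> s \<odot>\<^bsub>K\<^esub> P F" for F
  have T_compact: "compact_op E (T F)" "T F \<in> carrier K" if "F \<subseteq> I" for F
  proof -
    have "P F \<otimes>\<^bsub>K\<^esub> (a \<otimes>\<^bsub>K\<^esub> P F) \<in> carrier K" "P F \<in> carrier K"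
      using that D_compact a by (auto simp: compact_op_algebra_simps intro!: compact_op_compose)
    then show "T F \<in> carrier K" by (simp add: T_def)
    then show "compact_op E (T F)" by (simp add: compact_op_algebra_simps)
  qed
  have T_apply: "T F x = P F (aug a s (P F x))" if F: "finite F" "F \<subseteq> I" and x: "x \<in> carrier E" for F x
  proof -
    have "P F x \<in> carrier E" "a (P F x) \<in> carrier E"
      using D_closed[OF F(2) x] bounded_opsD(1)[OF a'] by auto
    then show ?thesis
      using x bounded_opsD(2,3)[OF D_bounded[OF F(2), of "\<lambda>_. 1"]]
      by (simp add: T_def compact_op_algebra_simps compose_eq aug_apply P_idem[OF F x])
  qed
  have le: "cmod (f (T F, 0)) + cmod (f (\<zero>\<^bsub>K\<^esub>, 1) - f (P F, 0)) \<le> op_nrm K1 complex_line f"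
    if F: "finite F" "F \<subseteq> I" for F
  proof -
    have PK: "P F \<in> carrier K" by (rule D_in_K[OF F(2)])
    obtain \<alpha> where \<alpha>: "cmod \<alpha> = 1" "\<alpha> * f (T F, 0) = complex_of_real (cmod (f (T F, 0)))"
      by (rule ex_unimodular_mult)
    obtain \<beta> where \<beta>: "cmod \<beta> = 1" "\<beta> * (f (\<zero>\<^bsub>K\<^esub>, 1) - f (P F, 0)) = complex_of_real (cmod (f (\<zero>\<^bsub>K\<^esub>, 1) - f (P F, 0)))"
      by (rule ex_unimodular_mult)
    \<comment> \<open>The pair \<open>(y, \<beta>)\<close> is \<alpha> T F + \<beta> (1 - P F), with
      the compact part \<beta> P F moved into \<open>y\<close>.\<close>
    define y where "y = \<alpha> \<odot>\<^bsub>K\<^esub> T F \<ominus>\<^bsub>K\<^esub> \<beta> \<odot>\<^bsub>K\<^esub> P F"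
    have yK: "y \<in> carrier K" using T_compact[OF F(2)] PK by (simp add: y_def)
    then have y: "compact_op E y" by (simp add: compact_op_algebra_simps)
    have "f (y, \<beta>) = complex_of_real (cmod (f (T F, 0)) + cmod (f (\<zero>\<^bsub>K\<^esub>, 1) - f (P F, 0)))"
      using functional_split[OF f y, of \<beta>] T_compact[OF F(2)] PK \<alpha> \<beta>
      by (simp add: y_def functional_diff[OF f] functional_smult[OF f] algebra_simps)
    then have "cmod (f (y, \<beta>)) = cmod (f (T F, 0)) + cmod (f (\<zero>\<^bsub>K\<^esub>, 1) - f (P F, 0))"
      by (simp del: of_real_add)
    moreover have "cmod (f (y, \<beta>)) \<le> op_nrm K1 complex_line f"
    proof (rule functional_unit[OF f y])
      fix x assume x: "x \<in> carrier E"
      define u where "u = \<alpha> \<odot> T F x"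
      define v where "v = \<beta> \<odot> (x \<ominus> P F x)"
      note TF = bounded_opsD(1)[OF compact_op_bounded[OF T_compact(1)[OF F(2)]] x]
      have Px: "P F x \<in> carrier E" by (rule D_closed[OF F(2) x])
      have mem: "u \<in> carrier E" "v \<in> carrier E" using TF Px x by (auto simp: u_def v_def)
      have yx: "y x = \<alpha> \<odot> T F x \<ominus> \<beta> \<odot> P F x"
        unfolding y_def
        using T_compact[OF F(2)] PK x
        by (subst K_diff_apply) (auto simp: compact_op_algebra_simps compact_op_smult)
      have auv: "aug y \<beta> x = u \<oplus> v"
        using x TF Px by (simp add: aug_apply yx u_def v_def diff_smult smult_add_right M.a_ac)
      have augP: "aug a s (P F x) \<in> carrier E" using bounded_opsD(1)[OF aug' Px] .
      have "P F u = u"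
        using TF by (simp add: u_def bounded_opsD(3)[OF D_bounded[OF F(2)]] T_apply[OF F x] P_idem[OF F augP])
      moreover have "P F v = \<zero>"
        using x Px by (simp add: v_def bounded_opsD(3)[OF D_bounded[OF F(2)]] ops.op_diff[OF D_bounded[OF F(2)]] P_idem[OF F x])
      ultimately have Puv: "P F (u \<oplus> v) = u"
        using mem by (simp add: bounded_opsD(2)[OF D_bounded[OF F(2)]])
      \<comment> \<open>\<open>T F\<close> sees only \<open>P F x\<close>, and the operator in
        between has norm at most 1. Together with \<open>v\<close>, which has the norm of
        \<open>x \<ominus> P F x\<close>, this allows the splitting of \<open>u \<oplus> v\<close>
        to be compared with that of \<open>x\<close> term by term.\<close>
      have "nrm E u \<le> nrm E (P F x)"
      proof -
        have "nrm E u = nrm E (P F (aug a s (P F x)))"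
          using TF \<alpha> by (simp add: u_def nrm_smult T_apply[OF F x])
        also have "\<dots> \<le> nrm E (aug a s (P F x))" by (rule P_contraction[OF F augP])
        also have "\<dots> \<le> op_nrm E E (aug a s) * nrm E (P F x)" by (rule ops.op_nrm_bound[OF aug' Px])
        also have "\<dots> \<le> 1 * nrm E (P F x)" by (intro mult_right_mono n1 nrm_nonneg Px)
        finally show ?thesis by simp
      qed
      then have "nrm E u powr p \<le> nrm E (P F x) powr p"
        using p_gt_1 mem nrm_nonneg by (intro powr_mono2) auto
      moreover have "nrm E v = nrm E (x \<ominus> P F x)"
        using \<beta> x Px by (simp add: v_def nrm_smult)
      ultimately have "nrm E (u \<oplus> v) powr p \<le> nrm E x powr p"
        using P_split[OF F, of "u \<oplus> v"] P_split[OF F x] mem by (simp add: Puv)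
      then have "nrm E (u \<oplus> v) \<le> nrm E x"
        by (rule powr_le_imp_le) (use mem x in \<open>auto simp: nrm_nonneg\<close>)
      then show "nrm E (aug y \<beta> x) \<le> nrm E x" by (simp only: auv)
    qed
    ultimately show ?thesis by simp
  qed
  have lim_P: "((\<lambda>F. f (P F, 0)) \<longlongrightarrow> (\<Sum>\<^sub>\<infinity>i\<in>I. f (e i, 0))) (finite_subsets_at_top I)"
  proof (rule Lim_transform_eventually)
    show "(sum (\<lambda>i. f (e i, 0)) \<longlongrightarrow> (\<Sum>\<^sub>\<infinity>i\<in>I. f (e i, 0))) (finite_subsets_at_top I)"
      using has_sum_infsum[OF functional_summable[OF f]] by (simp add: has_sum_def)
    show "\<forall>\<^sub>F F in finite_subsets_at_top I. (\<Sum>i\<in>F. f (e i, 0)) = f (P F, 0)"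
      by (rule eventually_finite_subsets_at_top_weakI) (simp add: functional_D[OF f])
  qed
  have lim_PaP: "((\<lambda>F. f (P F \<otimes>\<^bsub>K\<^esub> (a \<otimes>\<^bsub>K\<^esub> P F), 0)) \<longlongrightarrow> f (a, 0)) (finite_subsets_at_top I)"
  proof (rule LIM_zero_cancel, rule Lim_null_comparison)
    have "P F \<otimes>\<^bsub>K\<^esub> (a \<otimes>\<^bsub>K\<^esub> P F) \<in> carrier K" if "F \<subseteq> I" for F
      using that D_compact a by (auto simp: compact_op_algebra_simps intro!: compact_op_compose)
    then have "cmod (f (P F \<otimes>\<^bsub>K\<^esub> (a \<otimes>\<^bsub>K\<^esub> P F), 0) - f (a, 0))
        \<le> op_nrm K1 complex_line f * nrm K (P F \<otimes>\<^bsub>K\<^esub> (a \<otimes>\<^bsub>K\<^esub> P F) \<ominus>\<^bsub>K\<^esub> a)" if "F \<subseteq> I" for F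
      using functional_bound[OF f, of "P F \<otimes>\<^bsub>K\<^esub> (a \<otimes>\<^bsub>K\<^esub> P F) \<ominus>\<^bsub>K\<^esub> a"] that aK by (simp add: functional_diff[OF f])
    then show "\<forall>\<^sub>F F in finite_subsets_at_top I. cmod (f (P F \<otimes>\<^bsub>K\<^esub> (a \<otimes>\<^bsub>K\<^esub> P F), 0) - f (a, 0))
        \<le> op_nrm K1 complex_line f * nrm K (P F \<otimes>\<^bsub>K\<^esub> (a \<otimes>\<^bsub>K\<^esub> P F) \<ominus>\<^bsub>K\<^esub> a)"
      by (intro eventually_finite_subsets_at_top_weakI) auto
    show "((\<lambda>F. op_nrm K1 complex_line f * nrm K (P F \<otimes>\<^bsub>K\<^esub> (a \<otimes>\<^bsub>K\<^esub> P F) \<ominus>\<^bsub>K\<^esub> a)) \<longlongrightarrow> 0) (finite_subsets_at_top I)"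
      using tendsto_mult[OF tendsto_const P_a_P_tendsto[OF a]] by simp
  qed
  have "f (T F, 0) = f (P F \<otimes>\<^bsub>K\<^esub> (a \<otimes>\<^bsub>K\<^esub> P F), 0) + s * f (P F, 0)" if "F \<subseteq> I" for F
  proof -
    have "P F \<otimes>\<^bsub>K\<^esub> (a \<otimes>\<^bsub>K\<^esub> P F) \<in> carrier K"
      using that D_compact a by (auto simp: compact_op_algebra_simps intro!: compact_op_compose)
    then show ?thesis using D_in_K[OF that] by (simp add: T_def functional_add[OF f] functional_smult[OF f])
  qed
  then have "\<forall>\<^sub>F F in finite_subsets_at_top I.
      f (P F \<otimes>\<^bsub>K\<^esub> (a \<otimes>\<^bsub>K\<^esub> P F), 0) + s * f (P F, 0) = f (T F, 0)"
    by (intro eventually_finite_subsets_at_top_weakI) auto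
  moreover have "((\<lambda>F. f (P F \<otimes>\<^bsub>K\<^esub> (a \<otimes>\<^bsub>K\<^esub> P F), 0) + s * f (P F, 0)) \<longlongrightarrow>
      f (a, 0) + s * (\<Sum>\<^sub>\<infinity>i\<in>I. f (e i, 0))) (finite_subsets_at_top I)"
    by (intro tendsto_intros lim_PaP lim_P)
  ultimately have lim_T: "((\<lambda>F. f (T F, 0)) \<longlongrightarrow> f (a, 0) + s * (\<Sum>\<^sub>\<infinity>i\<in>I. f (e i, 0))) (finite_subsets_at_top I)"
    by (rule Lim_transform_eventually[rotated])
  have "f (a, s) - lam f * s = f (a, 0) + s * (\<Sum>\<^sub>\<infinity>i\<in>I. f (e i, 0))"
    using functional_split[OF f a, of s] by (simp add: lam_def algebra_simps)
  moreover have "cmod (f (a, 0) + s * (\<Sum>\<^sub>\<infinity>i\<in>I. f (e i, 0))) + cmod (lam f) \<le> op_nrm K1 complex_line f"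
    unfolding lam_def
  proof (rule tendsto_le[OF _ tendsto_const])
    show "((\<lambda>F. cmod (f (T F, 0)) + cmod (f (\<zero>\<^bsub>K\<^esub>, 1) - f (P F, 0))) \<longlongrightarrow>
        cmod (f (a, 0) + s * (\<Sum>\<^sub>\<infinity>i\<in>I. f (e i, 0))) + cmod (f (\<zero>\<^bsub>K\<^esub>, 1) - (\<Sum>\<^sub>\<infinity>i\<in>I. f (e i, 0))))
        (finite_subsets_at_top I)"
      by (intro tendsto_intros lim_T lim_P)
    show "\<forall>\<^sub>F F in finite_subsets_at_top I.
        cmod (f (T F, 0)) + cmod (f (\<zero>\<^bsub>K\<^esub>, 1) - f (P F, 0)) \<le> op_nrm K1 complex_line f"
      by (intro eventually_finite_subsets_at_top_weakI le)
  qed simp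
  ultimately show ?thesis by simp
qed

lemma lam_linear:
  assumes "f \<in> bounded_ops K1 complex_line" "g \<in> bounded_ops K1 complex_line"
  shows "lam (f \<oplus>\<^bsub>dual_space K1\<^esub> g) = lam f + lam g" "lam (c \<odot>\<^bsub>dual_space K1\<^esub> f) = c * lam f"
proof -
  have "(e i, 0) \<in> carrier K1" if "i \<in> I" for i
    using e_compact[OF that] by (simp add: mem_unitization_iff)
  then have 1: "(\<Sum>\<^sub>\<infinity>i\<in>I. (f \<oplus>\<^bsub>dual_space K1\<^esub> g) (e i, 0)) = (\<Sum>\<^sub>\<infinity>i\<in>I. f (e i, 0) + g (e i, 0))"
    and 2: "(\<Sum>\<^sub>\<infinity>i\<in>I. (c \<odot>\<^bsub>dual_space K1\<^esub> f) (e i, 0)) = (\<Sum>\<^sub>\<infinity>i\<in>I. c * f (e i, 0))"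
    by (auto simp: dual_space_def op_space_simps intro!: infsum_cong)
  have one: "(\<zero>\<^bsub>K\<^esub>, 1) \<in> carrier K1"
    using K.M.zero_closed by (simp add: mem_unitization_iff compact_op_algebra_simps)
  show "lam (f \<oplus>\<^bsub>dual_space K1\<^esub> g) = lam f + lam g"
    unfolding lam_def 1
    by (subst infsum_add[OF functional_summable functional_summable]) (use assms one in \<open>auto simp: dual_space_def op_space_simps\<close>)
  show "lam (c \<odot>\<^bsub>dual_space K1\<^esub> f) = c * lam f"
    unfolding lam_def 2
    by (subst infsum_cmult_right')
      (use assms one in \<open>auto simp: dual_space_def op_space_simps algebra_simps\<close>)
qed

lemma lam_chi: "lam chi = 1"
proof -
  have "chi (e i, 0) = 0" if "i \<in> I" for i
    using e_compact[OF that] by (simp add: chi_def mem_unitization_iff)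
  moreover have "chi (\<zero>\<^bsub>K\<^esub>, 1) = 1"
    using K.M.zero_closed by (simp add: chi_def mem_unitization_iff compact_op_algebra_simps)
  ultimately show ?thesis by (simp add: lam_def cong: infsum_cong)
qed

lemma M_ideal_K: "M_ideal K1 (carrier K \<times> {0})"
proof -
  let ?D = "dual_space K1"
  interpret D: complex_normed_space ?D
    unfolding dual_space_def by (rule K1_dual.op_space.complex_normed_space_axioms)
  have D_carrier: "carrier ?D = bounded_ops K1 complex_line" and D_nrm: "nrm ?D = op_nrm K1 complex_line"
    by (simp_all add: dual_space_def op_space_simps)
  define Q where "Q = (\<lambda>f\<in>carrier ?D. lam f \<odot>\<^bsub>?D\<^esub> chi)"
  have chi: "chi \<in> carrier ?D" "nrm ?D chi = 1" using chi_bounded by (simp_all add: D_carrier D_nrm)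
  have Q_apply: "Q f = lam f \<odot>\<^bsub>?D\<^esub> chi" if "f \<in> carrier ?D" for f using that by (simp add: Q_def)
  have Q_closed: "Q f \<in> carrier ?D" if "f \<in> carrier ?D" for f using that chi by (simp add: Q_apply)
  \<comment> \<open>One inequality is the triangle inequality. The other is \<open>lam_ineq\<close>
    read as a bound for f - lam f * chi at each point of the unit ball.\<close>
  have L: "nrm ?D f = nrm ?D (Q f) + nrm ?D (f \<ominus>\<^bsub>?D\<^esub> Q f)" if f: "f \<in> carrier ?D" for f
  proof (rule antisym)
    show "nrm ?D f \<le> nrm ?D (Q f) + nrm ?D (f \<ominus>\<^bsub>?D\<^esub> Q f)"
      using D.nrm_le_diff[OF f Q_closed[OF f]] by simp
    have f': "f \<in> bounded_ops K1 complex_line" "Q f \<in> bounded_ops K1 complex_line"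
      using f Q_closed[OF f] by (simp_all add: D_carrier)
    have nQ: "nrm ?D (Q f) = cmod (lam f)" using chi by (simp add: Q_apply[OF f] D.nrm_smult)
    have "nrm ?D (f \<ominus>\<^bsub>?D\<^esub> Q f) \<le> op_nrm K1 complex_line f - cmod (lam f)"
      unfolding D_nrm
    proof (rule K1_dual.op_nrm_leI)
      fix X assume X: "X \<in> unit_ball K1"
      obtain a s where [simp]: "X = (a, s)" by (cases X)
      have XE: "(a, s) \<in> carrier K1" using X by (simp add: unit_ball_def)
      have "(f \<ominus>\<^bsub>?D\<^esub> Q f) (a, s) = f (a, s) \<ominus>\<^bsub>complex_line\<^esub> Q f (a, s)"
        unfolding dual_space_def
        by (rule K1_dual.op_space_diff) (use f' XE in \<open>simp_all add: dual_space_def\<close>)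
      also have "\<dots> = f (a, s) - Q f (a, s)"
        using complex_normed_space.diff_smult[OF complex_normed_space_complex_line] by simp
      also have "Q f (a, s) = lam f * s"
        using XE by (simp add: Q_apply[OF f] dual_space_def op_space_simps chi_def)
      finally show "nrm complex_line ((f \<ominus>\<^bsub>?D\<^esub> Q f) X) \<le> op_nrm K1 complex_line f - cmod (lam f)"
        using lam_ineq[OF f'(1), of a s] X by simp
    qed
    then show "nrm ?D (Q f) + nrm ?D (f \<ominus>\<^bsub>?D\<^esub> Q f) \<le> nrm ?D f"
      using nQ by (simp add: D_nrm)
  qed
  have Q_bounded: "Q \<in> bounded_ops ?D ?D"
  proof (rule bounded_opsI[where K = 1])
    fix f g c assume f: "f \<in> carrier ?D"
    show "Q f \<in> carrier ?D" by (rule Q_closed[OF f])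
    show "nrm ?D (Q f) \<le> 1 * nrm ?D f"
      using L[OF f] D.nrm_nonneg[of "f \<ominus>\<^bsub>?D\<^esub> Q f"] Q_closed[OF f] f by simp
    show "Q (c \<odot>\<^bsub>?D\<^esub> f) = c \<odot>\<^bsub>?D\<^esub> Q f"
      using f chi lam_linear(2)[of f f c] by (simp add: Q_apply D_carrier[symmetric])
    assume g: "g \<in> carrier ?D"
    show "Q (f \<oplus>\<^bsub>?D\<^esub> g) = Q f \<oplus>\<^bsub>?D\<^esub> Q g"
      using f g chi lam_linear(1)[of f g] by (simp add: Q_apply D_carrier[symmetric] D.smult_add_left)
  qed (simp add: Q_def)
  have Q_chi: "Q (t \<odot>\<^bsub>?D\<^esub> chi) = t \<odot>\<^bsub>?D\<^esub> chi" for t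
    using chi lam_linear(2)[of chi chi t] by (simp add: Q_apply lam_chi D_carrier[symmetric])
  have "compose (carrier ?D) Q Q = Q"
  proof (rule extensionalityI[of _ "carrier ?D"])
    fix f assume f: "f \<in> carrier ?D"
    show "compose (carrier ?D) Q Q f = Q f"
      using Q_chi[of "lam f"] f by (simp add: compose_eq Q_apply[OF f])
  qed (auto simp: Q_def)
  moreover have "annihilator K1 (carrier K \<times> {0}) = Q ` carrier ?D"
  proof -
    have "Q ` carrier ?D \<subseteq> range (\<lambda>t. t \<odot>\<^bsub>?D\<^esub> chi)" by (auto simp: Q_apply)
    moreover have "t \<odot>\<^bsub>?D\<^esub> chi \<in> Q ` carrier ?D" for t
      by (rule image_eqI[where x = "t \<odot>\<^bsub>?D\<^esub> chi"]) (simp_all add: Q_chi chi(1))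
    ultimately show ?thesis unfolding annihilator_unitization by blast
  qed
  ultimately have "L_summand ?D (annihilator K1 (carrier K \<times> {0}))"
    unfolding L_summand_def L_projection_def using Q_bounded L by blast
  then show ?thesis
    unfolding M_ideal_def using closedin_K submodule_K by simp
qed

end

theorem (in lp_decomposition) M_approximately_unital_K: "M_approximately_unital K"
proof -
  have "M_ideal K1 (carrier K \<times> {0})"
  proof (cases "compact_op E idE")
    case True
    then show ?thesis by (rule M_ideal_if_identity_compact)
  next
    case False
    then interpret lp_decomposition_noncompact E p I e by unfold_locales
    show ?thesis by (rule M_ideal_K)
  qed
  then show ?thesis
    unfolding M_approximately_unital_def
    using compact_op_algebra_banach approximately_unital_K by blast
qed

section \<open>The spaces \<open>L\<^sup>p\<close>\<close>

text \<open>The conjugate factor is written as \<open>c powr (p - 1)\<close>, so that no conjugate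
  exponent is needed outside this proof. Convexity of t ^ p and Hoelder's inequality are both
  derived from this form.\<close>

lemma Young_powr:
  fixes p a c :: real
  assumes "1 < p" "0 \<le> a" "0 \<le> c"
  shows "a * c powr (p - 1) \<le> a powr p / p + (1 - 1 / p) * c powr p"
proof -
  define q where "q = p / (p - 1)"
  have inv_q: "1 / q = 1 - 1 / p" using assms(1) by (simp add: q_def diff_divide_distrib)
  have q: "1 < q" "(p - 1) * q = p" using assms(1) by (simp_all add: q_def)
  have "a * c powr (p - 1) \<le> a powr p / p + (c powr (p - 1)) powr q / q"
    using assms q inv_q by (intro Youngs_inequality) auto
  also have "(c powr (p - 1)) powr q / q = (1 - 1 / p) * c powr p"
    using q by (simp add: powr_powr flip: inv_q)
  finally show ?thesis .
qed

text \<open>Young's inequality multiplied by \<open>p\<close>, read as the statement that the graph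
  of t ^ p lies above its tangent at \<open>c\<close>.\<close>

lemma powr_tangent:
  fixes p a c :: real
  assumes "1 < p" "0 \<le> a" "0 \<le> c"
  shows "c powr p + p * c powr (p - 1) * (a - c) \<le> a powr p"
proof -
  have "c * c powr (p - 1) = c powr p"
    using assms(3) powr_mult_base[of c "p - 1"] by simp
  then show ?thesis
    using mult_left_mono[OF Young_powr[OF assms], of p] assms(1) by (simp add: algebra_simps)
qed

text \<open>Take the tangent at the convex combination \<open>c\<close> itself: in the weighted sum
  of the two tangent inequalities the linear terms cancel.\<close>

lemma powr_convex_combination:
  fixes p x y t :: real
  assumes p: "1 < p" and "0 \<le> x" "0 \<le> y" "0 \<le> t" "t \<le> 1"
  shows "(t * x + (1 - t) * y) powr p \<le> t * x powr p + (1 - t) * y powr p"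
proof -
  define c where "c = t * x + (1 - t) * y"
  have c: "0 \<le> c" using assms by (simp add: c_def)
  have "t * (c powr p + p * c powr (p - 1) * (x - c)) + (1 - t) * (c powr p + p * c powr (p - 1) * (y - c))
      \<le> t * x powr p + (1 - t) * y powr p"
    using assms c by (intro add_mono mult_left_mono powr_tangent) auto
  moreover have "t * (c powr p + p * c powr (p - 1) * (x - c)) + (1 - t) * (c powr p + p * c powr (p - 1) * (y - c))
      = c powr p + p * c powr (p - 1) * (t * x + (1 - t) * y - c)"
    by (simp add: algebra_simps)
  ultimately show ?thesis by (simp add: c_def)
qed

section \<open>The Banach space L^p and its norming functionals\<close>

locale Lp_space =
  fixes p :: real and M :: "'a measure"
  assumes p_gt_1: "1 < p"
begin

abbreviation "L \<equiv> Lp_fun p M"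
abbreviation "cls \<equiv> Lp_class p M"

text \<open>The p-th power of the norm, taken on functions rather than classes. Unlike the norm it
  is additive over disjoint supports.\<close>

definition Np :: "('a \<Rightarrow> complex) \<Rightarrow> real" where "Np f = (LINT x|M. cmod (f x) powr p)"

lemma LD [measurable_dest]: "f \<in> L \<Longrightarrow> f \<in> borel_measurable M"
  by (simp add: Lp_fun_def)

lemma L_integrable: "f \<in> L \<Longrightarrow> integrable M (\<lambda>x. cmod (f x) powr p)"
  by (simp add: Lp_fun_def)

lemma Np_nonneg: "0 \<le> Np f"
  by (simp add: Np_def)

lemma L_bound:
  assumes f: "f \<in> borel_measurable M" and h: "integrable M h" and le: "AE x in M. cmod (f x) powr p \<le> h x"
  shows "f \<in> L"
proof -
  have "integrable M (\<lambda>x. cmod (f x) powr p)"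
    by (rule Bochner_Integration.integrable_bound[OF h]) (use f le in auto)
  with f show ?thesis by (simp add: Lp_fun_def)
qed

lemma L_zero: "(\<lambda>x. 0) \<in> L"
  by (simp add: Lp_fun_def)

lemma L_smult: assumes "f \<in> L" shows "(\<lambda>x. c * f x) \<in> L"
proof -
  note [measurable] = LD[OF assms]
  have "(\<lambda>x. c * f x) \<in> borel_measurable M" by measurable
  then show ?thesis using L_integrable[OF assms] by (simp add: Lp_fun_def norm_mult powr_mult)
qed

lemma L_add:
  assumes f: "f \<in> L" and g: "g \<in> L" shows "(\<lambda>x. f x + g x) \<in> L"
proof (rule L_bound)
  show "(\<lambda>x. f x + g x) \<in> borel_measurable M" using f g by measurable
  show "integrable M (\<lambda>x. 2 powr p * (cmod (f x) powr p + cmod (g x) powr p))"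
    using f g L_integrable by auto
  show "AE x in M. cmod (f x + g x) powr p \<le> 2 powr p * (cmod (f x) powr p + cmod (g x) powr p)"
  proof (rule AE_I2)
    fix x
    have "cmod (f x + g x) powr p \<le> (2 * max (cmod (f x)) (cmod (g x))) powr p"
      using norm_triangle_ineq[of "f x" "g x"] p_gt_1 by (intro powr_mono2) auto
    also have "\<dots> = 2 powr p * max (cmod (f x)) (cmod (g x)) powr p" by (simp add: powr_mult)
    also have "\<dots> \<le> 2 powr p * (cmod (f x) powr p + cmod (g x) powr p)"
      by (intro mult_left_mono) (auto simp: max_def)
    finally show "cmod (f x + g x) powr p \<le> 2 powr p * (cmod (f x) powr p + cmod (g x) powr p)" .
  qed
qed

lemma L_diff: "\<lbrakk>f \<in> L; g \<in> L\<rbrakk> \<Longrightarrow> (\<lambda>x. f x - g x) \<in> L"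
  using L_add[of f "\<lambda>x. (-1) * g x"] L_smult[of g "-1"] by simp

lemma Np_cong: "\<lbrakk>f \<in> borel_measurable M; g \<in> borel_measurable M; AE x in M. f x = g x\<rbrakk> \<Longrightarrow> Np f = Np g"
  unfolding Np_def by (rule integral_cong_AE) auto

lemma Np_smult: "Np (\<lambda>x. c * f x) = cmod c powr p * Np f"
  by (simp add: Np_def norm_mult powr_mult)

lemma Np_eq_0_iff: "f \<in> L \<Longrightarrow> Np f = 0 \<longleftrightarrow> (AE x in M. f x = 0)"
  unfolding Np_def by (subst integral_nonneg_eq_0_iff_AE) (auto simp: L_integrable)

text \<open>(f + g) / (a + b) is the convex combination of f / a and g / b with weights a / (a + b)
  and b / (a + b), so convexity of t ^ p can be integrated. The normalization makes the cases of
  zero norm separate.\<close>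

lemma Minkowski:
  assumes f: "f \<in> L" and g: "g \<in> L"
  shows "Np (\<lambda>x. f x + g x) powr (1 / p) \<le> Np f powr (1 / p) + Np g powr (1 / p)"
proof -
  define a where "a = Np f powr (1 / p)"
  define b where "b = Np g powr (1 / p)"
  have ap: "a powr p = Np f" and bp: "b powr p = Np g"
    using p_gt_1 Np_nonneg by (simp_all add: a_def b_def powr_powr)
  have ab: "a \<ge> 0" "b \<ge> 0" by (simp_all add: a_def b_def)
  note [measurable] = LD[OF f] LD[OF g]
  consider "a = 0" | "b = 0" | "a > 0" "b > 0" using ab by linarith
  then have "Np (\<lambda>x. f x + g x) powr (1 / p) \<le> a + b"
  proof cases
    case 1
    then have "AE x in M. f x = 0" using ap f p_gt_1 by (simp flip: Np_eq_0_iff)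
    then have "Np (\<lambda>x. f x + g x) = Np g" by (intro Np_cong) auto
    then show ?thesis using 1 by (simp add: b_def)
  next
    case 2
    then have "AE x in M. g x = 0" using bp g p_gt_1 by (simp flip: Np_eq_0_iff)
    then have "Np (\<lambda>x. f x + g x) = Np f" by (intro Np_cong) auto
    then show ?thesis using 2 by (simp add: a_def)
  next
    case 3
    define t where "t = a / (a + b)"
    have t: "0 \<le> t" "t \<le> 1" "1 - t = b / (a + b)" using 3 by (auto simp: t_def field_simps)
    define h where "h x = (a + b) powr p * (t * (cmod (f x) powr p / a powr p) + (1 - t) * (cmod (g x) powr p / b powr p))" for x
    have h: "integrable M h" unfolding h_def using L_integrable[OF f] L_integrable[OF g] by simp
    have "cmod (f x + g x) powr p \<le> h x" for x
    proof -
      have "cmod (f x + g x) powr p \<le> (cmod (f x) + cmod (g x)) powr p"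
        using norm_triangle_ineq[of "f x" "g x"] p_gt_1 by (intro powr_mono2) auto
      also have "cmod (f x) + cmod (g x) = (a + b) * (t * (cmod (f x) / a) + (1 - t) * (cmod (g x) / b))"
        unfolding t(3) using 3 by (simp add: t_def distrib_left)
      also have "\<dots> powr p = (a + b) powr p * (t * (cmod (f x) / a) + (1 - t) * (cmod (g x) / b)) powr p"
        by (rule powr_mult)
      also have "\<dots> \<le> (a + b) powr p * (t * (cmod (f x) / a) powr p + (1 - t) * (cmod (g x) / b) powr p)"
        using t 3 p_gt_1 by (intro mult_left_mono powr_convex_combination) auto
      also have "\<dots> = h x" using 3 by (simp add: h_def powr_divide)
      finally show ?thesis .
    qed
    then have "Np (\<lambda>x. f x + g x) \<le> integral\<^sup>L M h"
      unfolding Np_def by (intro integral_mono h L_integrable[OF L_add[OF f g]])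
    also have "\<dots> = (a + b) powr p * (t * (Np f / a powr p) + (1 - t) * (Np g / b powr p))"
      unfolding h_def Np_def using L_integrable[OF f] L_integrable[OF g] by simp
    also have "\<dots> = (a + b) powr p"
      using 3 by (simp add: ap[symmetric] bp[symmetric])
    finally have "Np (\<lambda>x. f x + g x) powr (1 / p) \<le> ((a + b) powr p) powr (1 / p)"
      using p_gt_1 Np_nonneg by (intro powr_mono2) auto
    then show ?thesis using 3 p_gt_1 by (simp add: powr_powr)
  qed
  then show ?thesis by (simp add: a_def b_def)
qed

lemma cls_eq: "\<lbrakk>f \<in> borel_measurable M; AE x in M. f x = g x\<rbrakk> \<Longrightarrow> cls f = cls g"
  unfolding Lp_class_def by (intro Collect_cong conj_cong refl) (auto elim: eventually_elim2)

text \<open>\<open>Lp_rep\<close> may return any member of the class, so it is only ever compared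
  with \<open>f\<close> almost everywhere.\<close>

lemma rep: assumes "f \<in> L" shows "Lp_rep (cls f) \<in> L" "AE x in M. Lp_rep (cls f) x = f x"
proof -
  have "Lp_rep (cls f) \<in> cls f"
    unfolding Lp_rep_def by (rule someI[of _ f]) (use assms in \<open>simp add: Lp_class_def\<close>)
  then show "Lp_rep (cls f) \<in> L" "AE x in M. Lp_rep (cls f) x = f x"
    by (simp_all add: Lp_class_def)
qed

lemma Lp_carrier: "carrier (Lp p M) = cls ` L"
  by (simp add: Lp_def)

lemma cls_closed [simp, intro]: "f \<in> L \<Longrightarrow> cls f \<in> carrier (Lp p M)"
  by (simp add: Lp_carrier)

lemma Lp_zero: "\<zero>\<^bsub>Lp p M\<^esub> = cls (\<lambda>x. 0)"
  by (simp add: Lp_def)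

lemma Lp_add:
  assumes f: "f \<in> L" and g: "g \<in> L" shows "cls f \<oplus>\<^bsub>Lp p M\<^esub> cls g = cls (\<lambda>x. f x + g x)"
proof -
  note [measurable] = LD[OF rep(1)[OF f]] LD[OF rep(1)[OF g]]
  have "cls (\<lambda>x. Lp_rep (cls f) x + Lp_rep (cls g) x) = cls (\<lambda>x. f x + g x)"
    using rep(2)[OF f] rep(2)[OF g] by (intro cls_eq) (auto elim: eventually_elim2)
  then show ?thesis by (simp add: Lp_def)
qed

lemma Lp_smult:
  assumes f: "f \<in> L" shows "c \<odot>\<^bsub>Lp p M\<^esub> cls f = cls (\<lambda>x. c * f x)"
proof -
  note [measurable] = LD[OF rep(1)[OF f]]
  have "cls (\<lambda>x. c * Lp_rep (cls f) x) = cls (\<lambda>x. c * f x)"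
    using rep(2)[OF f] by (intro cls_eq) (auto elim: eventually_mono)
  then show ?thesis by (simp add: Lp_def)
qed

lemma Lp_nrm: assumes f: "f \<in> L" shows "nrm (Lp p M) (cls f) = Np f powr (1 / p)"
proof -
  have "nrm (Lp p M) (cls f) = Np (Lp_rep (cls f)) powr (1 / p)" by (simp add: Lp_def Np_def)
  also have "Np (Lp_rep (cls f)) = Np f"
    using rep[OF f] f by (intro Np_cong) auto
  finally show ?thesis .
qed

lemma Lp_nrm_powr: "f \<in> L \<Longrightarrow> nrm (Lp p M) (cls f) powr p = Np f"
  using p_gt_1 Np_nonneg by (simp add: Lp_nrm powr_powr)

lemma Np_eq_0_imp: "\<lbrakk>f \<in> L; Np f = 0\<rbrakk> \<Longrightarrow> cls f = cls (\<lambda>x. 0)"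
  by (rule cls_eq) (auto simp: Np_eq_0_iff)

sublocale Lp: complex_normed_space "Lp p M"
proof (rule complex_normed_spaceI)
  fix F G H and a b
  show "\<zero>\<^bsub>Lp p M\<^esub> \<in> carrier (Lp p M)" using L_zero by (simp add: Lp_zero)
  assume "F \<in> carrier (Lp p M)"
  then obtain f where f: "f \<in> L" "F = cls f" by (auto simp: Lp_carrier)
  show "a \<odot>\<^bsub>Lp p M\<^esub> F \<in> carrier (Lp p M)" "\<zero>\<^bsub>Lp p M\<^esub> \<oplus>\<^bsub>Lp p M\<^esub> F = F" "0 \<odot>\<^bsub>Lp p M\<^esub> F = \<zero>\<^bsub>Lp p M\<^esub>"
    "(a + b) \<odot>\<^bsub>Lp p M\<^esub> F = a \<odot>\<^bsub>Lp p M\<^esub> F \<oplus>\<^bsub>Lp p M\<^esub> b \<odot>\<^bsub>Lp p M\<^esub> F" "(a * b) \<odot>\<^bsub>Lp p M\<^esub> F = a \<odot>\<^bsub>Lp p M\<^esub> (b \<odot>\<^bsub>Lp p M\<^esub> F)"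
    "1 \<odot>\<^bsub>Lp p M\<^esub> F = F" "0 \<le> nrm (Lp p M) F"
    using f L_zero L_smult by (simp_all add: Lp_zero Lp_add Lp_smult Lp_nrm algebra_simps)
  show "F = \<zero>\<^bsub>Lp p M\<^esub>" if "nrm (Lp p M) F = 0"
    using that f p_gt_1 Np_nonneg[of f] by (simp add: Lp_zero Lp_nrm Np_eq_0_imp)
  show "nrm (Lp p M) (a \<odot>\<^bsub>Lp p M\<^esub> F) = cmod a * nrm (Lp p M) F"
    using f L_smult p_gt_1 Np_nonneg by (simp add: Lp_smult Lp_nrm Np_smult powr_mult powr_powr)
  assume "G \<in> carrier (Lp p M)"
  then obtain g where g: "g \<in> L" "G = cls g" by (auto simp: Lp_carrier)
  show "F \<oplus>\<^bsub>Lp p M\<^esub> G \<in> carrier (Lp p M)" "F \<oplus>\<^bsub>Lp p M\<^esub> G = G \<oplus>\<^bsub>Lp p M\<^esub> F"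
    "a \<odot>\<^bsub>Lp p M\<^esub> (F \<oplus>\<^bsub>Lp p M\<^esub> G) = a \<odot>\<^bsub>Lp p M\<^esub> F \<oplus>\<^bsub>Lp p M\<^esub> a \<odot>\<^bsub>Lp p M\<^esub> G"
    "nrm (Lp p M) (F \<oplus>\<^bsub>Lp p M\<^esub> G) \<le> nrm (Lp p M) F + nrm (Lp p M) G"
    using f g L_add L_smult Minkowski by (simp_all add: Lp_add Lp_smult Lp_nrm algebra_simps)
  assume "H \<in> carrier (Lp p M)"
  then obtain h where h: "h \<in> L" "H = cls h" by (auto simp: Lp_carrier)
  show "F \<oplus>\<^bsub>Lp p M\<^esub> G \<oplus>\<^bsub>Lp p M\<^esub> H = F \<oplus>\<^bsub>Lp p M\<^esub> (G \<oplus>\<^bsub>Lp p M\<^esub> H)"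
    using f g h L_add by (simp add: Lp_add algebra_simps)
qed

lemma Lp_diff: "\<lbrakk>f \<in> L; g \<in> L\<rbrakk> \<Longrightarrow> cls f \<ominus>\<^bsub>Lp p M\<^esub> cls g = cls (\<lambda>x. f x - g x)"
  using Lp_add[of f "\<lambda>x. (-1) * g x"] L_smult[of g "-1"] by (simp add: Lp.diff_smult Lp_smult)

text \<open>Fatou's lemma for the p-th powers of \<open>f - \<sigma> k\<close>. It yields both the
  membership of the difference and the bound on its norm.\<close>

lemma L_limit:
  assumes f: "f \<in> L" and \<sigma>: "\<And>k. \<sigma> k \<in> L" and g: "g \<in> borel_measurable M"
    and lim: "AE x in M. (\<lambda>k. \<sigma> k x) \<longlonglongrightarrow> g x"
    and bound: "\<forall>\<^sub>F k in sequentially. Np (\<lambda>x. f x - \<sigma> k x) \<le> c" and c: "0 \<le> c"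
  shows "(\<lambda>x. f x - g x) \<in> L" "Np (\<lambda>x. f x - g x) \<le> c"
proof -
  note [measurable] = LD[OF f] LD[OF \<sigma>] g
  let ?u = "\<lambda>k x. ennreal (cmod (f x - \<sigma> k x) powr p)"
  have "AE x in M. ennreal (cmod (f x - g x) powr p) = liminf (\<lambda>k. ?u k x)"
    using lim
  proof eventually_elim
    case (elim x)
    have "(\<lambda>k. cmod (f x - \<sigma> k x) powr p) \<longlonglongrightarrow> cmod (f x - g x) powr p"
      using p_gt_1 by (intro tendsto_powr' tendsto_intros elim) auto
    then have "(\<lambda>k. ?u k x) \<longlonglongrightarrow> ennreal (cmod (f x - g x) powr p)"
      by (rule tendsto_ennrealI)
    then show ?case by (rule lim_imp_Liminf[OF sequentially_bot, symmetric])
  qed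
  then have "(\<integral>\<^sup>+x. ennreal (cmod (f x - g x) powr p) \<partial>M) = (\<integral>\<^sup>+x. liminf (\<lambda>k. ?u k x) \<partial>M)"
    by (rule nn_integral_cong_AE)
  also have "\<dots> \<le> liminf (\<lambda>k. \<integral>\<^sup>+x. ?u k x \<partial>M)"
    by (rule nn_integral_liminf) measurable
  also have "\<dots> \<le> ennreal c"
  proof (rule Liminf_le[OF sequentially_bot])
    have "(\<integral>\<^sup>+x. ?u k x \<partial>M) = ennreal (Np (\<lambda>x. f x - \<sigma> k x))" for k
      unfolding Np_def by (rule nn_integral_eq_integral[OF L_integrable[OF L_diff[OF f \<sigma>]]]) simp
    then show "\<forall>\<^sub>F k in sequentially. (\<integral>\<^sup>+x. ?u k x \<partial>M) \<le> ennreal c"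
      using bound by (auto elim!: eventually_mono intro!: ennreal_leI)
  qed
  finally have le: "(\<integral>\<^sup>+x. ennreal (cmod (f x - g x) powr p) \<partial>M) \<le> ennreal c" .
  then have "integrable M (\<lambda>x. cmod (f x - g x) powr p)"
    by (intro integrableI_nonneg) (auto simp: ennreal_less_top intro: le_less_trans)
  then show "(\<lambda>x. f x - g x) \<in> L" by (simp add: Lp_fun_def)
  show "Np (\<lambda>x. f x - g x) \<le> c"
    unfolding Np_def by (rule integral_real_bounded[OF c le])
qed

text \<open>Riesz-Fischer: a fast subsequence converges almost everywhere, and
  \<open>L_limit\<close> turns its limit into a limit in norm of the whole sequence.\<close>

lemma Lp_complete: "Lp.metric.mcomplete"
  unfolding Lp.mcomplete_iff
proof (intro allI impI, elim conjE)
  fix \<sigma> :: "nat \<Rightarrow> ('a \<Rightarrow> complex) set"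
  assume "range \<sigma> \<subseteq> carrier (Lp p M)"
  then have "\<exists>f\<in>L. \<sigma> n = cls f" for n by (auto simp: Lp_carrier)
  then obtain f where f: "\<And>n. f n \<in> L" and \<sigma>: "\<And>n. \<sigma> n = cls (f n)" by metis
  note [measurable] = LD[OF f]
  define d where "d m n = nrm (Lp p M) (\<sigma> m \<ominus>\<^bsub>Lp p M\<^esub> \<sigma> n)" for m n
  have d: "Np (\<lambda>x. f m x - f n x) = d m n powr p" "0 \<le> d m n" for m n
    using f L_diff[OF f f, of m n] by (simp_all add: d_def \<sigma> Lp_diff Lp_nrm_powr Lp.nrm_nonneg)
  assume "\<forall>\<epsilon>>0. \<exists>N. \<forall>m\<ge>N. \<forall>n\<ge>N. nrm (Lp p M) (\<sigma> m \<ominus>\<^bsub>Lp p M\<^esub> \<sigma> n) < \<epsilon>"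
  then have cauchy: "\<exists>N. \<forall>m\<ge>N. \<forall>n\<ge>N. d m n < \<epsilon>" if "\<epsilon> > 0" for \<epsilon> using that by (simp add: d_def)
  \<comment> \<open>The rate 4 ^ -k leaves room for a weight 2 ^ k: the p-th powers of 2 ^ k |D k|
    have summable integrals, so almost everywhere they tend to 0 and |D k| is eventually at most 2 ^
    -k.\<close>
  have "\<exists>N. \<forall>m\<ge>N. \<forall>n\<ge>N. d m n < (1 / 4) ^ k" for k by (rule cauchy) simp
  then obtain N where N: "\<And>k m n. m \<ge> N k \<Longrightarrow> n \<ge> N k \<Longrightarrow> d m n < (1 / 4) ^ k" by metis
  \<comment> \<open>Summation makes \<open>r\<close> monotone and at least \<open>N k\<close>; the
    extra \<open>k\<close> makes it tend to infinity.\<close>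
  define r where "r k = (\<Sum>i\<le>k. N i) + k" for k
  have r: "N k \<le> r k" "k \<le> r k" "r k \<le> r (Suc k)" for k
    using member_le_sum[of k "{..k}" N] by (auto simp: r_def)
  define D where "D k x = f (r (Suc k)) x - f (r k) x" for k x
  have D_meas [measurable]: "D k \<in> borel_measurable M" for k unfolding D_def by measurable
  have "(\<integral>\<^sup>+x. ennreal ((2 ^ k * cmod (D k x)) powr p) \<partial>M) \<le> ennreal ((1 / 2) ^ k)" for k
  proof -
    have int: "integrable M (\<lambda>x. cmod (D k x) powr p)"
      unfolding D_def by (rule L_integrable[OF L_diff[OF f f]])
    have "(\<integral>\<^sup>+x. ennreal ((2 ^ k * cmod (D k x)) powr p) \<partial>M) = (\<integral>\<^sup>+x. ennreal ((2 ^ k) powr p * cmod (D k x) powr p) \<partial>M)"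
      by (simp add: powr_mult)
    also have "\<dots> = ennreal ((2 ^ k) powr p * Np (D k))"
      unfolding Np_def using int by (subst nn_integral_eq_integral) auto
    also have "(2 ^ k) powr p * Np (D k) \<le> (1 / 2) ^ k"
    proof -
      have "(2 ^ k) powr p * Np (D k) = (2 ^ k * d (r (Suc k)) (r k)) powr p"
        using d[of "r (Suc k)" "r k"] by (simp add: D_def[abs_def] powr_mult)
      also have "\<dots> \<le> (2 ^ k * (1 / 4) ^ k) powr p"
        using N[of k "r (Suc k)" "r k"] r[of k] d(2)[of "r (Suc k)" "r k"] p_gt_1
        by (intro powr_mono2 mult_left_mono) auto
      also have "2 ^ k * (1 / 4) ^ k = ((1 / 2) ^ k :: real)"
        by (simp flip: power_mult_distrib)
      also have "((1 / 2) ^ k :: real) powr p \<le> ((1 / 2) ^ k) powr 1"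
        using p_gt_1 by (intro powr_mono') (auto simp: power_le_one)
      finally show ?thesis by simp
    qed
    finally show ?thesis by (simp add: ennreal_leI)
  qed
  then have "(\<Sum>k. \<integral>\<^sup>+x. ennreal ((2 ^ k * cmod (D k x)) powr p) \<partial>M) \<le> (\<Sum>k. ennreal ((1 / 2) ^ k))"
    by (intro suminf_le) auto
  also have "\<dots> = ennreal (\<Sum>k. (1 / 2) ^ k)"
    by (rule suminf_ennreal2) (auto intro: summable_geometric)
  finally have "(\<integral>\<^sup>+x. (\<Sum>k. ennreal ((2 ^ k * cmod (D k x)) powr p)) \<partial>M) \<le> ennreal (\<Sum>k. (1 / 2) ^ k)"
    by (subst nn_integral_suminf) auto
  then have "(\<integral>\<^sup>+x. (\<Sum>k. ennreal ((2 ^ k * cmod (D k x)) powr p)) \<partial>M) \<noteq> \<infinity>"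
    by (auto simp: top_unique)
  then have "AE x in M. (\<Sum>k. ennreal ((2 ^ k * cmod (D k x)) powr p)) \<noteq> \<infinity>"
    by (intro nn_integral_PInf_AE) auto
  then have conv: "AE x in M. convergent (\<lambda>k. f (r k) x)"
  proof eventually_elim
    case (elim x)
    then have "summable (\<lambda>k. (2 ^ k * cmod (D k x)) powr p)"
      by (intro summable_suminf_not_top) auto
    then have "(\<lambda>k. (2 ^ k * cmod (D k x)) powr p) \<longlonglongrightarrow> 0" by (rule summable_LIMSEQ_zero)
    then have "\<forall>\<^sub>F k in sequentially. (2 ^ k * cmod (D k x)) powr p < 1"
      by (rule order_tendstoD) simp
    then have "\<forall>\<^sub>F k in sequentially. norm (D k x) \<le> (1 / 2) ^ k"
    proof eventually_elim
      case (elim k)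
      then have "2 ^ k * cmod (D k x) < 1"
        using ge_one_powr_ge_zero[of "2 ^ k * cmod (D k x)" p] p_gt_1 by linarith
      then show ?case by (simp add: field_simps power_divide)
    qed
    then have "summable (\<lambda>k. D k x)"
      by (rule summable_comparison_test_ev) (rule summable_geometric, simp)
    then have "convergent (\<lambda>n. \<Sum>k<n. D k x)" by (simp add: summable_iff_convergent)
    moreover have "(\<Sum>k<n. D k x) = f (r n) x - f (r 0) x" for n
      unfolding D_def by (rule sum_lessThan_telescope)
    ultimately have "convergent (\<lambda>n. (f (r n) x - f (r 0) x) + f (r 0) x)"
      by (intro convergent_add convergent_const) simp
    then show ?case by simp
  qed
  define g where "g x = lim (\<lambda>k. f (r k) x)" for x
  have g [measurable]: "g \<in> borel_measurable M" unfolding g_def by measurable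
  have lim: "AE x in M. (\<lambda>k. f (r k) x) \<longlonglongrightarrow> g x"
    using conv by eventually_elim (simp add: g_def convergent_LIMSEQ_iff)
  have close: "(\<lambda>x. f n x - g x) \<in> L \<and> Np (\<lambda>x. f n x - g x) \<le> \<epsilon> powr p"
    if K: "\<And>m n. m \<ge> K \<Longrightarrow> n \<ge> K \<Longrightarrow> d m n < \<epsilon>" and n: "n \<ge> K" for n K \<epsilon>
  proof -
    have "\<forall>\<^sub>F k in sequentially. Np (\<lambda>x. f n x - f (r k) x) \<le> \<epsilon> powr p"
      using eventually_ge_at_top[of K]
    proof eventually_elim
      case (elim k)
      then have "r k \<ge> K" using r(2)[of k] by linarith
      then show ?case unfolding d(1) using K[OF n] d(2) p_gt_1 by (intro powr_mono2) (auto intro: less_imp_le)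
    qed
    then show ?thesis using L_limit[OF f f g lim] by simp
  qed
  have g_L: "g \<in> L"
  proof -
    obtain K where K: "\<And>m n. m \<ge> K \<Longrightarrow> n \<ge> K \<Longrightarrow> d m n < 1" using cauchy[of 1] by auto
    then have "(\<lambda>x. f K x - g x) \<in> L" using close[OF K order_refl] by blast
    then have "(\<lambda>x. f K x - (f K x - g x)) \<in> L" by (rule L_diff[OF f])
    then show ?thesis by simp
  qed
  have "(\<lambda>n. nrm (Lp p M) (\<sigma> n \<ominus>\<^bsub>Lp p M\<^esub> cls g)) \<longlonglongrightarrow> 0"
  proof (rule LIMSEQ_I)
    fix \<epsilon> :: real assume \<epsilon>: "\<epsilon> > 0"
    then obtain K where K: "\<And>m n. m \<ge> K \<Longrightarrow> n \<ge> K \<Longrightarrow> d m n < \<epsilon> / 2" using cauchy[of "\<epsilon> / 2"] by auto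
    have "norm (nrm (Lp p M) (\<sigma> n \<ominus>\<^bsub>Lp p M\<^esub> cls g) - 0) < \<epsilon>" if n: "n \<ge> K" for n
    proof -
      have "nrm (Lp p M) (\<sigma> n \<ominus>\<^bsub>Lp p M\<^esub> cls g) = Np (\<lambda>x. f n x - g x) powr (1 / p)"
        using f g_L L_diff by (simp add: \<sigma> Lp_diff Lp_nrm)
      also have "\<dots> \<le> ((\<epsilon> / 2) powr p) powr (1 / p)"
        using close[OF K n] p_gt_1 Np_nonneg by (intro powr_mono2) auto
      also have "\<dots> = \<epsilon> / 2" using \<epsilon> p_gt_1 by (simp add: powr_powr)
      finally show ?thesis
        using \<epsilon> Lp.nrm_nonneg[of "\<sigma> n \<ominus>\<^bsub>Lp p M\<^esub> cls g"] f g_L by (simp add: \<sigma>)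
    qed
    then show "\<exists>no. \<forall>n\<ge>no. norm (nrm (Lp p M) (\<sigma> n \<ominus>\<^bsub>Lp p M\<^esub> cls g) - 0) < \<epsilon>" by blast
  qed
  with g_L show "\<exists>x\<in>carrier (Lp p M). (\<lambda>n. nrm (Lp p M) (\<sigma> n \<ominus>\<^bsub>Lp p M\<^esub> x)) \<longlonglongrightarrow> 0" by blast
qed

sublocale Lp: complex_banach_space "Lp p M"
  by unfold_locales (rule Lp_complete)

text \<open>The second factor is always of the form |u| ^ (p - 1) with \<open>u\<close> in L^p,
  whose norm in the conjugate exponent is \<open>Np u powr (1 - 1 / p)\<close>. The bound is Young's
  inequality for f / a and u / b, integrated.\<close>

lemma Hoelder:
  assumes f: "f \<in> L" and u: "u \<in> L"
  shows "integrable M (\<lambda>x. cmod (f x) * cmod (u x) powr (p - 1))" (is "integrable M ?h")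
    and "(LINT x|M. cmod (f x) * cmod (u x) powr (p - 1)) \<le> Np f powr (1 / p) * Np u powr (1 - 1 / p)"
proof -
  note [measurable] = LD[OF f] LD[OF u]
  have int: "integrable M (\<lambda>x. cmod (f x) powr p / p + (1 - 1 / p) * cmod (u x) powr p)"
    using L_integrable[OF f] L_integrable[OF u] by simp
  show h: "integrable M ?h"
    by (rule Bochner_Integration.integrable_bound[OF int])
      (use Young_powr[OF p_gt_1] in \<open>auto intro!: order_trans[OF _ abs_ge_self]\<close>)
  define a where "a = Np f powr (1 / p)"
  define b where "b = Np u powr (1 / p)"
  have ap: "a powr p = Np f" and bp: "b powr p = Np u"
    using p_gt_1 Np_nonneg by (simp_all add: a_def b_def powr_powr)
  have b1: "Np u powr (1 - 1 / p) = b powr (p - 1)"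
    using p_gt_1 by (simp add: b_def powr_powr diff_divide_distrib)
  have ab: "a \<ge> 0" "b \<ge> 0" by (simp_all add: a_def b_def)
  consider "a = 0" | "b = 0" | "a > 0" "b > 0" using ab by linarith
  then have "integral\<^sup>L M ?h \<le> a * b powr (p - 1)"
  proof cases
    case 1
    then have "AE x in M. f x = 0" using ap f p_gt_1 by (simp flip: Np_eq_0_iff)
    then have "integral\<^sup>L M ?h = (LINT x|M. 0)" by (intro integral_cong_AE) auto
    then show ?thesis using 1 by simp
  next
    case 2
    then have "AE x in M. u x = 0" using bp u p_gt_1 by (simp flip: Np_eq_0_iff)
    then have "integral\<^sup>L M ?h = (LINT x|M. 0)" by (intro integral_cong_AE) auto
    then show ?thesis using 2 by simp
  next
    case 3
    define c where "c = a * b powr (p - 1)"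
    have c: "c > 0" using 3 by (simp add: c_def)
    have le: "?h x \<le> c * (cmod (f x) powr p / Np f / p + (1 - 1 / p) * (cmod (u x) powr p / Np u))" for x
    proof -
      have "?h x = c * ((cmod (f x) / a) * (cmod (u x) / b) powr (p - 1))"
        using 3 by (simp add: c_def powr_divide)
      also have "\<dots> \<le> c * ((cmod (f x) / a) powr p / p + (1 - 1 / p) * (cmod (u x) / b) powr p)"
        using c 3 p_gt_1 by (intro mult_left_mono Young_powr) auto
      finally show ?thesis using 3 by (simp add: powr_divide ap bp)
    qed
    have "integral\<^sup>L M ?h \<le> (LINT x|M. c * (cmod (f x) powr p / Np f / p + (1 - 1 / p) * (cmod (u x) powr p / Np u)))"
      using L_integrable[OF f] L_integrable[OF u] by (intro integral_mono h le) simp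
    also have "\<dots> = c * (Np f / Np f / p + (1 - 1 / p) * (Np u / Np u))"
      using L_integrable[OF f] L_integrable[OF u] by (simp add: Np_def)
    also have "\<dots> = c"
      using 3 p_gt_1 by (simp add: ap[symmetric] bp[symmetric])
    finally show ?thesis by (simp add: c_def)
  qed
  then show "integral\<^sup>L M ?h \<le> Np f powr (1 / p) * Np u powr (1 - 1 / p)"
    by (simp add: a_def b1)
qed

text \<open>The unnormalized duality map of L^p: integration against \<open>dual_fun u\<close> is a
  functional that attains its norm in the direction of \<open>u\<close>. Where \<open>u\<close>
  vanishes the value is 0, also for p < 2.\<close>

definition dual_fun :: "('a \<Rightarrow> complex) \<Rightarrow> 'a \<Rightarrow> complex" where
  "dual_fun u x = cnj (u x) * complex_of_real (cmod (u x) powr (p - 2))"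

lemma dual_fun_measurable [measurable]:
  assumes [measurable]: "u \<in> borel_measurable M" shows "dual_fun u \<in> borel_measurable M"
proof -
  have "(\<lambda>x. cmod (u x) powr (p - 2)) \<in> borel_measurable M" by measurable
  then have "(\<lambda>x. complex_of_real (cmod (u x) powr (p - 2))) \<in> borel_measurable M"
    by (rule borel_measurable_continuous_on[rotated]) (intro continuous_intros)
  moreover have "(\<lambda>x. cnj (u x)) \<in> borel_measurable M"
    by (rule borel_measurable_continuous_on[OF _ assms]) (intro continuous_intros)
  ultimately show ?thesis unfolding dual_fun_def[abs_def] by (rule borel_measurable_times[rotated])
qed

lemma cmod_dual_fun: "cmod (dual_fun u x) = cmod (u x) powr (p - 1)"
  using powr_mult_base[of "cmod (u x)" "p - 2"] by (simp add: dual_fun_def norm_mult)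

lemma mult_dual_fun: "u x * dual_fun u x = complex_of_real (cmod (u x) powr p)"
proof -
  have "u x * dual_fun u x = complex_of_real (cmod (u x) * (cmod (u x) * cmod (u x) powr (p - 2)))"
    by (simp add: dual_fun_def complex_norm_square[symmetric] mult.assoc[symmetric] flip: power2_eq_square)
  also have "cmod (u x) * (cmod (u x) * cmod (u x) powr (p - 2)) = cmod (u x) powr p"
    using powr_mult_base[of "cmod (u x)" "p - 2"] powr_mult_base[of "cmod (u x)" "p - 1"] by simp
  finally show ?thesis .
qed

definition dual_op :: "('a \<Rightarrow> complex) \<Rightarrow> ('a \<Rightarrow> complex) set \<Rightarrow> complex" where
  "dual_op u = (\<lambda>F\<in>carrier (Lp p M). LINT x|M. Lp_rep F x * dual_fun u x)"

lemma dual_integrable: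
  assumes "f \<in> L" "u \<in> L" shows "integrable M (\<lambda>x. f x * dual_fun u x)"
proof -
  note [measurable] = LD[OF assms(1)] LD[OF assms(2)]
  show ?thesis
    by (rule Bochner_Integration.integrable_bound[OF Hoelder(1)[OF assms]])
      (auto simp: norm_mult cmod_dual_fun)
qed

lemma dual_op_apply:
  assumes f: "f \<in> L" and u: "u \<in> L"
  shows "dual_op u (cls f) = (LINT x|M. f x * dual_fun u x)"
proof -
  note [measurable] = LD[OF f] LD[OF u] LD[OF rep(1)[OF f]]
  have "(LINT x|M. Lp_rep (cls f) x * dual_fun u x) = (LINT x|M. f x * dual_fun u x)"
    using rep(2)[OF f] by (intro integral_cong_AE) (auto elim: eventually_mono)
  then show ?thesis using f by (simp add: dual_op_def)
qed

lemma dual_op_self: "u \<in> L \<Longrightarrow> dual_op u (cls u) = complex_of_real (Np u)"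
  by (simp add: dual_op_apply mult_dual_fun Np_def)

lemma dual_op_bound:
  assumes u: "u \<in> L" and F: "F \<in> carrier (Lp p M)"
  shows "cmod (dual_op u F) \<le> Np u powr (1 - 1 / p) * nrm (Lp p M) F"
proof -
  obtain f where f: "f \<in> L" "F = cls f" using F by (auto simp: Lp_carrier)
  have "cmod (dual_op u F) \<le> (LINT x|M. cmod (f x * dual_fun u x))"
    using f u by (simp add: dual_op_apply)
  also have "\<dots> \<le> Np f powr (1 / p) * Np u powr (1 - 1 / p)"
    using Hoelder(2)[OF f(1) u] by (simp add: norm_mult cmod_dual_fun)
  finally show ?thesis using f by (simp add: Lp_nrm mult.commute)
qed

lemma dual_op_bounded:
  assumes u: "u \<in> L"
  shows "dual_op u \<in> bounded_ops (Lp p M) complex_line"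
    and "op_nrm (Lp p M) complex_line (dual_op u) \<le> Np u powr (1 - 1 / p)"
proof -
  interpret dp: normed_space_pair "Lp p M" complex_line by (rule Lp.dual_pair)
  have le: "nrm complex_line (dual_op u F) \<le> Np u powr (1 - 1 / p) * nrm (Lp p M) F" if "F \<in> carrier (Lp p M)" for F
    using dual_op_bound[OF u that] by simp
  show "dual_op u \<in> bounded_ops (Lp p M) complex_line"
  proof (rule bounded_opsI[OF _ _ _ _ le])
    fix F G c assume "F \<in> carrier (Lp p M)"
    then obtain f where f: "f \<in> L" "F = cls f" by (auto simp: Lp_carrier)
    show "dual_op u (c \<odot>\<^bsub>Lp p M\<^esub> F) = c \<odot>\<^bsub>complex_line\<^esub> dual_op u F"
      using f u L_smult dual_integrable by (simp add: Lp_smult dual_op_apply mult.assoc)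
    assume "G \<in> carrier (Lp p M)"
    then obtain g where g: "g \<in> L" "G = cls g" by (auto simp: Lp_carrier)
    show "dual_op u (F \<oplus>\<^bsub>Lp p M\<^esub> G) = dual_op u F \<oplus>\<^bsub>complex_line\<^esub> dual_op u G"
      using f g u L_add dual_integrable by (simp add: Lp_add dual_op_apply distrib_right)
  qed (auto simp: dual_op_def extensional_def)
  show "op_nrm (Lp p M) complex_line (dual_op u) \<le> Np u powr (1 - 1 / p)"
    by (rule dp.op_nrm_le[OF le]) auto
qed

text \<open>The rank-one projection onto the line through \<open>u\<close> along the kernel of
  \<open>dual_op u\<close> is a contraction, because Hoelder's inequality is an equality at
  \<open>u\<close>.\<close>

sublocale Lp: norming_space "Lp p M"
proof unfold_locales
  fix U assume U: "U \<in> carrier (Lp p M)"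
  then obtain u where u: "u \<in> L" "U = cls u" by (auto simp: Lp_carrier)
  show "\<exists>c. compact_op (Lp p M) c \<and> op_nrm (Lp p M) (Lp p M) c \<le> 1 \<and> c U = U"
  proof (cases "Np u = 0")
    case True
    then have "U = \<zero>\<^bsub>Lp p M\<^esub>" using u by (simp add: Lp_zero Np_eq_0_imp)
    moreover have "op_nrm (Lp p M) (Lp p M) (\<lambda>x\<in>carrier (Lp p M). \<zero>\<^bsub>Lp p M\<^esub>) \<le> 1"
      by (rule Lp.ops.op_nrm_le) (auto simp: Lp.nrm_nonneg)
    ultimately show ?thesis using Lp.compact_op_zero U by (intro exI[of _ "\<lambda>x\<in>carrier (Lp p M). \<zero>\<^bsub>Lp p M\<^esub>"]) simp
  next
    case False
    then have pos: "Np u > 0" using Np_nonneg[of u] by simp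
    define v where "v = complex_of_real (inverse (Np u)) \<odot>\<^bsub>Lp p M\<^esub> U"
    have v: "v \<in> carrier (Lp p M)" using U by (simp add: v_def)
    have nv: "nrm (Lp p M) v = inverse (Np u) * Np u powr (1 / p)"
      using U u pos by (simp add: v_def Lp.nrm_smult Lp_nrm norm_inverse)
    note c = Lp.compact_op_rank_one[OF dual_op_bounded(1)[OF u(1)] v]
    have "op_nrm (Lp p M) complex_line (dual_op u) * nrm (Lp p M) v
        \<le> Np u powr (1 - 1 / p) * (inverse (Np u) * Np u powr (1 / p))"
      unfolding nv using dual_op_bounded(2)[OF u(1)] pos by (intro mult_right_mono) auto
    also have "\<dots> = inverse (Np u) * (Np u powr (1 - 1 / p) * Np u powr (1 / p))" by simp
    also have "\<dots> = 1" using pos by (simp flip: powr_add)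
    finally have "op_nrm (Lp p M) (Lp p M) (\<lambda>x\<in>carrier (Lp p M). dual_op u x \<odot>\<^bsub>Lp p M\<^esub> v) \<le> 1"
      using c(2) by linarith
    moreover have "dual_op u U \<odot>\<^bsub>Lp p M\<^esub> v = U"
      using u U pos by (simp add: dual_op_self v_def)
    ultimately show ?thesis using c(1) U by auto
  qed
qed

end

section \<open>Atoms\<close>

text \<open>If \<open>A\<close> met every piece of the decomposition in a null set, the sum formula
  would give it measure 0. The partition may be uncountable, so countable additivity alone would not
  do.\<close>

lemma decomposable_positive_part:
  assumes "decomposable M" "A \<in> sets M" "emeasure M A > 0"
  obtains B where "B \<in> sets M" "emeasure M B < \<infinity>" "emeasure M (A \<inter> B) > 0"
proof -
  obtain P where "\<forall>B\<in>P. B \<in> sets M \<and> emeasure M B < \<infinity>"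
    "\<forall>F\<in>sets M. emeasure M F = (\<Sum>\<^sub>\<infinity>B\<in>P. emeasure M (F \<inter> B))"
    using assms(1) unfolding decomposable_def by (elim exE conjE)
  then have P: "\<And>B. B \<in> P \<Longrightarrow> B \<in> sets M \<and> emeasure M B < \<infinity>"
    "\<And>F. F \<in> sets M \<Longrightarrow> emeasure M F = (\<Sum>\<^sub>\<infinity>B\<in>P. emeasure M (F \<inter> B))" by blast+
  have "\<exists>B\<in>P. emeasure M (A \<inter> B) > 0"
  proof (rule ccontr)
    assume "\<not> ?thesis"
    then have "(\<Sum>\<^sub>\<infinity>B\<in>P. emeasure M (A \<inter> B)) = 0"
      by (intro infsum_0) (simp add: zero_less_iff_neq_zero)
    with P(2)[OF assms(2)] assms(3) show False by simp
  qed
  with P(1) that show thesis by blast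
qed

text \<open>The atom meets some piece of finite measure in positive measure, and what lies outside
  that piece is then null.\<close>

lemma measure_atom_finite:
  assumes "decomposable M" "measure_atom M A" shows "emeasure M A < \<infinity>"
proof -
  have A: "A \<in> sets M" "emeasure M A > 0" using assms(2) by (auto simp: measure_atom_def)
  obtain B where B: "B \<in> sets M" "emeasure M B < \<infinity>" "emeasure M (A \<inter> B) > 0"
    using decomposable_positive_part[OF assms(1) A] by blast
  then have "emeasure M (A - A \<inter> B) = 0"
    using assms(2) A unfolding measure_atom_def by (metis Int_lower1 less_irrefl sets.Int)
  then have "emeasure M A = emeasure M (A \<inter> B)"
    using A B emeasure_Un_null_set[of "A \<inter> B" M "A - A \<inter> B"] by (simp add: null_sets_def Un_Diff_cancel Un_absorb1)
  also have "\<dots> \<le> emeasure M B" using B by (intro emeasure_mono) auto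
  finally show ?thesis using B by simp
qed

text \<open>Let \<open>c\<close> be the mean of \<open>g\<close> on \<open>A\<close>. The part of
  \<open>A\<close> where g > c is null or almost all of \<open>A\<close>; the latter contradicts
  that g - c has integral 0. Hence c - g is nonnegative on \<open>A\<close> with integral 0.\<close>

lemma atom_AE_const_real:
  fixes g :: "'a \<Rightarrow> real"
  assumes A: "measure_atom M A" "emeasure M A < \<infinity>"
    and g: "g \<in> borel_measurable M" "integrable M (\<lambda>x. indicator A x * g x)"
  shows "\<exists>c. AE x in M. x \<in> A \<longrightarrow> g x = c"
proof -
  have As [measurable]: "A \<in> sets M" and pos: "emeasure M A > 0" using A by (auto simp: measure_atom_def)
  note [measurable] = g(1)
  have mA: "measure M A > 0" using A pos by (simp add: measure_def enn2real_positive_iff)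
  define c where "c = (LINT x|M. indicator A x * g x) / measure M A"
  have intA: "integrable M (indicator A :: 'a \<Rightarrow> real)" using A by (simp add: As)
  have zero: "(LINT x|M. indicator A x * (g x - c)) = 0"
    using g(2) intA mA A by (simp add: right_diff_distrib c_def As)
  have int: "integrable M (\<lambda>x. indicator A x * (g x - c))"
    using g(2) intA by (simp add: right_diff_distrib)
  define B where "B = {x \<in> space M. x \<in> A \<and> g x > c}"
  have B [measurable]: "B \<in> sets M" unfolding B_def by measurable
  have "B \<subseteq> A" by (auto simp: B_def)
  then consider "emeasure M B = 0" | "emeasure M (A - B) = 0"
    using A B unfolding measure_atom_def by blast
  then have le: "AE x in M. x \<in> A \<longrightarrow> g x \<le> c"
  proof cases
    case 1
    then have "AE x in M. x \<notin> B" by (intro AE_not_in) (simp add: null_sets_def)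
    then show ?thesis using AE_space by eventually_elim (auto simp: B_def)
  next
    case 2
    then have "AE x in M. x \<notin> A - B" by (intro AE_not_in) (simp add: null_sets_def)
    then have gt: "AE x in M. x \<in> A \<longrightarrow> g x > c" by eventually_elim (auto simp: B_def)
    then have "AE x in M. 0 \<le> indicator A x * (g x - c)"
      by eventually_elim (auto simp: indicator_def)
    then have "AE x in M. indicator A x * (g x - c) = 0"
      using integral_nonneg_eq_0_iff_AE[OF int] zero by simp
    with gt have "AE x in M. x \<notin> A" by eventually_elim (auto simp: indicator_def)
    then show ?thesis by eventually_elim auto
  qed
  then have "AE x in M. 0 \<le> - (indicator A x * (g x - c))"
    by eventually_elim (auto simp: indicator_def)
  then have "AE x in M. - (indicator A x * (g x - c)) = 0"
    using integral_nonneg_eq_0_iff_AE[of M "\<lambda>x. - (indicator A x * (g x - c))"] int zero by simp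
  then show ?thesis by (intro exI[of _ c]) (auto elim!: eventually_mono simp: indicator_def)
qed

section \<open>Restriction to atoms as a decomposition of L^p\<close>

context Lp_space
begin

definition ind :: "'a set \<Rightarrow> ('a \<Rightarrow> complex) \<Rightarrow> 'a \<Rightarrow> complex" where
  "ind A f x = indicator A x * f x"

lemma ind_measurable:
  assumes [measurable]: "A \<in> sets M" "f \<in> borel_measurable M"
  shows "ind A f \<in> borel_measurable M"
  unfolding ind_def by measurable

lemma cmod_ind: "cmod (ind A f x) powr p = indicator A x * cmod (f x) powr p"
  by (simp add: ind_def indicator_def)

lemma L_ind: "\<lbrakk>A \<in> sets M; f \<in> L\<rbrakk> \<Longrightarrow> ind A f \<in> L"
  by (rule L_bound[OF ind_measurable L_integrable]) (auto simp: cmod_ind indicator_def LD)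

lemma L_indicator: "\<lbrakk>A \<in> sets M; emeasure M A < \<infinity>\<rbrakk> \<Longrightarrow> (\<lambda>x. c * indicator A x) \<in> L"
proof (rule L_bound)
  assume A [measurable]: "A \<in> sets M" "emeasure M A < \<infinity>"
  show "(\<lambda>x. c * indicator A x) \<in> borel_measurable M" by measurable
  show "integrable M (\<lambda>x. cmod c powr p * indicator A x)" using A by simp
qed (auto simp: indicator_def)

lemma Np_split:
  assumes A: "A \<in> sets M" and f: "f \<in> L"
  shows "Np f = Np (ind A f) + Np (\<lambda>x. f x - ind A f x)"
proof -
  have "Np (ind A f) + Np (\<lambda>x. f x - ind A f x)
      = (LINT x|M. cmod (ind A f x) powr p + cmod (f x - ind A f x) powr p)"
    unfolding Np_def
    by (rule Bochner_Integration.integral_add[symmetric])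
      (intro L_integrable L_ind A f, intro L_integrable L_diff L_ind A f)
  also have "\<dots> = Np f"
    unfolding Np_def by (rule Bochner_Integration.integral_cong) (auto simp: ind_def indicator_def)
  finally show ?thesis by simp
qed

definition mult_op :: "'a set \<Rightarrow> ('a \<Rightarrow> complex) set \<Rightarrow> ('a \<Rightarrow> complex) set" where
  "mult_op A = (\<lambda>F\<in>carrier (Lp p M). cls (ind A (Lp_rep F)))"

lemma mult_op_apply:
  assumes A: "A \<in> sets M" and f: "f \<in> L" shows "mult_op A (cls f) = cls (ind A f)"
proof -
  have "cls (ind A (Lp_rep (cls f))) = cls (ind A f)"
  proof (rule cls_eq)
    show "AE x in M. ind A (Lp_rep (cls f)) x = ind A f x"
      using rep(2)[OF f] by eventually_elim (simp add: ind_def)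
  qed (rule ind_measurable[OF A LD[OF rep(1)[OF f]]])
  then show ?thesis using f by (simp add: mult_op_def)
qed

lemma L_imp_integrable:
  assumes f: "f \<in> L" and A: "A \<in> sets M" "emeasure M A < \<infinity>"
  shows "integrable M (\<lambda>x. indicator A x * f x)"
proof (rule Bochner_Integration.integrable_bound)
  show "integrable M (\<lambda>x. indicator A x + cmod (f x) powr p)"
    using A L_integrable[OF f] by simp
  show "(\<lambda>x. indicator A x * f x) \<in> borel_measurable M"
    using ind_measurable[OF A(1) LD[OF f]] by (simp add: ind_def[abs_def])
  have "t \<le> 1 + t powr p" if "0 \<le> t" for t :: real
    using that powr_mono[of 1 p t] p_gt_1 by (cases "t \<le> 1") (auto simp: add_increasing2)
  then show "AE x in M. norm (indicator A x * f x) \<le> norm (indicator A x + cmod (f x) powr p)"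
    by (auto simp: indicator_def)
qed

lemma atom_AE_const:
  assumes A: "measure_atom M A" "emeasure M A < \<infinity>" and f: "f \<in> L"
  obtains c where "AE x in M. x \<in> A \<longrightarrow> f x = c"
proof -
  have As: "A \<in> sets M" using A by (auto simp: measure_atom_def)
  note [measurable] = LD[OF f]
  note int = L_imp_integrable[OF f As A(2)]
  have "Re (indicator A x * f x) = indicator A x * Re (f x)" "Im (indicator A x * f x) = indicator A x * Im (f x)" for x
    by (simp_all add: indicator_def)
  then have "integrable M (\<lambda>x. indicator A x * Re (f x))" "integrable M (\<lambda>x. indicator A x * Im (f x))"
    using integrable_Re[OF int] integrable_Im[OF int] by simp_all
  then obtain a b where "AE x in M. x \<in> A \<longrightarrow> Re (f x) = a" "AE x in M. x \<in> A \<longrightarrow> Im (f x) = b"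
    using atom_AE_const_real[OF A, of "\<lambda>x. Re (f x)"] atom_AE_const_real[OF A, of "\<lambda>x. Im (f x)"] by auto
  then have "AE x in M. x \<in> A \<longrightarrow> f x = Complex a b"
    by eventually_elim (simp add: complex_eq_iff)
  with that show thesis .
qed

text \<open>Functions in L^p are constant almost everywhere on an atom, so restriction to it
  coincides with averaging over it, an operator of rank one.\<close>

lemma mult_op_atom_compact:
  assumes A: "measure_atom M A" "emeasure M A < \<infinity>"
  shows "compact_op (Lp p M) (mult_op A)"
proof -
  have As: "A \<in> sets M" and pos: "emeasure M A > 0" using A by (auto simp: measure_atom_def)
  have mA: "measure M A > 0" using A pos by (simp add: measure_def enn2real_positive_iff)
  define u where "u = (\<lambda>x. 1 * indicator A x :: complex)"
  have u: "u \<in> L" unfolding u_def by (rule L_indicator[OF As A(2)])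
  define v where "v = cls (\<lambda>x. complex_of_real (inverse (measure M A)) * u x)"
  have v: "v \<in> carrier (Lp p M)" unfolding v_def by (rule cls_closed[OF L_smult[OF u]])
  have "mult_op A = (\<lambda>F\<in>carrier (Lp p M). dual_op u F \<odot>\<^bsub>Lp p M\<^esub> v)"
  proof (rule extensionalityI[of _ "carrier (Lp p M)"])
    fix F assume "F \<in> carrier (Lp p M)"
    then obtain f where f: "f \<in> L" "F = cls f" by (auto simp: Lp_carrier)
    obtain c where c: "AE x in M. x \<in> A \<longrightarrow> f x = c" using atom_AE_const[OF A f(1)] by blast
    note [measurable] = LD[OF f(1)] LD[OF u] As
    have "dual_op u F = (LINT x|M. f x * dual_fun u x)" using f u by (simp add: dual_op_apply)
    also have "\<dots> = (LINT x|M. indicator A x *\<^sub>R c)"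
      using c by (intro integral_cong_AE) (auto elim!: eventually_mono simp: u_def dual_fun_def indicator_def)
    also have "\<dots> = c * measure M A" using As A by (simp add: scaleR_conv_of_real mult.commute)
    finally have d: "dual_op u F = c * measure M A" .
    have "mult_op A F = cls (ind A f)" using f As by (simp add: mult_op_apply)
    also have "\<dots> = cls (\<lambda>x. c * u x)"
      using c by (intro cls_eq ind_measurable As LD f) (auto elim!: eventually_mono simp: ind_def u_def indicator_def)
    also have "\<dots> = dual_op u F \<odot>\<^bsub>Lp p M\<^esub> v"
    proof -
      have "c * complex_of_real (measure M A) * (complex_of_real (inverse (measure M A)) * z) = c * z" for z
        using mA by (simp add: field_simps)
      then show ?thesis using u L_smult by (simp only: d v_def Lp_smult)
    qed
    finally show "mult_op A F = (\<lambda>F\<in>carrier (Lp p M). dual_op u F \<odot>\<^bsub>Lp p M\<^esub> v) F"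
      using f by simp
  qed (auto simp: mult_op_def)
  then show ?thesis using Lp.compact_op_rank_one(1)[OF dual_op_bounded(1)[OF u] v] by simp
qed

text \<open>One atom from each class modulo null sets. The predicate after \<open>SOME\<close>
  depends only on the class of \<open>A\<close>, so equivalent atoms receive the same
  choice.\<close>

definition atom_rep :: "'a set \<Rightarrow> 'a set" where
  "atom_rep A = (SOME B. measure_atom M B \<and> (AE x in M. x \<in> A \<longleftrightarrow> x \<in> B))"

definition atoms :: "'a set set" where
  "atoms = atom_rep ` {A. measure_atom M A}"

lemma atom_rep:
  assumes "measure_atom M A"
  shows "measure_atom M (atom_rep A)" "AE x in M. x \<in> A \<longleftrightarrow> x \<in> atom_rep A"
  using someI[of "\<lambda>B. measure_atom M B \<and> (AE x in M. x \<in> A \<longleftrightarrow> x \<in> B)" A] assms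
  by (auto simp: atom_rep_def)

lemma atoms_atom: "A \<in> atoms \<Longrightarrow> measure_atom M A"
  using atom_rep by (auto simp: atoms_def)

lemma atoms_sets: "A \<in> atoms \<Longrightarrow> A \<in> sets M"
  using atoms_atom by (auto simp: measure_atom_def)

lemma atoms_disjoint:
  assumes "A \<in> atoms" "B \<in> atoms" "A \<noteq> B"
  shows "AE x in M. \<not> (x \<in> A \<and> x \<in> B)"
proof (rule ccontr)
  note A = atoms_atom[OF assms(1)] and B = atoms_atom[OF assms(2)]
  have AB: "A \<in> sets M" "B \<in> sets M" using A B by (auto simp: measure_atom_def)
  have half: "emeasure M (A - B) = 0"
    if A: "measure_atom M A" and AB: "A \<in> sets M" "B \<in> sets M" and n: "\<not> (AE x in M. \<not> (x \<in> A \<and> x \<in> B))" for A B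
  proof -
    have "emeasure M (A \<inter> B) = 0 \<or> emeasure M (A - A \<inter> B) = 0"
      using A AB by (auto simp: measure_atom_def)
    moreover have "emeasure M (A \<inter> B) \<noteq> 0"
    proof
      assume "emeasure M (A \<inter> B) = 0"
      then have "AE x in M. x \<notin> A \<inter> B" using AB by (intro AE_not_in) (simp add: null_sets_def)
      with n show False by simp
    qed
    moreover have "A - A \<inter> B = A - B" by blast
    ultimately show ?thesis by simp
  qed
  assume n: "\<not> (AE x in M. \<not> (x \<in> A \<and> x \<in> B))"
  then have "\<not> (AE x in M. \<not> (x \<in> B \<and> x \<in> A))" by (simp add: conj_commute)
  then have "emeasure M (A - B) = 0" "emeasure M (B - A) = 0"
    using half[OF A AB n] half[OF B AB(2,1)] by auto
  then have "AE x in M. x \<notin> A - B" "AE x in M. x \<notin> B - A"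
    using AB by (intro AE_not_in; simp add: null_sets_def)+
  then have eq: "AE x in M. x \<in> A \<longleftrightarrow> x \<in> B" by eventually_elim auto
  obtain A' B' where A': "measure_atom M A'" "A = atom_rep A'" and B': "measure_atom M B'" "B = atom_rep B'"
    using assms by (auto simp: atoms_def)
  have eq': "AE x in M. x \<in> A' \<longleftrightarrow> x \<in> B'"
    using atom_rep(2)[OF A'(1)] atom_rep(2)[OF B'(1)] eq unfolding A'(2)[symmetric] B'(2)[symmetric]
    by eventually_elim auto
  have "(AE x in M. x \<in> A' \<longleftrightarrow> x \<in> C) \<longleftrightarrow> (AE x in M. x \<in> B' \<longleftrightarrow> x \<in> C)" for C
    using eq' by (auto elim: eventually_elim2)
  then have "atom_rep A' = atom_rep B'" by (simp add: atom_rep_def)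
  with A' B' assms show False by simp
qed

lemma atoms_finite_disjoint:
  assumes "finite F" "F \<subseteq> atoms"
  shows "AE x in M. (\<Sum>A\<in>F. indicator A x) = (indicator (\<Union>F) x :: complex)"
proof -
  have "AE x in M. \<forall>A\<in>F. \<forall>B\<in>F. A \<noteq> B \<longrightarrow> \<not> (x \<in> A \<and> x \<in> B)"
    using assms atoms_disjoint by (intro AE_finite_allI) (auto simp: subset_iff)
  then show ?thesis
  proof eventually_elim
    case (elim x)
    show ?case
    proof (cases "\<exists>A\<in>F. x \<in> A")
      case True
      then obtain A where A: "A \<in> F" "x \<in> A" by blast
      then have "(\<Sum>B\<in>F. indicator B x) = (\<Sum>B\<in>F. if B = A then 1 else (0::complex))"
        using elim by (intro sum.cong) (auto simp: indicator_def)
      with A assms show ?thesis by (auto simp: indicator_def)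
    qed (auto simp: indicator_def)
  qed
qed

text \<open>As overlaps of distinct representatives are null, the sum of the indicators is almost
  everywhere the indicator of the union.\<close>

lemma finsum_mult_op:
  assumes F: "finite F" "F \<subseteq> atoms" and f: "f \<in> L"
  shows "(\<Oplus>\<^bsub>Lp p M\<^esub>A\<in>F. mult_op A (cls f)) = cls (ind (\<Union>F) f)"
proof -
  have "(\<Oplus>\<^bsub>Lp p M\<^esub>A\<in>F. mult_op A (cls f)) = cls (\<lambda>x. (\<Sum>A\<in>F. indicator A x) * f x) \<and>
      (\<lambda>x. (\<Sum>A\<in>F. indicator A x) * f x) \<in> L"
    using F
  proof (induction F rule: finite_induct)
    case empty
    then show ?case using L_zero by (simp add: Lp_zero)
  next
    case (insert A F)
    have A: "A \<in> sets M" using insert atoms_sets by auto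
    have B: "mult_op B (cls f) \<in> carrier (Lp p M)" if "B \<in> atoms" for B
      using mult_op_apply[OF atoms_sets[OF that] f] L_ind[OF atoms_sets[OF that] f] by simp
    have "(\<Oplus>\<^bsub>Lp p M\<^esub>B\<in>insert A F. mult_op B (cls f)) = mult_op A (cls f) \<oplus>\<^bsub>Lp p M\<^esub> (\<Oplus>\<^bsub>Lp p M\<^esub>B\<in>F. mult_op B (cls f))"
      using insert B by (intro Lp.M.finsum_insert) auto
    also have "\<dots> = cls (\<lambda>x. ind A f x + (\<Sum>A\<in>F. indicator A x) * f x)"
      using insert L_ind[OF A f] by (simp add: mult_op_apply[OF A f] Lp_add)
    also have "(\<lambda>x. ind A f x + (\<Sum>A\<in>F. indicator A x) * f x) = (\<lambda>x. (\<Sum>A\<in>insert A F. indicator A x) * f x)"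
      using insert by (simp add: ind_def fun_eq_iff distrib_right)
    finally show ?case
      using L_add[OF L_ind[OF A f], of "\<lambda>x. (\<Sum>A\<in>F. indicator A x) * f x"] insert
      by (simp add: ind_def distrib_right)
  qed
  moreover have "cls (\<lambda>x. (\<Sum>A\<in>F. indicator A x) * f x) = cls (ind (\<Union>F) f)"
    using calculation atoms_finite_disjoint[OF F]
    by (intro cls_eq) (auto intro: LD elim!: eventually_mono simp: ind_def)
  ultimately show ?thesis by simp
qed

text \<open>Exhaustion: choose finite sets of atoms whose share of \<open>Np f\<close> approaches
  the supremum. Were \<open>f\<close> nonzero on a set of positive measure outside all of them, an
  atom in that set would push the share beyond the supremum. This selects the countably many atoms
  relevant to \<open>f\<close> among possibly uncountably many.\<close>

lemma atoms_dense:
  assumes pa: "purely_atomic M" and f: "f \<in> L" and \<epsilon>: "\<epsilon> > 0"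
  shows "\<exists>F. finite F \<and> F \<subseteq> atoms \<and> Np (\<lambda>x. f x - ind (\<Union>F) f x) < \<epsilon>"
proof -
  note [measurable] = LD[OF f]
  define \<F> where "\<F> = {F. finite F \<and> F \<subseteq> atoms}"
  have sets: "\<Union>F \<in> sets M" if "F \<in> \<F>" for F
    using that atoms_sets by (auto simp: \<F>_def subset_iff)
  define m where "m F = Np (ind (\<Union>F) f)" for F
  have m_le: "m F \<le> Np f" if "F \<in> \<F>" for F
    using Np_split[OF sets[OF that] f] Np_nonneg by (simp add: m_def)
  have bdd: "bdd_above (m ` \<F>)" using m_le by (auto simp: bdd_above_def)
  have ne: "{} \<in> \<F>" by (simp add: \<F>_def)
  define S where "S = (SUP F\<in>\<F>. m F)"
  have S_upper: "m F \<le> S" if "F \<in> \<F>" for F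
    unfolding S_def by (rule cSUP_upper[OF that bdd])
  have "\<exists>F\<in>\<F>. S - inverse (real (Suc n)) < m F" for n
    using less_cSUP_iff[OF _ bdd, of "S - inverse (real (Suc n))"] ne by (auto simp: S_def)
  then obtain F where F: "\<And>n. F n \<in> \<F>" "\<And>n. S - inverse (real (Suc n)) < m (F n)" by metis
  \<comment> \<open>The near-optimal sets \<open>F n\<close> need not increase; their partial unions
    do, which is what pointwise convergence needs.\<close>
  define G where "G n = (\<Union>k\<le>n. F k)" for n
  have G: "G n \<in> \<F>" for n using F(1) by (auto simp: G_def \<F>_def)
  define U where "U = (\<Union>n. \<Union>(F n))"
  have U [measurable]: "U \<in> sets M" unfolding U_def using sets[OF F(1)] by auto
  define R where "R = {x \<in> space M. f x \<noteq> 0 \<and> x \<notin> U}"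
  have R [measurable]: "R \<in> sets M" unfolding R_def by measurable
  have "emeasure M R = 0"
  proof (rule ccontr)
    assume "emeasure M R \<noteq> 0"
    then obtain B where B: "B \<subseteq> R" "measure_atom M B"
      using pa R unfolding purely_atomic_def by (metis zero_less_iff_neq_zero)
    have Bs [measurable]: "B \<in> sets M" using B by (simp add: measure_atom_def)
    \<comment> \<open>The atom found in the leftover need not be one of the chosen representatives;
      it is replaced by its own, from which it differs by a null set.\<close>
    define i where "i = atom_rep B"
    have i: "i \<in> atoms" using B by (auto simp: i_def atoms_def)
    have iB: "AE x in M. x \<in> B \<longleftrightarrow> x \<in> i" using atom_rep(2)[OF B(2)] by (simp add: i_def)
    define a where "a = Np (ind B f)"
    have "a \<noteq> 0"
    proof
      assume "a = 0"
      then have "AE x in M. ind B f x = 0" using L_ind[OF Bs f] by (simp add: a_def Np_eq_0_iff)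
      then have "AE x in M. x \<notin> B"
        by eventually_elim (use B in \<open>auto simp: ind_def indicator_def R_def split: if_splits\<close>)
      then have "B \<in> null_sets M" using AE_iff_null_sets[OF Bs] by simp
      then have "emeasure M B = 0" by (simp add: null_sets_def)
      with B show False by (simp add: measure_atom_def)
    qed
    then have "a > 0" using Np_nonneg[of "ind B f"] by (simp add: a_def)
    then obtain n where n: "inverse (real (Suc n)) < a" using reals_Archimedean by blast
    have H: "insert i (F n) \<in> \<F>" using F(1)[of n] i by (auto simp: \<F>_def)
    let ?h = "ind (\<Union>(insert i (F n))) f"
    have h: "?h \<in> L" by (rule L_ind[OF sets[OF H] f])
    have disj: "B \<inter> \<Union>(F n) = {}" using B by (auto simp: R_def U_def)
    have "m (insert i (F n)) = Np (ind B ?h) + Np (\<lambda>x. ?h x - ind B ?h x)"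
      using Np_split[OF Bs h] by (simp add: m_def)
    also have "Np (ind B ?h) = a"
      unfolding a_def using iB
      by (intro Np_cong ind_measurable Bs sets[OF H] LD[OF f])
        (auto elim!: eventually_mono simp: ind_def indicator_def)
    also have "Np (\<lambda>x. ?h x - ind B ?h x) = m (F n)"
      unfolding m_def
    proof (rule Np_cong)
      show "(\<lambda>x. ?h x - ind B ?h x) \<in> borel_measurable M" by (rule LD[OF L_diff[OF h L_ind[OF Bs h]]])
      show "ind (\<Union>(F n)) f \<in> borel_measurable M" by (rule LD[OF L_ind[OF sets[OF F(1)] f]])
      show "AE x in M. ?h x - ind B ?h x = ind (\<Union>(F n)) f x"
        using iB by eventually_elim (use disj in \<open>auto simp: ind_def indicator_def\<close>)
    qed
    finally have "m (insert i (F n)) = a + m (F n)" .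
    then show False using S_upper[OF H] F(2)[of n] n by simp
  qed
  then have R0: "AE x in M. x \<notin> R" using R by (intro AE_not_in) (simp add: null_sets_def)
  have "(\<lambda>n. Np (\<lambda>x. f x - ind (\<Union>(G n)) f x)) \<longlonglongrightarrow> (LINT x|M. 0)"
    unfolding Np_def
  proof (rule integral_dominated_convergence)
    show "integrable M (\<lambda>x. cmod (f x) powr p)" by (rule L_integrable[OF f])
    show "(\<lambda>x. cmod (f x - ind (\<Union>(G n)) f x) powr p) \<in> borel_measurable M" for n
      using L_integrable[OF L_diff[OF f L_ind[OF sets[OF G[of n]] f]]] by simp
    show "AE x in M. norm (cmod (f x - ind (\<Union>(G n)) f x) powr p) \<le> cmod (f x) powr p" for n
      by (auto simp: ind_def indicator_def)
    show "AE x in M. (\<lambda>n. cmod (f x - ind (\<Union>(G n)) f x) powr p) \<longlonglongrightarrow> 0"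
      using R0 AE_space
    proof eventually_elim
      case (elim x)
      show ?case
      proof (cases "x \<in> U")
        case True
        then obtain k where k: "x \<in> \<Union>(F k)" by (auto simp: U_def)
        have "f x - ind (\<Union>(G n)) f x = 0" if "n \<ge> k" for n
        proof -
          have "x \<in> \<Union>(G n)" using k that by (auto simp: G_def)
          then show ?thesis by (simp add: ind_def)
        qed
        then show ?thesis
          by (intro tendsto_eventually) (auto simp: eventually_sequentially intro!: exI[of _ k])
      next
        case False
        then have "f x = 0" using elim by (auto simp: R_def)
        then show ?thesis by (simp add: ind_def)
      qed
    qed
  qed simp
  then have "\<forall>\<^sub>F n in sequentially. Np (\<lambda>x. f x - ind (\<Union>(G n)) f x) < \<epsilon>"
    using \<epsilon> by (intro order_tendstoD) auto
  then obtain n where "Np (\<lambda>x. f x - ind (\<Union>(G n)) f x) < \<epsilon>" by (auto simp: eventually_sequentially)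
  with G[of n] show ?thesis by (auto simp: \<F>_def)
qed

theorem purely_atomic_imp_M_approximately_unital:
  assumes dec: "decomposable M" and pa: "purely_atomic M"
  shows "M_approximately_unital (compact_op_algebra (Lp p M))"
proof -
  have "lp_decomposition (Lp p M) p atoms mult_op"
  proof (unfold_locales)
    show "1 < p" by (rule p_gt_1)
    fix A assume A: "A \<in> atoms"
    note As = atoms_sets[OF A]
    show "compact_op (Lp p M) (mult_op A)"
      by (rule mult_op_atom_compact[OF atoms_atom[OF A] measure_atom_finite[OF dec atoms_atom[OF A]]])
    fix X assume "X \<in> carrier (Lp p M)"
    then obtain f where f: "f \<in> L" "X = cls f" by (auto simp: Lp_carrier)
    show "mult_op A (mult_op A X) = mult_op A X"
      using f L_ind[OF As f(1)] As by (simp add: mult_op_apply) (simp add: ind_def[abs_def] mult.assoc[symmetric] indicator_inter_arith[symmetric])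
    show "nrm (Lp p M) X powr p = nrm (Lp p M) (mult_op A X) powr p + nrm (Lp p M) (X \<ominus>\<^bsub>Lp p M\<^esub> mult_op A X) powr p"
      using f L_ind[OF As f(1)] As L_diff Np_split[OF As f(1)] by (simp add: mult_op_apply Lp_diff Lp_nrm_powr)
    fix B assume B: "B \<in> atoms" "A \<noteq> B"
    note Bs = atoms_sets[OF B(1)]
    have "cls (ind A (ind B f)) = cls (\<lambda>x. 0)"
      using atoms_disjoint[OF A B] by (intro cls_eq ind_measurable As Bs LD f)
        (auto elim!: eventually_mono simp: ind_def indicator_def)
    then show "mult_op A (mult_op B X) = \<zero>\<^bsub>Lp p M\<^esub>"
      using f L_ind[OF Bs f(1)] As Bs by (simp add: mult_op_apply Lp_zero)
  next
    fix X and \<epsilon> :: real assume "X \<in> carrier (Lp p M)" and \<epsilon>: "0 < \<epsilon>"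
    then obtain f where f: "f \<in> L" "X = cls f" by (auto simp: Lp_carrier)
    obtain F where F: "finite F" "F \<subseteq> atoms" "Np (\<lambda>x. f x - ind (\<Union>F) f x) < \<epsilon> powr p"
      using atoms_dense[OF pa f(1), of "\<epsilon> powr p"] \<epsilon> by auto
    have UF: "\<Union>F \<in> sets M" using F atoms_sets by (auto simp: subset_iff)
    have "nrm (Lp p M) (X \<ominus>\<^bsub>Lp p M\<^esub> (\<Oplus>\<^bsub>Lp p M\<^esub>A\<in>F. mult_op A X)) = Np (\<lambda>x. f x - ind (\<Union>F) f x) powr (1 / p)"
      using f L_ind[OF UF f(1)] L_diff by (simp add: finsum_mult_op[OF F(1,2) f(1)] Lp_diff Lp_nrm)
    also have "\<dots> < (\<epsilon> powr p) powr (1 / p)"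
      using F(3) p_gt_1 Np_nonneg by (intro powr_less_mono2) auto
    also have "\<dots> = \<epsilon>" using \<epsilon> p_gt_1 by (simp add: powr_powr)
    finally show "\<exists>F. finite F \<and> F \<subseteq> atoms \<and> nrm (Lp p M) (X \<ominus>\<^bsub>Lp p M\<^esub> (\<Oplus>\<^bsub>Lp p M\<^esub>A\<in>F. mult_op A X)) < \<epsilon>"
      using F by blast
  qed
  then show ?thesis by (rule lp_decomposition.M_approximately_unital_K)
qed

end

section \<open>Atomless measures\<close>

locale atomless_finite_measure = finite_measure +
  assumes no_atom: "\<not> measure_atom M A"
begin

text \<open>Without atoms a set of positive measure splits into two parts of positive measure, one
  of which has at most half the measure. Iterate.\<close>

lemma ex_small_subset:
  assumes A: "A \<in> sets M" "measure M A > 0" and \<epsilon>: "\<epsilon> > 0"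
  shows "\<exists>B\<in>sets M. B \<subseteq> A \<and> 0 < measure M B \<and> measure M B < \<epsilon>"
proof -
  have half: "\<exists>B\<in>sets M. B \<subseteq> A \<and> 0 < measure M B \<and> measure M B \<le> measure M A / 2"
    if A: "A \<in> sets M" "measure M A > 0" for A
  proof -
    have "emeasure M A > 0" using A by (simp add: emeasure_eq_measure)
    then obtain B where B: "B \<in> sets M" "B \<subseteq> A" "emeasure M B \<noteq> 0" "emeasure M (A - B) \<noteq> 0"
      using no_atom[of A] A unfolding measure_atom_def by blast
    then have pos: "measure M B > 0" "measure M (A - B) > 0"
      using measure_nonneg[of M B] measure_nonneg[of M "A - B"]
      by (auto simp: emeasure_eq_measure less_le)
    have "measure M (A - B) = measure M A - measure M B"
      using A B by (intro finite_measure_Diff) auto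
    then show ?thesis
      using pos B A
      by (cases "measure M B \<le> measure M A / 2") (force intro: bexI[of _ B], auto intro!: bexI[of _ "A - B"])
  qed
  have "\<exists>B\<in>sets M. B \<subseteq> A \<and> 0 < measure M B \<and> measure M B \<le> measure M A / 2 ^ n" for n
  proof (induction n)
    case 0
    then show ?case using A by auto
  next
    case (Suc n)
    then obtain B where B: "B \<in> sets M" "B \<subseteq> A" "0 < measure M B" "measure M B \<le> measure M A / 2 ^ n" by blast
    obtain C where "C \<in> sets M" "C \<subseteq> B" "0 < measure M C" "measure M C \<le> measure M B / 2"
      using half[OF B(1,3)] by blast
    with B show ?case by (intro bexI[of _ C]) auto
  qed
  moreover obtain n where "(1 / 2) ^ n < \<epsilon> / measure M A"
    using real_arch_pow_inv[of "\<epsilon> / measure M A" "1 / 2"] \<epsilon> A by auto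
  then have "measure M A / 2 ^ n < \<epsilon>" using A by (simp add: field_simps)
  ultimately show ?thesis by (meson le_less_trans)
qed

text \<open>Sierpinski's theorem, by greedy exhaustion: each step adds a set at least half as large as possible.\<close>

lemma ex_subset_measure_eq:
  assumes A: "A \<in> sets M" and c: "0 \<le> c" "c \<le> measure M A"
  obtains B where "B \<in> sets M" "B \<subseteq> A" "measure M B = c"
proof -
  \<comment> \<open>The sets that can still be added to \<open>F\<close> without exceeding the
    measure \<open>c\<close>.\<close>
  define cand where "cand F = {G \<in> sets M. G \<subseteq> A - F \<and> measure M F + measure M G \<le> c}" for F
  define s where "s F = (SUP G\<in>cand F. measure M G)" for F
  have bdd: "bdd_above (measure M ` cand F)" for F
  proof (rule bdd_aboveI2)
    fix G assume "G \<in> cand F"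
    then have "measure M F + measure M G \<le> c" by (simp add: cand_def)
    then show "measure M G \<le> c" using measure_nonneg[of M F] by linarith
  qed
  have "\<exists>G\<in>cand F. s F / 2 \<le> measure M G" if F: "measure M F \<le> c" for F
  proof (cases "s F > 0")
    case True
    have "{} \<in> cand F" using F by (simp add: cand_def)
    then have "\<exists>G\<in>cand F. s F / 2 < measure M G"
      using less_cSUP_iff[OF _ bdd, of F "s F / 2"] True by (auto simp: s_def)
    then show ?thesis by (auto intro: less_imp_le)
  next
    case False
    then show ?thesis using F by (intro bexI[of _ "{}"]) (auto simp: cand_def)
  qed
  then obtain g where g: "\<And>F. measure M F \<le> c \<Longrightarrow> g F \<in> cand F" "\<And>F. measure M F \<le> c \<Longrightarrow> s F / 2 \<le> measure M (g F)"
    by metis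
  define F where "F = rec_nat {} (\<lambda>_ F. F \<union> g F)"
  have F_simps: "F 0 = {}" "F (Suc n) = F n \<union> g (F n)" for n by (simp_all add: F_def)
  have step: "F n \<in> sets M \<and> F n \<subseteq> A \<and> measure M (F n) \<le> c" for n
  proof (induction n)
    case 0
    then show ?case using c by (simp add: F_simps)
  next
    case (Suc n)
    then have G: "g (F n) \<in> sets M" "g (F n) \<subseteq> A - F n" "measure M (F n) + measure M (g (F n)) \<le> c"
      using g(1)[of "F n"] by (auto simp: cand_def)
    then have "measure M (F (Suc n)) = measure M (F n) + measure M (g (F n))"
      unfolding F_simps using Suc by (intro finite_measure_Union) auto
    with G Suc show ?case by (auto simp: F_simps)
  qed
  have incr: "measure M (F (Suc n)) = measure M (F n) + measure M (g (F n))" for n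
  proof -
    have "g (F n) \<in> sets M" "g (F n) \<subseteq> A - F n" using g(1)[of "F n"] step[of n] by (auto simp: cand_def)
    then show ?thesis unfolding F_simps using step[of n] by (intro finite_measure_Union) auto
  qed
  define B where "B = (\<Union>n. F n)"
  have B: "B \<in> sets M" "B \<subseteq> A" using step by (auto simp: B_def)
  have "incseq F" by (rule incseq_SucI) (simp add: F_simps)
  then have lim: "(\<lambda>n. measure M (F n)) \<longlonglongrightarrow> measure M B"
    unfolding B_def using step by (intro finite_Lim_measure_incseq) auto
  have FB: "measure M (F n) \<le> measure M B" for n
    using B step by (intro finite_measure_mono) (auto simp: B_def)
  have "measure M B \<le> c" by (rule LIMSEQ_le_const2[OF lim]) (use step in auto)
  moreover have "\<not> measure M B < c"
  proof
    assume less: "measure M B < c"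
    have "measure M (A - B) = measure M A - measure M B" using A B by (intro finite_measure_Diff) auto
    then have "measure M (A - B) > 0" using less c by simp
    \<comment> \<open>\<open>H\<close> stays a candidate at every stage, so each increment is at
      least half its measure. Infinitely many such increments contradict the bound
      \<open>c\<close>.\<close>
    then obtain H where H: "H \<in> sets M" "H \<subseteq> A - B" "0 < measure M H" "measure M H < c - measure M B"
      using ex_small_subset[of "A - B" "c - measure M B"] A B less by auto
    have lower: "measure M H / 2 \<le> measure M (g (F n))" for n
    proof -
      have "H \<in> cand (F n)" using H FB[of n] by (auto simp: cand_def B_def)
      then have "measure M H \<le> s (F n)" unfolding s_def by (rule cSUP_upper[OF _ bdd])
      then show ?thesis using g(2)[of "F n"] step[of n] by simp
    qed
    have "real n * (measure M H / 2) \<le> measure M (F n)" for n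
    proof (induction n)
      case (Suc n)
      have "real (Suc n) * (measure M H / 2) = real n * (measure M H / 2) + measure M H / 2"
        by (simp add: distrib_right add_divide_distrib)
      with Suc lower[of n] show ?case unfolding incr by linarith
    qed (simp add: F_simps)
    moreover obtain n :: nat where "c / (measure M H / 2) < real n" using reals_Archimedean2 by blast
    then have "c < real n * (measure M H / 2)" using H by (simp add: field_simps)
    ultimately show False using step[of n] by (meson less_le_trans not_le)
  qed
  ultimately show thesis using that B by force
qed

definition halve :: "'a set \<Rightarrow> 'a set" where
  "halve A = (SOME B. B \<in> sets M \<and> B \<subseteq> A \<and> measure M B = measure M A / 2)"

lemma halve:
  assumes "A \<in> sets M"
  shows "halve A \<in> sets M" "halve A \<subseteq> A" "measure M (halve A) = measure M A / 2"
proof -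
  have "\<exists>B. B \<in> sets M \<and> B \<subseteq> A \<and> measure M B = measure M A / 2"
  proof -
    have "0 \<le> measure M A / 2" "measure M A / 2 \<le> measure M A" by simp_all
    from ex_subset_measure_eq[OF assms this] show ?thesis by metis
  qed
  from someI_ex[OF this] show "halve A \<in> sets M" "halve A \<subseteq> A" "measure M (halve A) = measure M A / 2"
    by (auto simp: halve_def)
qed

fun cells :: "'a set \<Rightarrow> nat \<Rightarrow> 'a set set" where
  "cells A 0 = {A}"
| "cells A (Suc n) = halve ` cells A n \<union> (\<lambda>C. C - halve C) ` cells A n"

lemma cells:
  assumes A: "A \<in> sets M"
  shows "finite (cells A n)" "cells A n \<subseteq> sets M" "\<Union>(cells A n) = A" "disjoint (cells A n)"
proof -
  have "finite (cells A n) \<and> cells A n \<subseteq> sets M \<and> \<Union>(cells A n) = A \<and> disjoint (cells A n)"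
  proof (induction n)
    case 0
    then show ?case using A by simp
  next
    case (Suc n)
    have sub: "halve C \<in> sets M" "halve C \<subseteq> C" if "C \<in> cells A n" for C
      using halve(1,2)[of C] that Suc by auto
    have "\<Union>(cells A (Suc n)) = \<Union>(cells A n)" using sub by auto
    moreover have "disjoint (cells A (Suc n))"
    proof (rule disjointI)
      fix C D assume CD: "C \<in> cells A (Suc n)" "D \<in> cells A (Suc n)" "C \<noteq> D"
      then obtain C' D' where C': "C' \<in> cells A n" "C = halve C' \<or> C = C' - halve C'"
        and D': "D' \<in> cells A n" "D = halve D' \<or> D = D' - halve D'" by auto
      show "C \<inter> D = {}"
      proof (cases "C' = D'")
        case True
        then show ?thesis using C' D' CD by auto
      next
        case False
        then have "C' \<inter> D' = {}" using Suc C' D' by (auto dest: disjointD)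
        then show ?thesis using C' D' sub[OF C'(1)] sub[OF D'(1)] by auto
      qed
    qed
    ultimately show ?case using Suc sub by auto
  qed
  then show "finite (cells A n)" "cells A n \<subseteq> sets M" "\<Union>(cells A n) = A" "disjoint (cells A n)" by auto
qed

text \<open>\<open>H n\<close> takes the chosen half of each cell of the n-th dyadic partition, as
  the sets where the Rademacher functions equal 1 do. For n < m the set \<open>H n\<close> is a
  union of cells of generation \<open>m\<close>, and \<open>H m\<close> halves every one of
  them.\<close>

lemma ex_independent_halves:
  assumes A: "A \<in> sets M"
  shows "\<exists>H. \<forall>n::nat. H n \<in> sets M \<and> H n \<subseteq> A \<and> measure M (H n) = measure M A / 2 \<and>
    (\<forall>m. m \<noteq> n \<longrightarrow> measure M (H m \<inter> H n) = measure M A / 4)"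
proof -
  note cells = cells[OF A]
  define H where "H n = \<Union>(halve ` cells A n)" for n
  have h: "halve C \<in> sets M" "halve C \<subseteq> C" "measure M (halve C) = measure M C / 2" if "C \<in> cells A n" for C n
    using halve[of C] cells(2)[of n] that by auto
  have H_sets: "H n \<in> sets M" for n
    unfolding H_def using cells(1) h(1) by (intro sets.finite_Union) auto
  have H_sub: "H n \<subseteq> A" for n unfolding H_def using h(2) cells(3)[of n] by blast
  have CH: "C \<inter> H n = halve C" if C: "C \<in> cells A n" for C n
  proof -
    have "C \<inter> halve D \<subseteq> halve C" if "D \<in> cells A n" for D
      using disjointD[OF cells(4) C that] h(2)[OF that] by (cases "C = D") auto
    then show ?thesis using C h(2)[OF C] by (auto simp: H_def)
  qed
  have half: "measure M (\<Union>S \<inter> H n) = measure M (\<Union>S) / 2" if S: "S \<subseteq> cells A n" for S n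
  proof -
    have fin: "finite S" using S cells(1) finite_subset by blast
    have disj: "disjoint_family_on (\<lambda>C. C) S"
      using S cells(4)[of n] unfolding disjoint_family_on_def by (blast dest: disjointD)
    have disj': "disjoint_family_on halve S"
      unfolding disjoint_family_on_def
    proof (intro ballI impI)
      fix C D assume CD: "C \<in> S" "D \<in> S" "C \<noteq> D"
      then have "C \<inter> D = {}" using S cells(4)[of n] by (auto dest: disjointD)
      moreover have "halve C \<subseteq> C" "halve D \<subseteq> D" using CD S h(2) by auto
      ultimately show "halve C \<inter> halve D = {}" by blast
    qed
    have "\<Union>S \<inter> H n = (\<Union>C\<in>S. halve C)" using CH S by blast
    moreover have "halve ` S \<subseteq> sets M" using S h(1) by auto
    ultimately have "measure M (\<Union>S \<inter> H n) = (\<Sum>C\<in>S. measure M (halve C))"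
      using finite_measure_finite_Union[OF fin _ disj'] by simp
    also have "\<dots> = (\<Sum>C\<in>S. measure M C / 2)" using S h(3) by (intro sum.cong) auto
    also have "\<dots> = (\<Sum>C\<in>S. measure M C) / 2" by (simp add: sum_divide_distrib)
    also have "(\<Sum>C\<in>S. measure M C) = measure M (\<Union>S)"
      using finite_measure_finite_Union[OF fin _ disj] S cells(2)[of n] by auto
    finally show ?thesis .
  qed
  \<comment> \<open>Cells of all later generations lie entirely inside or entirely outside
    \<open>H n\<close>.\<close>
  have refine: "C \<subseteq> H n \<or> C \<inter> H n = {}" if "C \<in> cells A (Suc n + k)" for C n k
    using that
  proof (induction k arbitrary: C)
    case 0
    then obtain D where D: "D \<in> cells A n" "C = halve D \<or> C = D - halve D" by auto
    then show ?case using CH[OF D(1)] by (auto simp: H_def)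
  next
    case (Suc k)
    then obtain D where D: "D \<in> cells A (Suc n + k)" "C = halve D \<or> C = D - halve D" by auto
    then have "C \<subseteq> D" using h(2)[OF D(1)] by auto
    with Suc.IH[OF D(1)] show ?case by blast
  qed
  have half_A: "measure M (H n) = measure M A / 2" for n
  proof -
    have "A \<inter> H n = H n" using H_sub by blast
    then show ?thesis using half[of "cells A n" n] cells(3)[of n] by simp
  qed
  have quarter: "measure M (H n \<inter> H m) = measure M A / 4" if "n < m" for n m
  proof -
    obtain k where k: "m = Suc n + k" using less_imp_Suc_add[OF \<open>n < m\<close>] by auto
    define S where "S = {C \<in> cells A m. C \<subseteq> H n}"
    have "\<Union>S = H n"
    proof
      show "\<Union>S \<subseteq> H n" by (auto simp: S_def)
      show "H n \<subseteq> \<Union>S"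
      proof
        fix x assume x: "x \<in> H n"
        then have "x \<in> \<Union>(cells A m)" using H_sub cells(3)[of m] by blast
        then obtain C where C: "C \<in> cells A m" "x \<in> C" by blast
        then have "C \<subseteq> H n" using refine[of C n k] x unfolding k by blast
        with C show "x \<in> \<Union>S" by (auto simp: S_def)
      qed
    qed
    then show ?thesis using half[of S m] half_A[of n] by (auto simp: S_def)
  qed
  have "measure M (H m \<inter> H n) = measure M A / 4" if "m \<noteq> n" for m n
    using that quarter[of m n] quarter[of n m] by (cases "m < n") (auto simp: Int_commute)
  with H_sets H_sub half_A show ?thesis by (intro exI[of _ H]) simp
qed

end

text \<open>A set of positive measure without atoms is split into two halves of equal measure, and
  independent sets are built in each. All pairs of distinct indices have the same joint distribution
  on both halves, so a pair may be chosen late without affecting any norm.\<close>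

lemma not_purely_atomic_halves:
  assumes dec: "decomposable M" and npa: "\<not> purely_atomic M"
  obtains E1 E2 a H where "E1 \<in> sets M" "E2 \<in> sets M" "E1 \<inter> E2 = {}" "0 < a"
    "emeasure M E1 = ennreal a" "emeasure M E2 = ennreal a"
    "\<And>n::nat. H n \<in> sets M" "\<And>n. H n \<subseteq> E1 \<union> E2"
    "\<And>n. measure M (E1 \<inter> H n) = a / 2" "\<And>n. measure M (E2 \<inter> H n) = a / 2"
    "\<And>m n. m \<noteq> n \<Longrightarrow> measure M (E1 \<inter> H m \<inter> H n) = a / 4"
    "\<And>m n. m \<noteq> n \<Longrightarrow> measure M (E2 \<inter> H m \<inter> H n) = a / 4"
proof -
  obtain E0 where E0: "E0 \<in> sets M" "emeasure M E0 > 0" "\<And>A. A \<subseteq> E0 \<Longrightarrow> \<not> measure_atom M A"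
    using npa unfolding purely_atomic_def by blast
  obtain B where B: "B \<in> sets M" "emeasure M B < \<infinity>" "emeasure M (E0 \<inter> B) > 0"
    using decomposable_positive_part[OF dec E0(1,2)] by blast
  \<comment> \<open>Cutting down to finite measure, so that Sierpinski's theorem applies to the
    restricted space.\<close>
  define E where "E = E0 \<inter> B"
  have E: "E \<in> sets M" "emeasure M E > 0" "emeasure M E < \<infinity>" "\<And>A. A \<subseteq> E \<Longrightarrow> \<not> measure_atom M A"
    using E0 B emeasure_mono[of E B M] by (auto simp: E_def intro: le_less_trans)
  define N where "N = restrict_space M E"
  have space_N: "space N = E" using E(1) sets.sets_into_space by (auto simp: N_def space_restrict_space)
  have sets_N: "A \<in> sets N \<longleftrightarrow> A \<in> sets M \<and> A \<subseteq> E" for A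
    unfolding N_def using sets_restrict_space_iff[of E M A] E(1) by auto
  have emeasure_N: "emeasure N A = emeasure M A" if "A \<subseteq> E" for A
    unfolding N_def using E(1) that by (intro emeasure_restrict_space) auto
  then have measure_N: "measure N A = measure M A" if "A \<subseteq> E" for A
    using that by (simp add: measure_def)
  have fin: "finite_measure N"
    by (rule finite_measureI) (use E(3) in \<open>simp add: space_N emeasure_N\<close>)
  interpret N: atomless_finite_measure N
  proof (intro atomless_finite_measure.intro atomless_finite_measure_axioms.intro fin)
    fix A show "\<not> measure_atom N A"
    proof
      assume A: "measure_atom N A"
      then have AE: "A \<subseteq> E" "A \<in> sets M" by (auto simp: measure_atom_def sets_N)
      have "emeasure M C = 0 \<or> emeasure M (A - C) = 0" if "C \<in> sets M" "C \<subseteq> A" for C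
      proof -
        have "C \<in> sets N" "C \<subseteq> E" "A - C \<subseteq> E" using that AE by (auto simp: sets_N)
        then show ?thesis using A that by (metis emeasure_N measure_atom_def)
      qed
      then have "measure_atom M A"
        using A AE by (auto simp: measure_atom_def emeasure_N)
      with E(4)[OF AE(1)] show False by blast
    qed
  qed
  have EN: "E \<in> sets N" using E(1) by (simp add: sets_N)
  define E1 where "E1 = N.halve E"
  define E2 where "E2 = E - E1"
  define a where "a = measure M E / 2"
  have E1: "E1 \<in> sets N" "E1 \<subseteq> E" "measure N E1 = a"
    using N.halve[OF EN] by (auto simp: E1_def a_def measure_N)
  have "measure N E2 = measure N E - measure N E1"
    unfolding E2_def by (rule N.finite_measure_Diff[OF EN E1(1,2)])
  then have E2: "E2 \<in> sets N" "E2 \<subseteq> E" "measure N E2 = a"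
    using EN E1(1,3) by (auto simp: E2_def a_def measure_N)
  have a: "0 < a" using E by (simp add: a_def measure_def enn2real_positive_iff)
  have em: "emeasure M E1 = ennreal a" "emeasure M E2 = ennreal a"
    using N.emeasure_eq_measure[of E1] N.emeasure_eq_measure[of E2] E1 E2 by (simp_all add: emeasure_N)
  obtain H1 where H1': "\<forall>n::nat. H1 n \<in> sets N \<and> H1 n \<subseteq> E1 \<and> measure N (H1 n) = measure N E1 / 2 \<and>
    (\<forall>m. m \<noteq> n \<longrightarrow> measure N (H1 m \<inter> H1 n) = measure N E1 / 4)"
    using N.ex_independent_halves[OF E1(1)] ..
  then have H1: "H1 n \<in> sets N" "H1 n \<subseteq> E1" "measure N (H1 n) = measure N E1 / 2"
    "m \<noteq> n \<Longrightarrow> measure N (H1 m \<inter> H1 n) = measure N E1 / 4" for m n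
    by simp_all
  obtain H2 where H2': "\<forall>n::nat. H2 n \<in> sets N \<and> H2 n \<subseteq> E2 \<and> measure N (H2 n) = measure N E2 / 2 \<and>
    (\<forall>m. m \<noteq> n \<longrightarrow> measure N (H2 m \<inter> H2 n) = measure N E2 / 4)"
    using N.ex_independent_halves[OF E2(1)] ..
  then have H2: "H2 n \<in> sets N" "H2 n \<subseteq> E2" "measure N (H2 n) = measure N E2 / 2"
    "m \<noteq> n \<Longrightarrow> measure N (H2 m \<inter> H2 n) = measure N E2 / 4" for m n
    by simp_all
  \<comment> \<open>The two sequences are joined index by index, so that one pair m, n serves both
    halves at once.\<close>
  define H where "H n = H1 n \<union> H2 n" for n
  have disj: "E1 \<inter> E2 = {}" by (auto simp: E2_def)
  have cut: "E1 \<inter> H n = H1 n" "E2 \<inter> H n = H2 n" for n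
    using H1(2)[of n] H2(2)[of n] disj by (auto simp: H_def)
  have cut2: "E1 \<inter> H m \<inter> H n = H1 m \<inter> H1 n" "E2 \<inter> H m \<inter> H n = H2 m \<inter> H2 n" for m n
    using cut by blast+
  have sub: "H1 n \<subseteq> E" "H2 n \<subseteq> E" "H1 m \<inter> H1 n \<subseteq> E" "H2 m \<inter> H2 n \<subseteq> E" for m n
    using H1(2)[of n] H2(2)[of n] E1(2) E2(2) by auto
  show thesis
  proof (rule that[of E1 E2 a H])
    show "E1 \<in> sets M" "E2 \<in> sets M" using E1 E2 by (auto simp: sets_N)
    show "E1 \<inter> E2 = {}" "0 < a" "emeasure M E1 = ennreal a" "emeasure M E2 = ennreal a"
      using disj a em by simp_all
    show "H n \<in> sets M" "H n \<subseteq> E1 \<union> E2" for n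
      using H1(1,2)[of n] H2(1,2)[of n] by (auto simp: H_def sets_N)
    show "measure M (E1 \<inter> H n) = a / 2" "measure M (E2 \<inter> H n) = a / 2" for n
      using H1(3)[of n] H2(3)[of n] E1(3) E2(3) by (simp_all add: cut measure_N[OF sub(1)] measure_N[OF sub(2)])
    show "measure M (E1 \<inter> H m \<inter> H n) = a / 4" "measure M (E2 \<inter> H m \<inter> H n) = a / 4" if "m \<noteq> n" for m n
      using H1(4)[OF that] H2(4)[OF that] E1(3) E2(3) by (simp_all add: cut2 measure_N[OF sub(3)] measure_N[OF sub(4)])
  qed
qed

section \<open>Property (M)\<close>

text \<open>Pigeonhole: infinitely many images share the finitely many centres of a net, so two of
  them have a common centre.\<close>

lemma (in complex_banach_space) compact_op_close_pair:
  fixes X :: "nat \<Rightarrow> 'a"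
  assumes a: "compact_op E a" and X: "\<And>n. X n \<in> carrier E" "\<And>n. nrm E (X n) \<le> B" and \<epsilon>: "\<epsilon> > 0"
  obtains m n where "m \<noteq> n" "nrm E (a (X m) \<ominus> a (X n)) < \<epsilon>"
proof -
  note a' = compact_op_bounded[OF a]
  define b where "b = \<bar>B\<bar> + 1"
  have b: "b > 0" "B \<le> b" by (auto simp: b_def)
  define Y where "Y n = complex_of_real (inverse b) \<odot> X n" for n
  have Y: "Y n \<in> unit_ball E" for n
    using X[of n] b by (auto simp: Y_def unit_ball_def nrm_smult norm_inverse norm_divide field_simps intro: order_trans)
  have XY: "a (X n) = complex_of_real b \<odot> a (Y n)" for n
    using X b bounded_opsD(1,3)[OF a'] by (simp add: Y_def)
  have aY: "a (Y n) \<in> carrier E" for n using Y bounded_opsD(1)[OF a'] by (auto simp: unit_ball_def)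
  define \<delta> where "\<delta> = \<epsilon> / (2 * b)"
  have \<delta>: "\<delta> > 0" using \<epsilon> b by (simp add: \<delta>_def)
  obtain Z where Z: "finite Z" "Z \<subseteq> carrier E" "\<And>x. x \<in> unit_ball E \<Longrightarrow> \<exists>z\<in>Z. nrm E (a x \<ominus> z) < \<delta>"
    using compact_op_net[OF a \<delta>] by blast
  have "\<exists>z\<in>Z. nrm E (a (Y n) \<ominus> z) < \<delta>" for n by (rule Z(3)[OF Y])
  then obtain \<zeta> where \<zeta>: "\<And>n. \<zeta> n \<in> Z" "\<And>n. nrm E (a (Y n) \<ominus> \<zeta> n) < \<delta>" by metis
  have "\<not> inj \<zeta>"
    using Z(1) \<zeta>(1) finite_subset[of "range \<zeta>" Z] range_inj_infinite[of \<zeta>] by auto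
  then obtain m n where mn: "m \<noteq> n" "\<zeta> m = \<zeta> n" by (auto simp: inj_on_def)
  have z: "\<zeta> n \<in> carrier E" using \<zeta> Z by auto
  have "nrm E (a (Y m) \<ominus> a (Y n)) < 2 * \<delta>"
    using nrm_diff_trans[OF aY[of m] z aY[of n]] nrm_diff_commute[OF z aY[of n]] \<zeta>(2)[of m] \<zeta>(2)[of n] mn by simp
  then have "b * nrm E (a (Y m) \<ominus> a (Y n)) < b * (2 * \<delta>)" using b by simp
  also have "b * (2 * \<delta>) = \<epsilon>" using b by (simp add: \<delta>_def)
  also have "b * nrm E (a (Y m) \<ominus> a (Y n)) = nrm E (a (X m) \<ominus> a (X n))"
    using b aY by (simp add: XY nrm_smult flip: smult_diff_right)
  finally show thesis using that mn by blast
qed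

text \<open>The L-projection onto \<open>\<complex> chi\<close> kills the functional \<open>f\<close>, because \<open>f\<close> attains its norm on the
  compact operators.  Hence \<open>f + chi\<close> has norm 2, and operators almost attaining it are, after
  normalization, of the form \<open>a + 1\<close>.\<close>

lemma (in norming_space_noncompact) M_ideal_multiplier:
  assumes Mi: "M_ideal K1 (carrier K \<times> {0})"
    and f: "f \<in> bounded_ops K1 complex_line" "op_nrm K1 complex_line f \<le> 1"
    and a0: "compact_op E a0" "op_nrm E E a0 \<le> 1" "1 \<le> cmod (f (a0, 0))" and \<epsilon>: "\<epsilon> > 0"
  obtains a where "compact_op E a" "op_nrm E E (aug a 1) \<le> 1 + \<epsilon>" "1 - \<epsilon> \<le> Re (f (a, 1))"
proof -
  let ?D = "dual_space K1"
  interpret D: complex_normed_space ?D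
    unfolding dual_space_def by (rule K1_dual.op_space.complex_normed_space_axioms)
  have D_carrier: "carrier ?D = bounded_ops K1 complex_line" and D_nrm: "nrm ?D = op_nrm K1 complex_line"
    by (simp_all add: dual_space_def op_space_simps)
  have D_apply: "(g \<ominus>\<^bsub>?D\<^esub> h) X = g X - h X" if "g \<in> carrier ?D" "h \<in> carrier ?D" "X \<in> carrier K1" for g h X
    using K1_dual.op_space_diff[of g h X] that complex_normed_space.diff_smult[OF complex_normed_space_complex_line]
    unfolding D_carrier by (simp add: dual_space_def)
  have chi: "chi \<in> carrier ?D" "nrm ?D chi = 1" using chi_bounded by (simp_all add: D_carrier D_nrm)
  have fD: "f \<in> carrier ?D" using f by (simp add: D_carrier)
  obtain Q where Q: "Q \<in> bounded_ops ?D ?D" "compose (carrier ?D) Q Q = Q"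
    "\<And>g. g \<in> carrier ?D \<Longrightarrow> nrm ?D g = nrm ?D (Q g) + nrm ?D (g \<ominus>\<^bsub>?D\<^esub> Q g)"
    and ran: "Q ` carrier ?D = range (\<lambda>t. t \<odot>\<^bsub>?D\<^esub> chi)"
    using Mi unfolding M_ideal_def L_summand_def L_projection_def annihilator_unitization by auto
  have "1 \<odot>\<^bsub>?D\<^esub> chi \<in> Q ` carrier ?D" unfolding ran by blast
  then obtain g where g: "g \<in> carrier ?D" "chi = Q g" using chi by auto
  have Q_chi: "Q chi = chi"
    using fun_cong[OF Q(2), of g] g by (simp add: compose_eq)
  have "Q f \<in> range (\<lambda>t. t \<odot>\<^bsub>?D\<^esub> chi)" using fD ran by blast
  then obtain t where t: "Q f = t \<odot>\<^bsub>?D\<^esub> chi" by blast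
  have a0K: "(a0, 0) \<in> unit_ball K1" "(a0, 0) \<in> carrier K1"
    using a0 aug_0[OF compact_op_bounded[OF a0(1)]]
    by (simp_all add: unit_ball_def mem_unitization_iff nrm_unitization_eq)
  \<comment> \<open>\<open>chi\<close> vanishes at \<open>(a0, 0)\<close>, so subtracting
    \<open>Q f\<close> leaves the value there unchanged. The norm of f - Q f is thus at least 1,
    while that of \<open>f\<close> is at most 1, and the L-decomposition leaves nothing for
    \<open>Q f\<close>.\<close>
  have "(f \<ominus>\<^bsub>?D\<^esub> Q f) (a0, 0) = f (a0, 0)"
    using fD chi a0K by (simp add: D_apply t) (simp add: dual_space_def op_space_simps chi_def)
  moreover have "f \<ominus>\<^bsub>?D\<^esub> Q f \<in> bounded_ops K1 complex_line"
    using fD chi D.M.minus_closed[of f "Q f"] by (simp add: t flip: D_carrier)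
  ultimately have ge: "1 \<le> nrm ?D (f \<ominus>\<^bsub>?D\<^esub> Q f)"
    using K1_dual.op_nrm_unit_ball[OF _ a0K(1)] a0(3) by (fastforce simp: D_nrm)
  have Qf: "Q f \<in> carrier ?D" using chi by (simp add: t)
  have "nrm ?D (Q f) = 0" "1 \<le> nrm ?D f"
    using Q(3)[OF fD] ge f(2) D.nrm_nonneg[OF Qf] by (auto simp: D_nrm)
  then have "Q f = \<zero>\<^bsub>?D\<^esub>" using D.nrm_eq_0_iff[OF Qf] by simp
  then have Q_sum: "Q (chi \<oplus>\<^bsub>?D\<^esub> f) = chi"
    using bounded_opsD(2)[OF Q(1) chi(1) fD] Q_chi chi by simp
  have "nrm ?D (chi \<oplus>\<^bsub>?D\<^esub> f) = 1 + nrm ?D f"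
    using Q(3)[of "chi \<oplus>\<^bsub>?D\<^esub> f"] chi fD by (simp add: Q_sum)
  then have two: "2 \<le> op_nrm K1 complex_line (chi \<oplus>\<^bsub>?D\<^esub> f)" using \<open>1 \<le> nrm ?D f\<close> by (simp add: D_nrm)
  \<comment> \<open>If |s + f (b, s)| is almost 2 with both summands of modulus at most 1, then |s|
    is almost 1 and f (b, s) / s is almost 1.\<close>
  have approx: "\<exists>a. compact_op E a \<and> op_nrm E E (aug a 1) \<le> 1 / (1 - \<delta>) \<and>
      ((2 - \<delta>)\<^sup>2 - (1 / (1 - \<delta>))\<^sup>2 - 1) / 2 \<le> Re (f (a, 1))"
    if \<delta>: "0 < \<delta>" "\<delta> < 1" for \<delta>
  proof -
    have "\<exists>X\<in>unit_ball K1. 2 - \<delta> < cmod ((chi \<oplus>\<^bsub>?D\<^esub> f) X)"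
    proof (rule ccontr)
      assume "\<not> ?thesis"
      then have "op_nrm K1 complex_line (chi \<oplus>\<^bsub>?D\<^esub> f) \<le> 2 - \<delta>"
        by (intro K1_dual.op_nrm_leI) (simp add: not_less)
      with two \<delta> show False by simp
    qed
    then obtain b s where X: "(b, s) \<in> unit_ball K1" "2 - \<delta> < cmod ((chi \<oplus>\<^bsub>?D\<^esub> f) (b, s))" by auto
    have XK: "(b, s) \<in> carrier K1" using X by (simp add: unit_ball_def)
    then have b: "compact_op E b" and bK: "b \<in> carrier K" by (auto simp: mem_unitization_iff compact_op_algebra_simps)
    have "(chi \<oplus>\<^bsub>?D\<^esub> f) (b, s) = s + f (b, s)"
      using XK by (simp add: dual_space_def op_space_simps chi_def)
    then have big: "2 - \<delta> < cmod (s + f (b, s))" using X(2) by simp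
    have s1: "cmod s \<le> 1" using cmod_snd_le[OF XK] X(1) by (simp add: unit_ball_def)
    have f1: "cmod (f (b, s)) \<le> 1" using K1_dual.op_nrm_unit_ball[OF f(1) X(1)] f(2) by simp
    have s0: "cmod s > 1 - \<delta>" using big f1 norm_triangle_ineq[of s "f (b, s)"] by linarith
    then have sne: "s \<noteq> 0" "cmod s > 0" using \<delta> by auto
    \<comment> \<open>Division by \<open>s\<close> turns b + s1 into a + 1, at the cost of a factor
      at most 1 / (1 - \<delta>) in the norm.\<close>
    define a where "a = inverse s \<odot>\<^bsub>K\<^esub> b"
    have aK: "a \<in> carrier K" using bK by (simp add: a_def)
    then have a: "compact_op E a" by (simp add: compact_op_algebra_simps)
    have a1: "(a, 1) = inverse s \<odot>\<^bsub>K1\<^esub> (b, s)" using sne by (simp add: unitization_simps a_def)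
    have inv_s: "inverse (cmod s) \<le> 1 / (1 - \<delta>)"
      using s0 \<delta> by (simp add: divide_inverse le_imp_inverse_le)
    have "op_nrm E E (aug a 1) = nrm K1 (inverse s \<odot>\<^bsub>K1\<^esub> (b, s))"
      using a nrm_unitization_eq[OF a, of 1] by (simp add: a1)
    also have "\<dots> = inverse (cmod s) * nrm K1 (b, s)" using K1.nrm_smult[OF XK] by (simp add: norm_inverse)
    also have "\<dots> \<le> inverse (cmod s) * 1"
      using X(1) by (intro mult_left_mono) (auto simp: unit_ball_def)
    finally have n: "op_nrm E E (aug a 1) \<le> 1 / (1 - \<delta>)" using inv_s by simp
    define z where "z = f (a, 1)"
    have z: "z = inverse s * f (b, s)"
      using bounded_opsD(3)[OF f(1) XK, of "inverse s"] by (simp add: z_def a1)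
    have "cmod z = inverse (cmod s) * cmod (f (b, s))" by (simp add: z norm_mult norm_inverse)
    also have "\<dots> \<le> inverse (cmod s) * 1" by (intro mult_left_mono f1) simp
    finally have z_le: "cmod z \<le> 1 / (1 - \<delta>)" using inv_s by simp
    have "z + 1 = inverse s * (s + f (b, s))" using sne by (simp add: z field_simps)
    then have "cmod (z + 1) = inverse (cmod s) * cmod (s + f (b, s))" by (simp add: norm_mult norm_inverse)
    moreover have "1 * cmod (s + f (b, s)) \<le> inverse (cmod s) * cmod (s + f (b, s))"
      using s1 sne by (intro mult_right_mono) (simp_all add: one_le_inverse)
    ultimately have "2 - \<delta> \<le> cmod (z + 1)" using big by simp
    \<comment> \<open>The real part of \<open>z\<close> is read off from |z + 1|^2 = |z|^2 + 2 Re z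
      + 1: the left side is nearly 4 and |z|^2 at most about 1.\<close>
    then have "(2 - \<delta>)\<^sup>2 \<le> (cmod (z + 1))\<^sup>2" using \<delta> by (intro power_mono) auto
    also have "(cmod (z + 1))\<^sup>2 = (cmod z)\<^sup>2 + 2 * Re z + 1"
      unfolding cmod_power2 by (simp add: power2_eq_square algebra_simps)
    also have "(cmod z)\<^sup>2 \<le> (1 / (1 - \<delta>))\<^sup>2" using z_le by (intro power_mono) auto
    finally have "((2 - \<delta>)\<^sup>2 - (1 / (1 - \<delta>))\<^sup>2 - 1) / 2 \<le> Re z" by simp
    with a n show ?thesis by (auto simp: z_def)
  qed
  have "((\<lambda>\<delta>. 1 / (1 - \<delta>)) \<longlongrightarrow> 1) (at_right (0::real))"
    by (rule tendsto_eq_rhs, (rule tendsto_intros)+) auto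
  then have "\<forall>\<^sub>F \<delta> in at_right (0::real). 1 / (1 - \<delta>) < 1 + \<epsilon>" using \<epsilon> by (intro order_tendstoD) auto
  moreover have "((\<lambda>\<delta>. ((2 - \<delta>)\<^sup>2 - (1 / (1 - \<delta>))\<^sup>2 - 1) / 2) \<longlongrightarrow> 1) (at_right (0::real))"
    by (rule tendsto_eq_rhs, (rule tendsto_intros)+) auto
  then have "\<forall>\<^sub>F \<delta> in at_right (0::real). 1 - \<epsilon> < ((2 - \<delta>)\<^sup>2 - (1 / (1 - \<delta>))\<^sup>2 - 1) / 2"
    using \<epsilon> by (intro order_tendstoD) auto
  moreover have "\<forall>\<^sub>F \<delta> in at_right (0::real). 0 < \<delta> \<and> \<delta> < 1"
    using eventually_at_right_real[of 0 1] by (auto elim: eventually_mono)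
  ultimately have "\<forall>\<^sub>F \<delta> in at_right (0::real). 0 < \<delta> \<and> \<delta> < 1 \<and> 1 / (1 - \<delta>) < 1 + \<epsilon> \<and>
      1 - \<epsilon> < ((2 - \<delta>)\<^sup>2 - (1 / (1 - \<delta>))\<^sup>2 - 1) / 2"
    by eventually_elim auto
  then obtain \<delta> where "0 < \<delta>" "\<delta> < 1" "1 / (1 - \<delta>) < 1 + \<epsilon>" "1 - \<epsilon> < ((2 - \<delta>)\<^sup>2 - (1 / (1 - \<delta>))\<^sup>2 - 1) / 2"
    using eventually_happens' by (metis (mono_tags, lifting) trivial_limit_at_right_real)
  with approx[of \<delta>] that show thesis by (meson less_imp_le order_trans)
qed

section \<open>A quantitative form of strict convexity of t ^ p\<close>

lemma powr_tangent_strict: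
  fixes p x :: real
  assumes p: "1 < p" and x: "0 \<le> x" "x \<noteq> 1"
  shows "1 + p * (x - 1) < x powr p"
proof (cases "x = 0")
  case True
  then show ?thesis using p by simp
next
  case False
  have D: "DERIV (\<lambda>x. x powr p) y :> p * y powr (p - 1)" if "y > 0" for y
    using that by (auto intro!: derivative_eq_intros)
  consider "x < 1" | "x > 1" using x by linarith
  then show ?thesis
  proof cases
    case 1
    obtain z where z: "x < z" "z < 1" "1 powr p - x powr p = (1 - x) * (p * z powr (p - 1))"
      using MVT2[OF 1, of "\<lambda>x. x powr p" "\<lambda>y. p * y powr (p - 1)"] D x False by force
    have "z powr (p - 1) < 1 powr (p - 1)" using z x p by (intro powr_less_mono2) auto
    then have "(1 - x) * (p * z powr (p - 1)) < (1 - x) * (p * 1)"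
      using 1 p by (intro mult_strict_left_mono) auto
    with z show ?thesis by (simp add: algebra_simps)
  next
    case 2
    obtain z where z: "1 < z" "z < x" "x powr p - 1 powr p = (x - 1) * (p * z powr (p - 1))"
      using MVT2[OF 2, of "\<lambda>x. x powr p" "\<lambda>y. p * y powr (p - 1)"] D by force
    have "1 powr (p - 1) < z powr (p - 1)" using z p by (intro powr_less_mono2) auto
    then have "(x - 1) * (p * 1) < (x - 1) * (p * z powr (p - 1))"
      using 2 p by (intro mult_strict_left_mono) auto
    with z show ?thesis by (simp add: algebra_simps)
  qed
qed

text \<open>The bracket is the gap in the tangent inequality at 1 and vanishes only at w = 1. Near 1
  the term \<epsilon> covers the left side; far away the gap itself grows like |w| ^ p; on the
  compact annulus in between it has a positive minimum.\<close>

lemma powr_deficit_near_1: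
  fixes p \<epsilon> :: real
  assumes p: "1 < p" and \<epsilon>: "0 < \<epsilon>"
  obtains C where "1 \<le> C" "\<And>w. cmod (w - 1) powr p \<le> \<epsilon> + C * (cmod w powr p - 1 - p * (Re w - 1))"
proof -
  define D where "D w = cmod w powr p - 1 - p * (Re w - 1)" for w
  have D_ge: "cmod w powr p - 1 - p * (cmod w - 1) \<le> D w" for w
    using p complex_Re_le_cmod[of w] by (simp add: D_def)
  have D0: "0 \<le> D w" for w
    using D_ge[of w] powr_tangent[OF p, of "cmod w" 1] by simp
  have Dpos: "0 < D w" if "w \<noteq> 1" for w
  proof (cases "cmod w = 1")
    case False
    then show ?thesis using D_ge[of w] powr_tangent_strict[OF p, of "cmod w"] by simp
  next
    case True
    have "Re w \<noteq> 1"
    proof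
      assume "Re w = 1"
      with True have "Im w = 0" using cmod_power2[of w] by simp
      with \<open>Re w = 1\<close> that show False by (simp add: complex_eq_iff)
    qed
    then have "Re w < 1" using True complex_Re_le_cmod[of w] by simp
    then show ?thesis using True p mult_pos_neg[of p "Re w - 1"] by (simp add: D_def)
  qed
  define \<delta> where "\<delta> = \<epsilon> powr (1 / p)"
  have \<delta>: "0 < \<delta>" "\<delta> powr p = \<epsilon>" using \<epsilon> p by (simp_all add: \<delta>_def powr_powr)
  \<comment> \<open>For t \<ge> T one has t ^ (p - 1) \<ge> 2 + 4p, so twice the affine part 1 + 2pt
    is absorbed by t ^ p.\<close>
  define T where "T = (2 + 4 * p) powr (1 / (p - 1))"
  have T: "T powr (p - 1) = 2 + 4 * p" "1 \<le> T" using p by (simp_all add: T_def powr_powr ge_one_powr_ge_zero)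
  have far: "cmod (w - 1) powr p \<le> (2 powr p * 2) * D w" if "cmod (w - 1) \<ge> 2 * T" for w
  proof -
    define t where "t = cmod (w - 1) / 2"
    have t: "T \<le> t" "1 \<le> t" using that T by (auto simp: t_def)
    have "2 + 4 * p \<le> t powr (p - 1)" using t T p powr_mono2[of "p - 1" T t] by simp
    then have "t * (2 + 4 * p) \<le> t powr p"
      using t mult_left_mono[of "2 + 4 * p" "t powr (p - 1)" t] powr_mult_base[of t "p - 1"] by simp
    moreover have "2 \<le> t * 2" using t by simp
    ultimately have 1: "2 + 4 * p * t \<le> t powr p" by (simp add: algebra_simps)
    have "cmod (w - 1) \<le> cmod w + 1" using norm_triangle_ineq4[of w 1] by simp
    then have "t \<le> cmod w" using t by (simp add: t_def)
    then have "t powr p \<le> cmod w powr p" using t p by (intro powr_mono2) auto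
    moreover have "Re w - 1 \<le> 2 * t" using complex_Re_le_cmod[of "w - 1"] by (simp add: t_def)
    then have "p * (Re w - 1) \<le> p * (2 * t)" using p by (intro mult_left_mono) auto
    ultimately have "t powr p \<le> 2 * D w" using 1 by (simp add: D_def algebra_simps)
    moreover have "cmod (w - 1) powr p = 2 powr p * t powr p"
      by (simp add: t_def powr_divide)
    ultimately show ?thesis by (simp add: mult.assoc)
  qed
  define A where "A = {w :: complex. \<delta> \<le> cmod (w - 1) \<and> cmod (w - 1) \<le> 2 * T}"
  have "A = cball 1 (2 * T) - ball 1 \<delta>" by (auto simp: A_def dist_norm norm_minus_commute)
  then have cA: "compact A" by (simp add: compact_diff)
  have contD: "continuous_on A D" unfolding D_def using p by (intro continuous_intros continuous_on_powr') auto
  obtain m where m: "0 < m" "\<And>w. w \<in> A \<Longrightarrow> m \<le> D w"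
  proof (cases "A = {}")
    case True
    then show ?thesis using that[of 1] by simp
  next
    case False
    obtain w0 where "w0 \<in> A" "\<And>w. w \<in> A \<Longrightarrow> D w0 \<le> D w"
      using continuous_attains_inf[OF cA False contD] by blast
    moreover have "w0 \<noteq> 1" using \<open>w0 \<in> A\<close> \<delta> by (auto simp: A_def)
    ultimately show ?thesis using that[of "D w0"] Dpos by blast
  qed
  \<comment> \<open>The last two entries serve the far region and the annulus; the bound 1 \<le> C
    is called for in \<open>powr_deficit\<close> at t = 0.\<close>
  define C where "C = max 1 (max (2 powr p * 2) ((2 * T) powr p / m))"
  have "cmod (w - 1) powr p \<le> \<epsilon> + C * D w" for w
  proof -
    consider "cmod (w - 1) \<le> \<delta>" | "w \<in> A" | "cmod (w - 1) \<ge> 2 * T"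
      unfolding A_def mem_Collect_eq by linarith
    then show ?thesis
    proof cases
      case 1
      then have "cmod (w - 1) powr p \<le> \<epsilon>" using powr_mono2[of p "cmod (w - 1)" \<delta>] \<delta> p by simp
      moreover have "0 \<le> C * D w" using D0[of w] by (simp add: C_def)
      ultimately show ?thesis by simp
    next
      case 2
      have "cmod (w - 1) powr p \<le> (2 * T) powr p" using 2 p by (intro powr_mono2) (auto simp: A_def)
      also have "\<dots> = ((2 * T) powr p / m) * m" using m by simp
      also have "\<dots> \<le> C * D w" using m(2)[OF 2] m(1) by (intro mult_mono) (auto simp: C_def)
      finally show ?thesis using \<epsilon> by simp
    next
      case 3
      have "(2 powr p * 2) * D w \<le> C * D w" using D0[of w] by (intro mult_right_mono) (auto simp: C_def)
      with far[OF 3] show ?thesis using \<epsilon> by simp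
    qed
  qed
  moreover have "1 \<le> C" by (simp add: C_def)
  ultimately show thesis using that by (simp add: D_def)
qed

text \<open>The previous estimate for w = z / t, multiplied by t ^ p. At t = 0 it degenerates to the
  comparison of |z| ^ p with C |z| ^ p.\<close>

lemma powr_deficit:
  fixes p \<epsilon> :: real
  assumes p: "1 < p" and \<epsilon>: "0 < \<epsilon>"
  obtains C where "1 \<le> C" "\<And>z t. 0 \<le> t \<Longrightarrow>
    cmod (z - complex_of_real t) powr p \<le> \<epsilon> * t powr p + C * (cmod z powr p + (p - 1) * t powr p - p * (t powr (p - 1) * Re z))"
proof -
  obtain C where C: "1 \<le> C" "\<And>w. cmod (w - 1) powr p \<le> \<epsilon> + C * (cmod w powr p - 1 - p * (Re w - 1))"
    using powr_deficit_near_1[OF p \<epsilon>] by blast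
  have "cmod (z - complex_of_real t) powr p \<le> \<epsilon> * t powr p + C * (cmod z powr p + (p - 1) * t powr p - p * (t powr (p - 1) * Re z))"
    if t: "0 \<le> t" for z t
  proof (cases "t = 0")
    case True
    then show ?thesis using C(1) mult_right_mono[OF C(1), of "cmod z powr p"] by simp
  next
    case False
    define w where "w = z / t"
    have z: "z = complex_of_real t * w" using False by (simp add: w_def)
    have tt: "t powr p = t powr (p - 1) * t" using t powr_mult_base[of t "p - 1"] by (simp add: mult.commute)
    have "cmod (z - complex_of_real t) = t * cmod (w - 1)"
      using t by (simp add: z norm_mult flip: right_diff_distrib[where c = 1, simplified])
        (metis abs_of_nonneg mult.right_neutral norm_mult norm_of_real right_diff_distrib)
    then have "cmod (z - complex_of_real t) powr p = t powr p * cmod (w - 1) powr p" by (simp add: powr_mult)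
    also have "\<dots> \<le> t powr p * (\<epsilon> + C * (cmod w powr p - 1 - p * (Re w - 1)))"
      using C(2) by (intro mult_left_mono) auto
    also have "\<dots> = \<epsilon> * t powr p + C * ((t powr p * cmod w powr p) + (p - 1) * t powr p - p * (t powr p * Re w))"
      by (simp add: algebra_simps)
    also have "t powr p * cmod w powr p = cmod z powr p" using t by (simp add: z norm_mult powr_mult)
    also have "t powr p * Re w = t powr (p - 1) * Re z" by (simp add: z tt)
    finally show ?thesis .
  qed
  with C(1) that show thesis by blast
qed

section \<open>From the multiplier to property (M) in L^p\<close>

context Lp_space
begin

text \<open>The pointwise estimate, integrated. If \<open>t\<close> has norm 1 and \<open>g\<close>
  has norm and pairing with the dual of \<open>t\<close> close to 1, the bracket is close to 1 + (p
  - 1) - p = 0, and \<open>g\<close> is close to \<open>t\<close>. This plays the part of uniform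
  convexity.\<close>

lemma near_maximizer:
  assumes \<epsilon>: "0 < \<epsilon>"
  obtains C where "1 \<le> C" "\<And>g t. \<lbrakk>g \<in> L; (\<lambda>x. complex_of_real (t x)) \<in> L; \<And>x. 0 \<le> t x\<rbrakk> \<Longrightarrow>
    Np (\<lambda>x. g x - complex_of_real (t x)) \<le> \<epsilon> * Np (\<lambda>x. complex_of_real (t x)) +
      C * (Np g + (p - 1) * Np (\<lambda>x. complex_of_real (t x))
        - p * Re (dual_op (\<lambda>x. complex_of_real (t x)) (cls g)))"
proof -
  obtain C where C: "1 \<le> C" "\<And>z t. 0 \<le> t \<Longrightarrow>
    cmod (z - complex_of_real t) powr p \<le> \<epsilon> * t powr p + C * (cmod z powr p + (p - 1) * t powr p - p * (t powr (p - 1) * Re z))"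
    using powr_deficit[OF p_gt_1 \<epsilon>] by blast
  show thesis
  proof (rule that[OF C(1)])
    fix g and t :: "'a \<Rightarrow> real"
    define u where "u x = complex_of_real (t x)" for x
    assume g: "g \<in> L" and "(\<lambda>x. complex_of_real (t x)) \<in> L" and t: "\<And>x. 0 \<le> t x"
    then have u: "u \<in> L" by (simp add: u_def[abs_def])
    have cu: "cmod (u x) = t x" for x using t by (simp add: u_def)
    have "t x powr (p - 1) = t x * t x powr (p - 2)" for x using powr_mult_base[OF t, of x "p - 2"] by simp
    then have "dual_fun u x = complex_of_real (t x powr (p - 1))" for x
      unfolding dual_fun_def cu by (simp add: u_def)
    then have Re_dual: "Re (g x * dual_fun u x) = t x powr (p - 1) * Re (g x)" for x by simp
    have intu: "integrable M (\<lambda>x. t x powr p)" using L_integrable[OF u] by (simp add: cu)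
    have intg: "integrable M (\<lambda>x. cmod (g x) powr p)" by (rule L_integrable[OF g])
    have intd: "integrable M (\<lambda>x. t x powr (p - 1) * Re (g x))"
      using integrable_Re[OF dual_integrable[OF g u]] by (simp only: Re_dual)
    have "Np (\<lambda>x. g x - u x) \<le> (LINT x|M. \<epsilon> * t x powr p + C * (cmod (g x) powr p + (p - 1) * t x powr p - p * (t x powr (p - 1) * Re (g x))))"
      unfolding Np_def
    proof (rule integral_mono)
      show "integrable M (\<lambda>x. cmod (g x - u x) powr p)" by (rule L_integrable[OF L_diff[OF g u]])
      show "integrable M (\<lambda>x. \<epsilon> * t x powr p + C * (cmod (g x) powr p + (p - 1) * t x powr p - p * (t x powr (p - 1) * Re (g x))))"
        using intu intg intd by simp
    qed (use C(2)[OF t] in \<open>simp add: u_def\<close>)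
    also have "\<dots> = \<epsilon> * (LINT x|M. t x powr p) + C * ((LINT x|M. cmod (g x) powr p) + (p - 1) * (LINT x|M. t x powr p)
        - p * (LINT x|M. t x powr (p - 1) * Re (g x)))"
      using intu intg intd by simp
    also have "(LINT x|M. t x powr (p - 1) * Re (g x)) = Re (dual_op u (cls g))"
      using integral_Re[OF dual_integrable[OF g u]] by (simp add: dual_op_apply[OF g u] Re_dual del: times_complex.sel)
    also have "(LINT x|M. t x powr p) = Np u" by (simp add: Np_def cu)
    finally show "Np (\<lambda>x. g x - complex_of_real (t x)) \<le> \<epsilon> * Np (\<lambda>x. complex_of_real (t x)) +
      C * (Np g + (p - 1) * Np (\<lambda>x. complex_of_real (t x)) - p * Re (dual_op (\<lambda>x. complex_of_real (t x)) (cls g)))"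
      by (simp add: Np_def u_def[abs_def])
  qed
qed

text \<open>A contraction-like \<open>a + 1\<close> moving \<open>\<xi>\<close> close to \<open>\<eta>\<close> almost fixes the difference of two
  suitably chosen \<open>x n\<close>, as \<open>a\<close> is compact.  This is Kalton's property (M).\<close>

lemma property_M:
  assumes Mi: "M_ideal (mult_unitization (compact_op_algebra (Lp p M))) (carrier (compact_op_algebra (Lp p M)) \<times> {0})"
    and nc: "\<not> compact_op (Lp p M) (\<lambda>x\<in>carrier (Lp p M). x)"
    and \<xi>: "\<xi> \<in> L" "Np \<xi> = 1"
    and \<eta>: "(\<lambda>x. complex_of_real (t x)) \<in> L" "\<And>x. 0 \<le> t x" "Np (\<lambda>x. complex_of_real (t x)) = 1"
    and X: "\<And>n::nat. X n \<in> L" "\<And>n. Np (X n) \<le> B" and \<epsilon>: "0 < \<epsilon>"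
  obtains m n where "m \<noteq> n"
    "Np (\<lambda>x. complex_of_real (t x) + (X m x - X n x)) powr (1 / p) \<le> (1 + \<epsilon>) * Np (\<lambda>x. \<xi> x + (X m x - X n x)) powr (1 / p) + \<epsilon>"
proof -
  interpret nn: norming_space_noncompact "Lp p M" by unfold_locales (rule nc)
  define \<eta> where "\<eta> = (\<lambda>x. complex_of_real (t x))"
  have \<eta>L: "\<eta> \<in> L" and N\<eta>: "Np \<eta> = 1" using \<eta> by (simp_all add: \<eta>_def)
  interpret dp: normed_space_pair "Lp p M" complex_line by (rule Lp.dual_pair)
  \<comment> \<open>The vector functional sending a + s1 to the pairing of (a + s1) \<xi> with the
    dual of \<eta>.\<close>
  define f where "f = (\<lambda>X\<in>carrier Lp.K1. dual_op \<eta> (Lp.aug (fst X) (snd X) (cls \<xi>)))"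
  have \<xi>E: "cls \<xi> \<in> carrier (Lp p M)" "nrm (Lp p M) (cls \<xi>) = 1" using \<xi> by (auto simp: Lp_nrm)
  have \<eta>E: "cls \<eta> \<in> carrier (Lp p M)" "nrm (Lp p M) (cls \<eta>) = 1" using \<eta>L N\<eta> by (auto simp: Lp_nrm)
  note dop = dual_op_bounded[OF \<eta>L]
  have f_apply: "f (a, s) = dual_op \<eta> (Lp.aug a s (cls \<xi>))" if "compact_op (Lp p M) a" for a s
    using that by (simp add: f_def nn.mem_unitization_iff)
  have aug_closed: "Lp.aug a s (cls \<xi>) \<in> carrier (Lp p M)" if "compact_op (Lp p M) a" for a s
    using bounded_opsD(1)[OF Lp.aug_bounded[OF Lp.compact_op_bounded[OF that]] \<xi>E(1)] .
  have f_le: "nrm complex_line (f X) \<le> 1 * nrm Lp.K1 X" if X: "X \<in> carrier Lp.K1" for X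
  proof -
    obtain a s where [simp]: "X = (a, s)" by (cases X)
    have a: "compact_op (Lp p M) a" using X by (simp add: nn.mem_unitization_iff)
    have "cmod (f X) \<le> Np \<eta> powr (1 - 1 / p) * nrm (Lp p M) (Lp.aug a s (cls \<xi>))"
      using dual_op_bound[OF \<eta>L aug_closed[OF a, of s]] by (simp add: f_apply[OF a])
    also have "\<dots> \<le> op_nrm (Lp p M) (Lp p M) (Lp.aug a s)"
      using Lp.ops.op_nrm_bound[OF Lp.aug_bounded[OF Lp.compact_op_bounded[OF a]] \<xi>E(1), of s] by (simp add: N\<eta> \<xi>E)
    finally show ?thesis by (simp add: nn.nrm_unitization_eq[OF a])
  qed
  have f: "f \<in> bounded_ops Lp.K1 complex_line"
  proof (rule bounded_opsI[OF _ _ _ _ f_le])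
    fix X Y c assume X: "X \<in> carrier Lp.K1"
    obtain a s where [simp]: "X = (a, s)" by (cases X)
    have a: "compact_op (Lp p M) a" using X by (simp add: nn.mem_unitization_iff)
    note a' = Lp.compact_op_bounded[OF a]
    have "c \<odot>\<^bsub>Lp.K1\<^esub> X \<in> carrier Lp.K1" using X by (rule Lp.K1.smult_closed')
    then show "f (c \<odot>\<^bsub>Lp.K1\<^esub> X) = c \<odot>\<^bsub>complex_line\<^esub> f X"
      using X aug_closed[OF a, of s] bounded_opsD(3)[OF dop(1)] \<xi>E
      by (simp add: f_def Lp.unitization_simps(4) Lp.aug_smult[OF a'])
    assume Y: "Y \<in> carrier Lp.K1"
    obtain b r where [simp]: "Y = (b, r)" by (cases Y)
    have b: "compact_op (Lp p M) b" using Y by (simp add: nn.mem_unitization_iff)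
    note b' = Lp.compact_op_bounded[OF b]
    have "X \<oplus>\<^bsub>Lp.K1\<^esub> Y \<in> carrier Lp.K1" using X Y by (rule Lp.K1.M.a_closed)
    then show "f (X \<oplus>\<^bsub>Lp.K1\<^esub> Y) = f X \<oplus>\<^bsub>complex_line\<^esub> f Y"
      using X Y aug_closed[OF a, of s] aug_closed[OF b, of r] bounded_opsD(2)[OF dop(1)] \<xi>E
      by (simp add: f_def Lp.unitization_simps(3) Lp.aug_add[OF a' b'])
  qed (auto simp: f_def extensional_def)
  have f1: "op_nrm Lp.K1 complex_line f \<le> 1" by (rule Lp.K1_dual.op_nrm_le[OF f_le]) auto
  \<comment> \<open>The rank-one contraction that takes \<xi> to \<eta>; \<open>f\<close> attains
    its norm there.\<close>
  define a0 where "a0 = (\<lambda>F\<in>carrier (Lp p M). dual_op \<xi> F \<odot>\<^bsub>Lp p M\<^esub> cls \<eta>)"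
  note rank = Lp.compact_op_rank_one[OF dual_op_bounded(1)[OF \<xi>(1)] \<eta>E(1), folded a0_def]
  have a0n: "op_nrm (Lp p M) (Lp p M) a0 \<le> 1"
    using rank(2) dual_op_bounded(2)[OF \<xi>(1)] by (simp add: \<eta>E \<xi>)
  have "Lp.aug a0 0 (cls \<xi>) = cls \<eta>"
    using \<xi>E \<eta>E \<xi> by (simp add: Lp.aug_apply a0_def dual_op_self)
  then have fa0: "f (a0, 0) = 1" using \<eta>L N\<eta> by (simp add: f_apply[OF rank(1)] dual_op_self)
  \<comment> \<open>The target is a distance \<epsilon> / 2 between (a + 1) \<xi> and \<eta>, that
    is (\<epsilon> / 2) ^ p for \<open>Np\<close>. One half of it goes to the first term of
    \<open>near_maximizer\<close>, the other to the term with \<open>C\<close>.\<close>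
  define \<epsilon>' where "\<epsilon>' = (\<epsilon> / 2) powr p / 2"
  have \<epsilon>': "0 < \<epsilon>'" using \<epsilon> by (simp add: \<epsilon>'_def)
  obtain C where C: "1 \<le> C" "\<And>g t. \<lbrakk>g \<in> L; (\<lambda>x. complex_of_real (t x)) \<in> L; \<And>x. 0 \<le> t x\<rbrakk> \<Longrightarrow>
    Np (\<lambda>x. g x - complex_of_real (t x)) \<le> \<epsilon>' * Np (\<lambda>x. complex_of_real (t x)) +
      C * (Np g + (p - 1) * Np (\<lambda>x. complex_of_real (t x))
        - p * Re (dual_op (\<lambda>x. complex_of_real (t x)) (cls g)))"
    using near_maximizer[OF \<epsilon>'] by blast
  \<comment> \<open>\<open>C\<close> depends only on \<epsilon>', so \<delta> may be chosen
    afterwards, small enough to offset it.\<close>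
  have "((\<lambda>\<delta>. C * ((1 + \<delta>) powr p + (p - 1) - p * (1 - \<delta>))) \<longlongrightarrow> C * ((1 + 0) powr p + (p - 1) - p * (1 - 0))) (at_right (0::real))"
    by (intro tendsto_intros) auto
  then have "((\<lambda>\<delta>. C * ((1 + \<delta>) powr p + (p - 1) - p * (1 - \<delta>))) \<longlongrightarrow> 0) (at_right (0::real))" by simp
  then have "\<forall>\<^sub>F \<delta> in at_right (0::real). C * ((1 + \<delta>) powr p + (p - 1) - p * (1 - \<delta>)) < \<epsilon>'"
    using \<epsilon>' by (intro order_tendstoD) auto
  moreover have "\<forall>\<^sub>F \<delta> in at_right (0::real). 0 < \<delta> \<and> \<delta> < \<epsilon>"
    using eventually_at_right_real[OF \<epsilon>] by (auto elim: eventually_mono)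
  ultimately have "\<forall>\<^sub>F \<delta> in at_right (0::real). C * ((1 + \<delta>) powr p + (p - 1) - p * (1 - \<delta>)) < \<epsilon>' \<and> 0 < \<delta> \<and> \<delta> < \<epsilon>"
    by eventually_elim auto
  then obtain \<delta> where \<delta>: "C * ((1 + \<delta>) powr p + (p - 1) - p * (1 - \<delta>)) < \<epsilon>'" "0 < \<delta>" "\<delta> < \<epsilon>"
    using eventually_happens' by (metis (mono_tags, lifting) trivial_limit_at_right_real)
  obtain a where a: "compact_op (Lp p M) a" "op_nrm (Lp p M) (Lp p M) (Lp.aug a 1) \<le> 1 + \<delta>" "1 - \<delta> \<le> Re (f (a, 1))"
    using nn.M_ideal_multiplier[OF Mi f f1 rank(1) a0n _ \<delta>(2)] fa0 by auto
  note a' = Lp.compact_op_bounded[OF a(1)]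
  note aug' = Lp.aug_bounded[OF a', of 1]
  define G where "G = Lp.aug a 1 (cls \<xi>)"
  have GE: "G \<in> carrier (Lp p M)" using aug_closed[OF a(1)] by (simp add: G_def)
  then obtain g where g: "g \<in> L" "G = cls g" by (auto simp: Lp_carrier)
  have "nrm (Lp p M) G \<le> 1 + \<delta>"
    using Lp.ops.op_nrm_bound[OF aug' \<xi>E(1)] a(2) by (simp add: G_def \<xi>E)
  then have "nrm (Lp p M) G powr p \<le> (1 + \<delta>) powr p"
    using p_gt_1 Lp.nrm_nonneg[OF GE] by (intro powr_mono2) auto
  then have Ng: "Np g \<le> (1 + \<delta>) powr p" using g by (simp add: Lp_nrm_powr)
  have Re_g: "1 - \<delta> \<le> Re (dual_op \<eta> (cls g))"
    using a(3) g by (simp add: f_apply[OF a(1)] G_def)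
  have "Np (\<lambda>x. g x - \<eta> x) \<le> \<epsilon>' * 1 + C * (Np g + (p - 1) * 1 - p * Re (dual_op \<eta> (cls g)))"
    using C(2)[OF g(1) \<eta>(1,2)] N\<eta> unfolding \<eta>_def by simp
  also have "\<dots> \<le> \<epsilon>' * 1 + C * ((1 + \<delta>) powr p + (p - 1) * 1 - p * (1 - \<delta>))"
    using C(1) Ng Re_g p_gt_1 by (intro add_left_mono mult_left_mono diff_mono add_mono) auto
  also have "\<dots> \<le> (\<epsilon> / 2) powr p" using \<delta>(1) by (simp add: \<epsilon>'_def)
  finally have "Np (\<lambda>x. g x - \<eta> x) powr (1 / p) \<le> ((\<epsilon> / 2) powr p) powr (1 / p)"
    using p_gt_1 Np_nonneg by (intro powr_mono2) auto
  then have G\<eta>: "nrm (Lp p M) (G \<ominus>\<^bsub>Lp p M\<^esub> cls \<eta>) \<le> \<epsilon> / 2"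
    using g \<eta>L L_diff \<epsilon> p_gt_1 by (simp add: Lp_diff Lp_nrm powr_powr)
  have "nrm (Lp p M) (cls (X n)) \<le> \<bar>B\<bar> powr (1 / p)" for n
    using X[of n] p_gt_1 Np_nonneg[of "X n"] by (simp add: Lp_nrm powr_mono2)
  \<comment> \<open>Only now, with \<open>a\<close> fixed, is the pair selected, by compactness of
    \<open>a\<close>.\<close>
  then obtain m n where mn: "m \<noteq> n" "nrm (Lp p M) (a (cls (X m)) \<ominus>\<^bsub>Lp p M\<^esub> a (cls (X n))) < \<epsilon> / 2"
    using Lp.compact_op_close_pair[OF a(1), of "\<lambda>n. cls (X n)" "\<bar>B\<bar> powr (1 / p)" "\<epsilon> / 2"] X \<epsilon> by auto
  define r where "r = (\<lambda>x. X m x - X n x)"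
  have r: "r \<in> L" unfolding r_def by (rule L_diff[OF X(1) X(1)])
  have R: "cls r \<in> carrier (Lp p M)" using r by simp
  have "cls r = cls (X m) \<ominus>\<^bsub>Lp p M\<^esub> cls (X n)" using X by (simp add: r_def Lp_diff)
  then have ar: "nrm (Lp p M) (a (cls r)) < \<epsilon> / 2"
    using mn X by (simp add: Lp.ops.op_diff[OF a'])
  have arE: "a (cls r) \<in> carrier (Lp p M)" using bounded_opsD(1)[OF a' R] .
  have sumE: "cls \<xi> \<oplus>\<^bsub>Lp p M\<^esub> cls r \<in> carrier (Lp p M)" "cls \<eta> \<oplus>\<^bsub>Lp p M\<^esub> cls r \<in> carrier (Lp p M)"
    using \<xi>E \<eta>E R by auto
  \<comment> \<open>(a + 1)(\<xi> + r) = (a + 1) \<xi> + r + a r, where the first term is within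
    \<epsilon> / 2 of \<eta> and the last is smaller than \<epsilon> / 2.\<close>
  define V where "V = Lp.aug a 1 (cls \<xi> \<oplus>\<^bsub>Lp p M\<^esub> cls r)"
  have VE: "V \<in> carrier (Lp p M)" unfolding V_def using bounded_opsD(1)[OF aug' sumE(1)] .
  have "V = G \<oplus>\<^bsub>Lp p M\<^esub> (a (cls r) \<oplus>\<^bsub>Lp p M\<^esub> cls r)"
    unfolding V_def G_def using \<xi>E R bounded_opsD(2)[OF aug' \<xi>E(1) R] by (simp add: Lp.aug_apply[OF R])
  also have "\<dots> = (G \<oplus>\<^bsub>Lp p M\<^esub> cls r) \<oplus>\<^bsub>Lp p M\<^esub> a (cls r)"
    using GE R arE by (simp add: Lp.M.a_ac)
  finally have "V \<ominus>\<^bsub>Lp p M\<^esub> (cls \<eta> \<oplus>\<^bsub>Lp p M\<^esub> cls r) = (G \<ominus>\<^bsub>Lp p M\<^esub> cls \<eta>) \<oplus>\<^bsub>Lp p M\<^esub> a (cls r)"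
  proof -
    assume V: "V = (G \<oplus>\<^bsub>Lp p M\<^esub> cls r) \<oplus>\<^bsub>Lp p M\<^esub> a (cls r)"
    have "V \<ominus>\<^bsub>Lp p M\<^esub> (cls \<eta> \<oplus>\<^bsub>Lp p M\<^esub> cls r) = (G \<oplus>\<^bsub>Lp p M\<^esub> (cls r \<oplus>\<^bsub>Lp p M\<^esub> a (cls r))) \<ominus>\<^bsub>Lp p M\<^esub> (cls \<eta> \<oplus>\<^bsub>Lp p M\<^esub> cls r)"
      using GE R arE by (simp add: V Lp.M.a_assoc)
    also have "\<dots> = (G \<ominus>\<^bsub>Lp p M\<^esub> cls \<eta>) \<oplus>\<^bsub>Lp p M\<^esub> ((cls r \<oplus>\<^bsub>Lp p M\<^esub> a (cls r)) \<ominus>\<^bsub>Lp p M\<^esub> cls r)"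
      using GE R arE \<eta>E by (intro Lp.add_diff_add) auto
    finally show ?thesis using R arE by simp
  qed
  then have "nrm (Lp p M) (V \<ominus>\<^bsub>Lp p M\<^esub> (cls \<eta> \<oplus>\<^bsub>Lp p M\<^esub> cls r)) \<le> \<epsilon>"
    using Lp.nrm_triangle[of "G \<ominus>\<^bsub>Lp p M\<^esub> cls \<eta>" "a (cls r)"] GE \<eta>E arE G\<eta> ar by simp
  then have "nrm (Lp p M) (cls \<eta> \<oplus>\<^bsub>Lp p M\<^esub> cls r) \<le> \<epsilon> + nrm (Lp p M) V"
    using Lp.nrm_le_diff[OF sumE(2) VE] Lp.nrm_diff_commute[OF sumE(2) VE] by simp
  also have "nrm (Lp p M) V \<le> op_nrm (Lp p M) (Lp p M) (Lp.aug a 1) * nrm (Lp p M) (cls \<xi> \<oplus>\<^bsub>Lp p M\<^esub> cls r)"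
    unfolding V_def by (rule Lp.ops.op_nrm_bound[OF aug' sumE(1)])
  also have "\<dots> \<le> (1 + \<epsilon>) * nrm (Lp p M) (cls \<xi> \<oplus>\<^bsub>Lp p M\<^esub> cls r)"
    using a(2) \<delta>(3) Lp.nrm_nonneg[OF sumE(1)] by (intro mult_right_mono) auto
  finally have "nrm (Lp p M) (cls \<eta> \<oplus>\<^bsub>Lp p M\<^esub> cls r) \<le> (1 + \<epsilon>) * nrm (Lp p M) (cls \<xi> \<oplus>\<^bsub>Lp p M\<^esub> cls r) + \<epsilon>" by simp
  then have "Np (\<lambda>x. \<eta> x + r x) powr (1 / p) \<le> (1 + \<epsilon>) * Np (\<lambda>x. \<xi> x + r x) powr (1 / p) + \<epsilon>"
    using \<eta>L \<xi>(1) r L_add by (simp add: Lp_add Lp_nrm)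
  with that[OF mn(1)] show thesis by (simp add: \<eta>_def r_def)
qed

end

text \<open>The mean of |k + \<kappa> \<sigma>| ^ p for a random \<sigma> equal to 1, -1, 0 with
  probabilities 1/4, 1/4, 1/2: the distribution of the difference of indicators of two independent
  halves.\<close>

definition sign_avg :: "real \<Rightarrow> real \<Rightarrow> real \<Rightarrow> real" where
  "sign_avg p \<kappa> k = (\<bar>k + \<kappa>\<bar> powr p + \<bar>k - \<kappa>\<bar> powr p) / 4 + \<bar>k\<bar> powr p / 2"

lemma sign_avg_scale: "0 < \<kappa> \<Longrightarrow> sign_avg p \<kappa> k = \<kappa> powr p * sign_avg p 1 (k / \<kappa>)"
proof -
  assume \<kappa>: "0 < \<kappa>"
  have "\<bar>k + \<kappa>\<bar> = \<kappa> * \<bar>k / \<kappa> + 1\<bar>" "\<bar>k - \<kappa>\<bar> = \<kappa> * \<bar>k / \<kappa> - 1\<bar>"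
    using \<kappa> abs_mult[of \<kappa> "k / \<kappa> + 1"] abs_mult[of \<kappa> "k / \<kappa> - 1"] by (simp_all add: algebra_simps)
  then have "\<bar>k + \<kappa>\<bar> powr p = \<kappa> powr p * \<bar>k / \<kappa> + 1\<bar> powr p" "\<bar>k - \<kappa>\<bar> powr p = \<kappa> powr p * \<bar>k / \<kappa> - 1\<bar> powr p"
    by (simp_all only: powr_mult)
  moreover have "\<bar>k\<bar> powr p = \<kappa> powr p * \<bar>k / \<kappa>\<bar> powr p"
    using \<kappa> by (simp add: powr_divide abs_divide)
  ultimately show ?thesis unfolding sign_avg_def by (simp only: distrib_left times_divide_eq_right)
qed

text \<open>Iterating the equation along u = c ^ n with c = 2 ^ (1/p) gives the value 1/2 + 2 ^ n 2
  ^ p / 4 at c ^ n. But \<open>sign_avg p 1 u\<close> behaves like u ^ p at infinity, that is like 2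
  ^ n at c ^ n. Hence 2 ^ p = 4.\<close>

lemma sign_avg_affine_imp_p_eq_2:
  fixes p :: real
  assumes p: "1 < p"
    and affine: "\<And>u. 0 < u \<Longrightarrow> sign_avg p 1 (2 powr (1 / p) * u) + sign_avg p 1 0 = 2 * sign_avg p 1 u"
  shows "p = 2"
proof -
  define c where "c = (2::real) powr (1 / p)"
  have c: "0 < c" "1 < c" "c powr p = 2" using p by (simp_all add: c_def powr_powr gr_one_powr)
  have zero: "sign_avg p 1 0 = 1 / 2" by (simp add: sign_avg_def)
  have iter: "sign_avg p 1 (c ^ n) - 1 / 2 = 2 ^ n * (2 powr p / 4)" for n
  proof (induction n)
    case 0
    then show ?case by (simp add: sign_avg_def)
  next
    case (Suc n)
    have "sign_avg p 1 (c ^ Suc n) + 1 / 2 = 2 * sign_avg p 1 (c ^ n)"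
      using affine[of "c ^ n"] c by (simp add: zero c_def)
    with Suc show ?case by simp
  qed
  \<comment> \<open>Homogeneity turns growth at infinity into the limit \<kappa> -> 0 of
    \<open>sign_avg p \<kappa> 1\<close>, where continuity gives the value 1.\<close>
  have eq: "sign_avg p ((1 / c) ^ n) 1 = 2 powr p / 4 + (1 / 2) * (1 / 2) ^ n" for n
  proof -
    define v where "v = c ^ n"
    have "(c ^ n) powr p = (c powr p) ^ n"
      using c(1) by (simp add: powr_realpow[symmetric] powr_powr mult.commute)
    then have v: "0 < v" "v powr p = 2 ^ n" using c by (simp_all add: v_def)
    have "sign_avg p (1 / v) 1 = (1 / v) powr p * sign_avg p 1 v"
      using sign_avg_scale[of "1 / v" p 1] v by simp
    also have "(1 / v) powr p = (1 / 2) ^ n" using v by (simp add: powr_divide power_one_over)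
    also have "sign_avg p 1 v = 2 ^ n * (2 powr p / 4) + 1 / 2" using iter[of n] by (simp add: v_def)
    also have "(1 / 2) ^ n * (2 ^ n * (2 powr p / 4) + 1 / 2) = 2 powr p / 4 + (1 / 2) * (1 / 2) ^ n"
      by (simp add: distrib_left power_one_over)
    finally show ?thesis by (simp add: v_def power_one_over)
  qed
  have "(\<lambda>n. (1 / c) ^ n) \<longlonglongrightarrow> 0" using c by (intro LIMSEQ_power_zero) simp
  then have "(\<lambda>n. sign_avg p ((1 / c) ^ n) 1) \<longlonglongrightarrow> (\<bar>1 + 0\<bar> powr p + \<bar>1 - 0\<bar> powr p) / 4 + \<bar>1\<bar> powr p / 2"
    unfolding sign_avg_def by (intro tendsto_intros) (use c in auto)
  moreover have "(\<lambda>n. 2 powr p / 4 + (1 / 2) * (1 / 2 :: real) ^ n) \<longlonglongrightarrow> 2 powr p / 4 + (1 / 2) * 0"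
    by (intro tendsto_intros LIMSEQ_power_zero) simp
  ultimately have "2 powr p / 4 = (1 :: real)"
    using LIMSEQ_unique unfolding eq by fastforce
  then have "2 powr p = (2::real) powr 2" by simp
  then show "p = 2" using powr_inj[of "2::real" p 2] by simp
qed

lemma le_if_le_scaled:
  fixes u v :: real
  assumes "\<And>\<epsilon>. 0 < \<epsilon> \<Longrightarrow> u \<le> (1 + \<epsilon>) * v + \<epsilon>" shows "u \<le> v"
proof (rule tendsto_le[OF _ _ tendsto_const])
  show "((\<lambda>\<epsilon>. (1 + \<epsilon>) * v + \<epsilon>) \<longlongrightarrow> v) (at_right (0::real))"
    by (rule tendsto_eq_rhs, (rule tendsto_intros)+) auto
  show "\<forall>\<^sub>F \<epsilon> in at_right (0::real). u \<le> (1 + \<epsilon>) * v + \<epsilon>"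
    using assms by (auto simp: eventually_at_right_less intro: eventually_mono[OF eventually_at_right_less])
qed simp

section \<open>Comparison of two step functions on an atomless set\<close>

context Lp_space
begin

text \<open>Inside \<open>E\<close> the difference of the indicators is 1 on A - B and -1 on B - A,
  each of measure a/2 - a/4, and 0 on the rest, of measure a/2.\<close>

lemma integral_sign_avg:
  assumes E: "E \<in> sets M" "emeasure M E = ennreal a" "0 < a" and A: "A \<in> sets M" and B: "B \<in> sets M"
    and m: "measure M (E \<inter> A) = a / 2" "measure M (E \<inter> B) = a / 2" "measure M (E \<inter> A \<inter> B) = a / 4"
  shows "integrable M (\<lambda>x. indicator E x * \<bar>k + \<kappa> * (indicator A x - indicator B x)\<bar> powr p)"
    and "(LINT x|M. indicator E x * \<bar>k + \<kappa> * (indicator A x - indicator B x)\<bar> powr p) = a * sign_avg p \<kappa> k"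
proof -
  have mE: "measure M E = a" using E by (simp add: measure_def)
  have fin: "emeasure M (E \<inter> C) < \<infinity>" for C
    using emeasure_mono[of "E \<inter> C" E M] E by (auto intro: le_less_trans)
  have int: "integrable M (indicator (E \<inter> C) :: 'a \<Rightarrow> real)" if "C \<in> sets M" for C
    using fin[of C] that E by (intro integrable_real_indicator) auto
  have intE: "integrable M (indicator E :: 'a \<Rightarrow> real)" using E by (intro integrable_real_indicator) auto
  have meas: "E \<inter> A \<in> sets M" "E \<inter> B \<in> sets M" "E \<inter> A \<inter> B \<in> sets M" using E A B by auto
  have intAB: "integrable M (indicator (E \<inter> A \<inter> B) :: 'a \<Rightarrow> real)"
    using int[of "A \<inter> B"] A B by (simp add: Int_assoc)
  have eq: "indicator E x * \<bar>k + \<kappa> * (indicator A x - indicator B x)\<bar> powr p =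
      \<bar>k\<bar> powr p * indicator E x
      + (\<bar>k + \<kappa>\<bar> powr p - \<bar>k\<bar> powr p) * (indicator (E \<inter> A) x - indicator (E \<inter> A \<inter> B) x)
      + (\<bar>k - \<kappa>\<bar> powr p - \<bar>k\<bar> powr p) * (indicator (E \<inter> B) x - indicator (E \<inter> A \<inter> B) x)" for x
    by (auto simp: indicator_def)
  show "integrable M (\<lambda>x. indicator E x * \<bar>k + \<kappa> * (indicator A x - indicator B x)\<bar> powr p)"
    unfolding eq using int[OF A] int[OF B] intE intAB by simp
  have "(LINT x|M. indicator E x * \<bar>k + \<kappa> * (indicator A x - indicator B x)\<bar> powr p)
      = \<bar>k\<bar> powr p * a + (\<bar>k + \<kappa>\<bar> powr p - \<bar>k\<bar> powr p) * (a / 2 - a / 4) + (\<bar>k - \<kappa>\<bar> powr p - \<bar>k\<bar> powr p) * (a / 2 - a / 4)"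
    unfolding eq using int[OF A] int[OF B] intE intAB meas E(1)
    by (simp add: m mE)
  then show "(LINT x|M. indicator E x * \<bar>k + \<kappa> * (indicator A x - indicator B x)\<bar> powr p) = a * sign_avg p \<kappa> k"
    by (simp add: sign_avg_def algebra_simps)
qed

text \<open>Functions with one nonnegative value on each of \<open>E1\<close> and \<open>E2\<close>
  suffice for \<xi> and \<eta>. Property (M) makes the sum of the two averages independent of the
  choice of a normalized pair of values.\<close>

theorem M_approximately_unital_imp_purely_atomic:
  assumes dec: "decomposable M" and p2: "p \<noteq> 2"
    and Mi: "M_ideal (mult_unitization (compact_op_algebra (Lp p M))) (carrier (compact_op_algebra (Lp p M)) \<times> {0})"
  shows "purely_atomic M"
proof (rule ccontr)
  assume "\<not> purely_atomic M"
  then obtain E1 E2 a H where E: "E1 \<in> sets M" "E2 \<in> sets M" "E1 \<inter> E2 = {}" and a: "0 < a"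
    and em: "emeasure M E1 = ennreal a" "emeasure M E2 = ennreal a"
    and H: "\<And>n::nat. H n \<in> sets M" "\<And>n. H n \<subseteq> E1 \<union> E2"
    and m1: "\<And>n. measure M (E1 \<inter> H n) = a / 2" "\<And>n. measure M (E2 \<inter> H n) = a / 2"
    and m2: "\<And>m n. m \<noteq> n \<Longrightarrow> measure M (E1 \<inter> H m \<inter> H n) = a / 4"
    "\<And>m n. m \<noteq> n \<Longrightarrow> measure M (E2 \<inter> H m \<inter> H n) = a / 4"
    using not_purely_atomic_halves[OF dec] by metis
  define t where "t k1 k2 x = k1 * indicator E1 x + k2 * indicator E2 x" for k1 k2 :: real and x
  define X where "X \<kappa> n x = complex_of_real \<kappa> * indicator (H n) x" for \<kappa> :: real and n x
  have fin: "emeasure M E1 < \<infinity>" "emeasure M E2 < \<infinity>" using em by auto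
  have mH: "emeasure M (H n) \<le> ennreal (2 * a)" for n
  proof -
    have "emeasure M (H n) \<le> emeasure M (E1 \<union> E2)" using E H by (intro emeasure_mono) auto
    also have "\<dots> = ennreal a + ennreal a" using plus_emeasure[OF E(1,2,3)] em by simp
    also have "\<dots> = ennreal (2 * a)" using a by (simp flip: ennreal_plus)
    finally show ?thesis .
  qed
  have finH: "emeasure M (H n) < \<infinity>" for n using mH[of n] by (auto intro: le_less_trans)
  have tL: "(\<lambda>x. complex_of_real (t k1 k2 x)) \<in> L" for k1 k2
  proof -
    have "(\<lambda>x. complex_of_real k1 * indicator E1 x + complex_of_real k2 * indicator E2 x) \<in> L"
      using E fin by (intro L_add L_indicator) auto
    moreover have "complex_of_real (t k1 k2 x) = complex_of_real k1 * indicator E1 x + complex_of_real k2 * indicator E2 x" for x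
      by (simp add: t_def indicator_def)
    ultimately show ?thesis by simp
  qed
  have XL: "X \<kappa> n \<in> L" for \<kappa> n
    unfolding X_def by (rule L_indicator[OF H(1) finH])
  have NX: "Np (X \<kappa> n) \<le> \<bar>\<kappa>\<bar> powr p * (2 * a)" for \<kappa> n
  proof -
    have "Np (X \<kappa> n) = (LINT x|M. \<bar>\<kappa>\<bar> powr p * indicator (H n) x)"
      unfolding Np_def by (rule Bochner_Integration.integral_cong) (auto simp: X_def indicator_def)
    also have "\<dots> = \<bar>\<kappa>\<bar> powr p * measure M (H n)" using H(1) by simp
    also have "measure M (H n) \<le> 2 * a"
      using mH[of n] a finH[of n] by (simp add: emeasure_eq_ennreal_measure)
    finally show ?thesis by (simp add: mult_left_mono)
  qed
  have Np_eq: "Np (\<lambda>x. complex_of_real (t k1 k2 x) + (X \<kappa> m x - X \<kappa> n x)) = a * (sign_avg p \<kappa> k1 + sign_avg p \<kappa> k2)"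
    if mn: "m \<noteq> n" for m n k1 k2 \<kappa>
  proof -
    let ?r = "\<lambda>x. \<kappa> * (indicator (H m) x - indicator (H n) x)"
    have "cmod (complex_of_real (t k1 k2 x) + (X \<kappa> m x - X \<kappa> n x)) powr p
        = indicator E1 x * \<bar>k1 + ?r x\<bar> powr p + indicator E2 x * \<bar>k2 + ?r x\<bar> powr p" for x
    proof -
      have "complex_of_real (t k1 k2 x) + (X \<kappa> m x - X \<kappa> n x) = complex_of_real (t k1 k2 x + ?r x)"
        by (simp add: X_def indicator_def)
      then have "cmod (complex_of_real (t k1 k2 x) + (X \<kappa> m x - X \<kappa> n x)) = \<bar>t k1 k2 x + ?r x\<bar>"
        by (simp only: norm_of_real)
      moreover have "x \<notin> E1 \<Longrightarrow> x \<notin> E2 \<Longrightarrow> x \<notin> H m \<and> x \<notin> H n" using H(2) by blast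
      ultimately show ?thesis
        using E(3) by (cases "x \<in> E1"; cases "x \<in> E2") (auto simp: t_def)
    qed
    then show ?thesis
      using integral_sign_avg[OF E(1) em(1) a H(1) H(1) m1(1) m1(1) m2(1)[OF mn], of k1 \<kappa>]
        integral_sign_avg[OF E(2) em(2) a H(1) H(1) m1(2) m1(2) m2(2)[OF mn], of k2 \<kappa>]
      by (simp add: Np_def distrib_left)
  qed
  \<comment> \<open>A compact identity would bring two of the \<open>X 1 n\<close> arbitrarily
    close, but all their mutual distances equal a ^ (1/p).\<close>
  have nc: "\<not> compact_op (Lp p M) (\<lambda>x\<in>carrier (Lp p M). x)"
  proof
    assume c: "compact_op (Lp p M) (\<lambda>x\<in>carrier (Lp p M). x)"
    have "nrm (Lp p M) (cls (X 1 n)) \<le> (2 * a) powr (1 / p)" for n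
      using XL[of 1 n] NX[of 1 n] Np_nonneg[of "X 1 n"] p_gt_1 by (simp add: Lp_nrm powr_mono2)
    then obtain m n where mn: "m \<noteq> n" "nrm (Lp p M) (cls (X 1 m) \<ominus>\<^bsub>Lp p M\<^esub> cls (X 1 n)) < a powr (1 / p)"
      using Lp.compact_op_close_pair[OF c, of "\<lambda>n. cls (X 1 n)" "(2 * a) powr (1 / p)" "a powr (1 / p)"] XL a by auto
    have "Np (\<lambda>x. X 1 m x - X 1 n x) = a"
      using Np_eq[OF mn(1), of 0 0 1] by (simp add: t_def sign_avg_def)
    then have "nrm (Lp p M) (cls (X 1 m) \<ominus>\<^bsub>Lp p M\<^esub> cls (X 1 n)) = a powr (1 / p)"
      using XL L_diff by (simp add: Lp_diff Lp_nrm)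
    with mn show False by simp
  qed
  \<comment> \<open>The case \<kappa> = 0, in which the perturbation disappears.\<close>
  have Np_t: "Np (\<lambda>x. complex_of_real (t k1 k2 x)) = a * (k1 powr p + k2 powr p)" if "0 \<le> k1" "0 \<le> k2" for k1 k2
    using Np_eq[of 0 1 k1 k2 0] that by (simp add: X_def sign_avg_def algebra_simps)
  \<comment> \<open>The norms in \<open>property_M\<close> do not depend on the selected m and n, so
    \<epsilon> can be sent to 0. The roles of \<open>k\<close> and \<open>l\<close> are symmetric,
    and exchanging them gives equality.\<close>
  have compare: "sign_avg p \<kappa> l1 + sign_avg p \<kappa> l2 \<le> sign_avg p \<kappa> k1 + sign_avg p \<kappa> k2"
    if k: "0 \<le> k1" "0 \<le> k2" "a * (k1 powr p + k2 powr p) = 1"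
      and l: "0 \<le> l1" "0 \<le> l2" "a * (l1 powr p + l2 powr p) = 1" for k1 k2 l1 l2 \<kappa>
  proof -
    have "(a * (sign_avg p \<kappa> l1 + sign_avg p \<kappa> l2)) powr (1 / p) \<le> (a * (sign_avg p \<kappa> k1 + sign_avg p \<kappa> k2)) powr (1 / p)"
    proof (rule le_if_le_scaled)
      fix \<epsilon> :: real assume \<epsilon>: "0 < \<epsilon>"
      obtain m n where "m \<noteq> n" "Np (\<lambda>x. complex_of_real (t l1 l2 x) + (X \<kappa> m x - X \<kappa> n x)) powr (1 / p)
          \<le> (1 + \<epsilon>) * Np (\<lambda>x. complex_of_real (t k1 k2 x) + (X \<kappa> m x - X \<kappa> n x)) powr (1 / p) + \<epsilon>"
      proof (rule property_M[OF Mi nc tL _ tL _ _ XL NX \<epsilon>])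
        show "Np (\<lambda>x. complex_of_real (t k1 k2 x)) = 1" "Np (\<lambda>x. complex_of_real (t l1 l2 x)) = 1"
          using k l by (simp_all add: Np_t)
        show "0 \<le> t l1 l2 x" for x using l by (simp add: t_def)
      qed
      then show "(a * (sign_avg p \<kappa> l1 + sign_avg p \<kappa> l2)) powr (1 / p)
          \<le> (1 + \<epsilon>) * (a * (sign_avg p \<kappa> k1 + sign_avg p \<kappa> k2)) powr (1 / p) + \<epsilon>"
        by (simp add: Np_eq)
    qed
    moreover have "0 \<le> sign_avg p \<kappa> k1 + sign_avg p \<kappa> k2" by (simp add: sign_avg_def)
    ultimately have "a * (sign_avg p \<kappa> l1 + sign_avg p \<kappa> l2) \<le> a * (sign_avg p \<kappa> k1 + sign_avg p \<kappa> k2)"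
      using a p_gt_1 powr_less_mono2[of "1 / p" "a * (sign_avg p \<kappa> k1 + sign_avg p \<kappa> k2)" "a * (sign_avg p \<kappa> l1 + sign_avg p \<kappa> l2)"]
      by (force simp: not_le[symmetric])
    then show ?thesis using a by simp
  qed
  \<comment> \<open>The constant that normalizes a function on both halves; \<open>c * s\<close>
    does the same for a function on \<open>E1\<close> alone.\<close>
  define s where "s = (1 / (2 * a)) powr (1 / p)"
  have s: "0 < s" "a * (s powr p + s powr p) = 1" using a p_gt_1 by (simp_all add: s_def powr_powr)
  define c where "c = (2::real) powr (1 / p)"
  have c: "0 < c" "c powr p = 2" using p_gt_1 by (simp_all add: c_def powr_powr)
  have cs: "a * ((c * s) powr p + 0 powr p) = 1" using s c by (simp add: powr_mult)
  have "p = 2"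
  proof (rule sign_avg_affine_imp_p_eq_2[OF p_gt_1])
    fix u :: real assume u: "0 < u"
    \<comment> \<open>The size of the perturbation is free, so by homogeneity the ratio s / \<kappa>
      can be any prescribed u > 0.\<close>
    define \<kappa> where "\<kappa> = s / u"
    have \<kappa>: "0 < \<kappa>" "s / \<kappa> = u" using s u by (simp_all add: \<kappa>_def)
    have "sign_avg p \<kappa> (c * s) + sign_avg p \<kappa> 0 = sign_avg p \<kappa> s + sign_avg p \<kappa> s"
      using compare[of s s "c * s" 0 \<kappa>] compare[of "c * s" 0 s s \<kappa>] s c cs by (intro antisym) auto
    moreover have "c * s / \<kappa> = c * u" using \<kappa>(2) by (simp flip: times_divide_eq_right)
    ultimately have "\<kappa> powr p * (sign_avg p 1 (c * u) + sign_avg p 1 0) = \<kappa> powr p * (2 * sign_avg p 1 u)"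
      using sign_avg_scale[OF \<kappa>(1), of p "c * s"] sign_avg_scale[OF \<kappa>(1), of p 0]
        sign_avg_scale[OF \<kappa>(1), of p s] by (simp add: \<kappa>(2) distrib_left)
    then show "sign_avg p 1 (2 powr (1 / p) * u) + sign_avg p 1 0 = 2 * sign_avg p 1 u"
      using \<kappa> by (simp add: c_def)
  qed
  with p2 show False by simp
qed

end

theorem proposition5p2:
  fixes p :: real and M :: "'a measure"
  assumes "1 < p" and "p \<noteq> 2"
    and "decomposable M"
  shows "M_approximately_unital (compact_op_algebra (Lp p M)) \<longleftrightarrow> purely_atomic M"
proof -
  interpret Lp_space p M by unfold_locales (rule assms(1))
  show ?thesis
    using M_approximately_unital_imp_purely_atomic[OF assms(3,2)]
      purely_atomic_imp_M_approximately_unital[OF assms(3)]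
    by (auto simp: M_approximately_unital_def)
qed

end
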